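(* Let $k\ge 2$, let $\varepsilon\in(0,1/4)$, and let $H=(V,E)$ be an $n$-vertex $k$-uniform hypergraph with dual VC-dimension $d$. Then $V$ has an equitable partition $V=V_1\cup\cdots\cup V_K$ with $8/\varepsilon\leq K\leq c(1/\varepsilon)^{2d+1}$ parts such that all but an $\varepsilon$-fraction of the $k$-tuples of parts are $\varepsilon$-homogeneous, where $c=c(d,k)$ is a constant depending only on $d$ and $k$. Moreover, there is an $O(n^k)$-time algorithm that computes such a partition.
   Context: For a $k$-uniform hypergraph $H=(V,E)$ and a vertex $v$, let $N(v)$ be the set of $(k-1)$-element subsets $S\subset V$ with $S\cup\{v\}\in E$. The dual VC-dimension of $H$ is the VC-dimension of the set system $\{N(v):v\in V\}$ on the ground set $\binom{V}{k-1}$, where the VC-dimension of a set system $\mathcal{F}$ on ground set $X$ is the largest $d$ such that some $d$-element $S\subset X$ satisfies: for every $B\subset S$ there is $A\in\mathcal{F}$ with $A\cap S=B$. For vertex sets $V_1,\dots,V_k$, $E(V_1,\dots,V_k)$ is the set of edges with exactly one vertex in each $V_i$, and the density across them is $|E(V_1,\ldots,V_k)|/(|V_1|\cdots|V_k|)$; the $k$-tuple $(V_1,\ldots,V_k)$ is $\varepsilon$-homogeneous if this density is less than $\varepsilon$ or greater than $1-\varepsilon$. A partition is equitable if any two parts differ in size by at most one. "All but an $\varepsilon$-fraction of the $k$-tuples of parts" refers to the $\binom{K}{k}$ unordered $k$-tuples of distinct parts.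
   Formalization: When n < 8/ε there are too few vertices for at least 8/ε nonempty parts, so in that case only, empty parts are allowed and a tuple containing an empty part is given density 0; for n ≥ 8/ε all parts are nonempty. *)

theory Defs
  imports Complex_Main "HOL-Library.Disjoint_Sets" "HOL-Library.Ramsey"
begin

definition uniform_hypergraph :: "nat \<Rightarrow> 'a set \<Rightarrow> 'a set set \<Rightarrow> bool" where
  "uniform_hypergraph k V E \<longleftrightarrow> finite V \<and> E \<subseteq> nsets V k"

definition nbhd :: "nat \<Rightarrow> 'a set \<Rightarrow> 'a set set \<Rightarrow> 'a \<Rightarrow> 'a set set" where
  "nbhd k V E v = {S \<in> nsets V (k - 1). S \<union> {v} \<in> E}"

definition shatters :: "'b set set \<Rightarrow> 'b set \<Rightarrow> bool" where
  "shatters F S \<longleftrightarrow> (\<forall>B\<subseteq>S. \<exists>A\<in>F. A \<inter> S = B)"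

text \<open>
  A relation rather than a function: the empty set system shatters nothing, not even the empty
  set, and so has no VC-dimension.
\<close>
definition has_vc_dim :: "'b set \<Rightarrow> 'b set set \<Rightarrow> nat \<Rightarrow> bool" where
  "has_vc_dim X F d \<longleftrightarrow>
     (\<exists>S\<in>nsets X d. shatters F S) \<and> (\<forall>m. \<forall>S\<in>nsets X m. shatters F S \<longrightarrow> m \<le> d)"

definition has_dual_vc_dim :: "nat \<Rightarrow> 'a set \<Rightarrow> 'a set set \<Rightarrow> nat \<Rightarrow> bool" where
  "has_dual_vc_dim k V E d \<longleftrightarrow> has_vc_dim (nsets V (k - 1)) (nbhd k V E ` V) d"

text \<open>
  Partitions are indexed families \<open>P 0, \<dots>, P (K - 1)\<close>; an unordered tuple of distinct parts is
  given by its set of indices.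
\<close>
definition cross_edges :: "'a set set \<Rightarrow> (nat \<Rightarrow> 'a set) \<Rightarrow> nat set \<Rightarrow> 'a set set" where
  "cross_edges E P I = {e \<in> E. \<forall>i\<in>I. card (e \<inter> P i) = 1}"

definition density :: "'a set set \<Rightarrow> (nat \<Rightarrow> 'a set) \<Rightarrow> nat set \<Rightarrow> real" where
  "density E P I = real (card (cross_edges E P I)) / real (\<Prod>i\<in>I. card (P i))"

definition homogeneous :: "real \<Rightarrow> 'a set set \<Rightarrow> (nat \<Rightarrow> 'a set) \<Rightarrow> nat set \<Rightarrow> bool" where
  "homogeneous \<epsilon> E P I \<longleftrightarrow> density E P I < \<epsilon> \<or> density E P I > 1 - \<epsilon>"

definition equitable_partition :: "'a set \<Rightarrow> nat \<Rightarrow> (nat \<Rightarrow> 'a set) \<Rightarrow> bool" where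
  "equitable_partition V K P \<longleftrightarrow>
     (\<Union>i<K. P i) = V \<and> disjoint_family_on P {..<K} \<and>
     (\<forall>i<K. \<forall>j<K. card (P i) \<le> card (P j) + 1)"

text \<open>
  If \<open>V\<close> has fewer than \<open>8 / \<epsilon>\<close> vertices, no partition into at least \<open>8 / \<epsilon>\<close> nonempty parts
  exists. Only in that case are empty parts admitted; a tuple containing an empty part then has
  density \<open>0 / 0 = 0\<close>.
\<close>
definition regular_partition ::
  "real \<Rightarrow> nat \<Rightarrow> nat \<Rightarrow> real \<Rightarrow> 'a set \<Rightarrow> 'a set set \<Rightarrow> nat \<Rightarrow> (nat \<Rightarrow> 'a set) \<Rightarrow> bool" where
  "regular_partition c k d \<epsilon> V E K P \<longleftrightarrow>
     equitable_partition V K P \<and>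
     (8 / \<epsilon> \<le> real (card V) \<longrightarrow> (\<forall>i<K. P i \<noteq> {})) \<and>
     8 / \<epsilon> \<le> real K \<and> real K \<le> c * (1 / \<epsilon>) ^ (2 * d + 1) \<and>
     real (card {I \<in> nsets {..<K} k. \<not> homogeneous \<epsilon> E P I}) \<le> \<epsilon> * real (K choose k)"

text \<open>
  Running time is measured on a word RAM, presented as a structured language with registers and
  arrays of natural numbers. A program mentions only finitely many registers and arrays, and
  every operation costs one time unit. Every value computed during a run, including addresses and
  intermediate results, must be at most the word bound \<open>W\<close>; a run that would exceed it is stuck.
\<close>
datatype binop = Plus | Minus | Times | Div | Mod

fun binop_val :: "binop \<Rightarrow> nat \<Rightarrow> nat \<Rightarrow> nat" where
  "binop_val Plus x y = x + y"
| "binop_val Minus x y = x - y"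
| "binop_val Times x y = x * y"
| "binop_val Div x y = x div y"
| "binop_val Mod x y = x mod y"

datatype expr = Lit nat | Reg nat | Arr nat expr | Bin binop expr expr

datatype prog =
    Skip
  | Assign nat expr
  | Store nat expr expr
  | Seq prog prog
  | Cond expr prog prog
  | Loop expr prog

text \<open>Contents of the registers and of the arrays.\<close>
type_synonym ram = "(nat \<Rightarrow> nat) \<times> (nat \<Rightarrow> nat \<Rightarrow> nat)"

fun val :: "ram \<Rightarrow> expr \<Rightarrow> nat" where
  "val s (Lit m) = m"
| "val s (Reg r) = fst s r"
| "val s (Arr a e) = snd s a (val s e)"
| "val s (Bin f e1 e2) = binop_val f (val s e1) (val s e2)"

fun fits :: "nat \<Rightarrow> ram \<Rightarrow> expr \<Rightarrow> bool" where
  "fits W s (Lit m) \<longleftrightarrow> m \<le> W"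
| "fits W s (Reg r) \<longleftrightarrow> fst s r \<le> W"
| "fits W s (Arr a e) \<longleftrightarrow> fits W s e \<and> val s (Arr a e) \<le> W"
| "fits W s (Bin f e1 e2) \<longleftrightarrow> fits W s e1 \<and> fits W s e2 \<and> val s (Bin f e1 e2) \<le> W"

fun cost :: "expr \<Rightarrow> nat" where
  "cost (Lit m) = 1"
| "cost (Reg r) = 1"
| "cost (Arr a e) = cost e + 1"
| "cost (Bin f e1 e2) = cost e1 + cost e2 + 1"

text \<open>
  \<open>run W p s t s'\<close>: started in \<open>s\<close>, program \<open>p\<close> halts in \<open>s'\<close> after \<open>t\<close> time units, with all
  values at most \<open>W\<close>. Guards are true if nonzero.
\<close>
inductive run :: "nat \<Rightarrow> prog \<Rightarrow> ram \<Rightarrow> nat \<Rightarrow> ram \<Rightarrow> bool" for W :: nat where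
  Skip: "run W Skip s 1 s"
| Assign: "fits W s e \<Longrightarrow>
    run W (Assign r e) s (cost e + 1) ((fst s)(r := val s e), snd s)"
| Store: "fits W s e1 \<Longrightarrow> fits W s e2 \<Longrightarrow>
    run W (Store a e1 e2) s (cost e1 + cost e2 + 1)
      (fst s, (snd s)(a := (snd s a)(val s e1 := val s e2)))"
| Seq: "run W p s t s' \<Longrightarrow> run W q s' t' s'' \<Longrightarrow> run W (Seq p q) s (t + t') s''"
| CondT: "fits W s e \<Longrightarrow> val s e \<noteq> 0 \<Longrightarrow> run W p s t s' \<Longrightarrow>
    run W (Cond e p q) s (cost e + 1 + t) s'"
| CondF: "fits W s e \<Longrightarrow> val s e = 0 \<Longrightarrow> run W q s t s' \<Longrightarrow>
    run W (Cond e p q) s (cost e + 1 + t) s'"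
| LoopT: "fits W s e \<Longrightarrow> val s e \<noteq> 0 \<Longrightarrow> run W p s t s' \<Longrightarrow> run W (Loop e p) s' t' s'' \<Longrightarrow>
    run W (Loop e p) s (cost e + 1 + t + t') s''"
| LoopF: "fits W s e \<Longrightarrow> val s e = 0 \<Longrightarrow> run W (Loop e p) s (cost e + 1) s"

lemma run_deterministic:
  "run W p s t s' \<Longrightarrow> run W p s u s'' \<Longrightarrow> t = u \<and> s' = s''"
proof (induction arbitrary: u s'' rule: run.induct)
  case (Skip s)
  then show ?case by cases simp
next
  case (Assign s e r)
  from Assign.prems show ?case by cases simp
next
  case (Store s e1 e2 a)
  from Store.prems show ?case by cases simp
next
  case (Seq p s t s' q t' s2)
  from Seq.prems show ?case by cases (blast dest: Seq.IH)
next
  case (CondT s e p t s' q)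
  from CondT.prems show ?case by cases (use CondT.hyps in \<open>blast dest: CondT.IH\<close>)+
next
  case (CondF s e q t s' p)
  from CondF.prems show ?case by cases (use CondF.hyps in \<open>blast dest: CondF.IH\<close>)+
next
  case (LoopT s e p t s' t' s2)
  from LoopT.prems show ?case by cases (use LoopT.hyps in \<open>blast dest: LoopT.IH\<close>)+
next
  case (LoopF s e p)
  from LoopF.prems show ?case by cases (use LoopF.hyps in simp_all)
qed

text \<open>
  Input: register 0 holds the number \<open>n\<close> of vertices \<open>0, \<dots>, n - 1\<close>, and array 0 holds the
  \<open>n \<times> \<dots> \<times> n\<close> adjacency tensor (\<open>k\<close> factors) as a flat array of length \<open>n ^ k\<close>. The base-\<open>n\<close>
  digits of an index are the coordinates of the tensor entry.
\<close>
definition adjacency :: "nat \<Rightarrow> nat \<Rightarrow> nat set set \<Rightarrow> nat \<Rightarrow> nat" where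
  "adjacency k n E i = (if i < n ^ k \<and> (\<lambda>j. i div n ^ j mod n) ` {..<k} \<in> E then 1 else 0)"

definition input :: "nat \<Rightarrow> nat \<Rightarrow> nat set set \<Rightarrow> ram" where
  "input k n E = ((\<lambda>r. 0)(0 := n), (\<lambda>a i. 0)(0 := adjacency k n E))"

text \<open>
  Output: register 0 holds the number of parts, and array 1 maps each vertex to the index of its
  part.
\<close>
definition output_size :: "ram \<Rightarrow> nat" where
  "output_size s = fst s 0"

definition output_part :: "nat \<Rightarrow> ram \<Rightarrow> nat \<Rightarrow> nat set" where
  "output_part n s i = {v. v < n \<and> snd s 1 v = i}"

end

theory Submission
  imports Defs "HOL-Library.FuncSet"
begin

text \<open>
  Call two vertices near if their neighbourhoods differ in fewer than \<open>n ^ (k - 1) / q\<close> sets, with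
  \<open>q\<close> of order \<open>1 / \<epsilon>\<^sup>2\<close>. By Haussler's packing lemma a set of pairwise far vertices has
  \<open>O(q ^ d)\<close> elements, so a greedy choice of centres splits \<open>V\<close> into that many clusters of small
  diameter. List the vertices cluster by cluster and cut the list into \<open>K\<close> equal slices; with \<open>K\<close>
  of order \<open>1 / \<epsilon>\<close> times the number of clusters, few slices meet two clusters. If a tuple of
  the remaining slices is not homogeneous, then at least \<open>3 \<epsilon> / 2\<close> of the ordered pairs of its
  transversals consist of an edge and a non-edge. Walking from one to the other by one coordinate
  at a time, the edge status changes at some coordinate, which yields a set lying in exactly one
  of the neighbourhoods of two vertices of one slice. Since slices have small diameter, this
  happens for few tuples.

  The algorithm computes distances only from the centres, at a cost of \<open>O(n ^ (k - 1))\<close> each. It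
  does not sort: the \<open>r\<close>-th vertex that joins a cluster goes to part \<open>r * K div n\<close>. If \<open>n < K\<close>,
  singletons form a regular partition.
\<close>

section \<open>Haussler's packing lemma\<close>

text \<open>The order of \<open>q\<close> comes from one comparison. Let u = n / K. A bad tuple has
  about \<epsilon> u^(2k) discordant ordered pairs of transversals. Each of them is charged to a
  switch: two vertices of one slice together with a (k-1)-set in exactly one of their
  neighbourhoods, where up to u^(k-1) pairs share a switch. The slices are disjoint, so the
  (k-1)-set names the other slices of the tuple. Hence all bad tuples draw on a single supply of at
  most K u^2 2 n^(k-1) / q switches, and up to constants there are at most K^k / (\<epsilon> q) bad
  tuples. For this to be below \<epsilon> K^k, \<open>q\<close> must be of order 1 / \<epsilon>^2.
  Packing then gives order \<epsilon>^(-2d) clusters, and making the split slices rare costs one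
  more factor 1 / \<epsilon>: this is the exponent 2d + 1. Clusters have uncontrolled sizes and
  cannot serve as parts. Slicing makes equitability a matter of positions alone, which is also why a
  part index can be written as soon as a vertex is placed.\<close>

text \<open>Only meaningful for finite \<open>X\<close>: an infinite shattered set has \<open>card S = 0\<close>.\<close>
definition vc_le :: "'b set \<Rightarrow> 'b set set \<Rightarrow> nat \<Rightarrow> bool" where
  "vc_le X F d \<longleftrightarrow> (\<forall>S\<subseteq>X. shatters F S \<longrightarrow> card S \<le> d)"

section \<open>Deletion, doubling and the Sauer bound\<close>

lemma shatters_mono: "shatters F S \<Longrightarrow> F \<subseteq> G \<Longrightarrow> shatters G S"
  unfolding shatters_def by (meson subsetD)

text \<open>The lower endpoints of the edges in direction \<open>x\<close> of the one-inclusion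
  graph, the subgraph of the hypercube induced by \<open>F\<close>.\<close>

definition doubled :: "'b \<Rightarrow> 'b set set \<Rightarrow> 'b set set" where
  "doubled x F = {B \<in> F. x \<notin> B \<and> insert x B \<in> F}"

definition deleted :: "'b \<Rightarrow> 'b set set \<Rightarrow> 'b set set" where
  "deleted x F = (\<lambda>B. B - {x}) ` F"

text \<open>Removing \<open>x\<close> merges sets only in pairs, and the merged pairs are indexed by
  \<open>doubled x F\<close>.\<close>

lemma card_deleted_doubled:
  assumes "finite F"
  shows "card F = card (deleted x F) + card (doubled x F)"
proof -
  let ?L = "{B\<in>F. x \<notin> B}" and ?H = "(\<lambda>B. B - {x}) ` {B\<in>F. x \<in> B}"
  have fin: "finite ?L" "finite ?H" using assms by auto
  have inj: "inj_on (\<lambda>B. B - {x}) {B\<in>F. x \<in> B}"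
    by (auto simp: inj_on_def)
  have un: "deleted x F = ?L \<union> ?H"
  proof (intro set_eqI iffI)
    fix B assume "B \<in> deleted x F"
    then obtain A where "A \<in> F" "B = A - {x}" by (auto simp: deleted_def)
    then show "B \<in> ?L \<union> ?H" by (cases "x \<in> A") auto
  next
    fix B assume "B \<in> ?L \<union> ?H"
    then show "B \<in> deleted x F"
    proof
      assume "B \<in> ?L"
      then have "B = B - {x}" "B \<in> F" by auto
      then show ?thesis unfolding deleted_def by blast
    qed (auto simp: deleted_def)
  qed
  have int: "doubled x F = ?L \<inter> ?H"
  proof (intro set_eqI iffI)
    fix B assume "B \<in> doubled x F"
    then have "B \<in> F" "x \<notin> B" "insert x B \<in> F" by (auto simp: doubled_def)
    moreover have "B = insert x B - {x}" using \<open>x \<notin> B\<close> by auto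
    ultimately show "B \<in> ?L \<inter> ?H" by blast
  next
    fix B assume "B \<in> ?L \<inter> ?H"
    then show "B \<in> doubled x F" by (auto simp: doubled_def insert_absorb)
  qed
  have "card F = card ?L + card {B\<in>F. x \<in> B}"
  proof -
    have "F = ?L \<union> {B\<in>F. x \<in> B}" by blast
    moreover have "card (?L \<union> {B\<in>F. x \<in> B}) = card ?L + card {B\<in>F. x \<in> B}"
      by (rule card_Un_disjoint) (use assms in auto)
    ultimately show ?thesis by simp
  qed
  also have "card {B\<in>F. x \<in> B} = card ?H" using card_image [OF inj] by simp
  also have "card ?L + card ?H = card (deleted x F) + card (doubled x F)"
    using card_Un_Int [OF fin] un int by simp
  finally show ?thesis .
qed

lemma vc_le_deleted:
  assumes "vc_le (insert x X) F d" "x \<notin> X"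
  shows "vc_le X (deleted x F) d"
  unfolding vc_le_def
proof (intro allI impI)
  fix S assume S: "S \<subseteq> X" "shatters (deleted x F) S"
  have "shatters F S" unfolding shatters_def
  proof (intro allI impI)
    fix B assume "B \<subseteq> S"
    then have "\<exists>A\<in>deleted x F. A \<inter> S = B" using S(2) by (simp add: shatters_def)
    then obtain A where "A \<in> F" "(A - {x}) \<inter> S = B" by (auto simp: deleted_def)
    moreover have "A \<inter> S = (A - {x}) \<inter> S" using S(1) assms(2) by auto
    ultimately show "\<exists>A\<in>F. A \<inter> S = B" by metis
  qed
  then show "card S \<le> d" using S(1) assms(1) unfolding vc_le_def by blast
qed

text \<open>A member of \<open>doubled x F\<close> is available in \<open>F\<close> both with and
  without \<open>x\<close>, so \<open>x\<close> can be added to any set that is shattered. The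
  conclusion \<open>0 < d\<close> makes \<open>d - 1\<close> a true predecessor.\<close>

lemma vc_le_doubled:
  assumes "vc_le (insert x X) F d" "x \<notin> X" "finite X" "doubled x F \<noteq> {}"
  shows "0 < d \<and> vc_le X (doubled x F) (d - 1)"
proof -
  have *: "Suc (card S) \<le> d" if S: "S \<subseteq> X" "shatters (doubled x F) S" for S
  proof -
    have "shatters F (insert x S)" unfolding shatters_def
    proof (intro allI impI)
      fix B assume B: "B \<subseteq> insert x S"
      then have "B - {x} \<subseteq> S" by blast
      then have "\<exists>A\<in>doubled x F. A \<inter> S = B - {x}" using S(2) by (simp add: shatters_def)
      then obtain A where A: "A \<in> doubled x F" "A \<inter> S = B - {x}" ..
      show "\<exists>A\<in>F. A \<inter> insert x S = B"
      proof (cases "x \<in> B")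
        case True
        have "insert x A \<inter> insert x S = insert x (A \<inter> S)" by simp
        then have "insert x A \<inter> insert x S = B" using A(2) insert_Diff [OF True] by simp
        moreover have "insert x A \<in> F" using A(1) by (simp add: doubled_def)
        ultimately show ?thesis by (intro bexI)
      next
        case False
        have "x \<notin> A" using A(1) by (simp add: doubled_def)
        then have "A \<inter> insert x S = B" using A(2) False by simp
        moreover have "A \<in> F" using A(1) by (simp add: doubled_def)
        ultimately show ?thesis by (intro bexI)
      qed
    qed
    moreover have "insert x S \<subseteq> insert x X" using S(1) by blast
    ultimately have "card (insert x S) \<le> d" using assms(1) by (simp add: vc_le_def)
    moreover have "x \<notin> S" "finite S" using S(1) assms finite_subset by auto
    ultimately show ?thesis by simp
  qed
  have "shatters (doubled x F) {}" using assms(4) by (auto simp: shatters_def)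
  then have "0 < d" using * [of "{}"] by simp
  moreover have "vc_le X (doubled x F) (d - 1)" unfolding vc_le_def
  proof (intro allI impI)
    fix S assume "S \<subseteq> X" "shatters (doubled x F) S"
    from * [OF this] show "card S \<le> d - 1" by simp
  qed
  ultimately show ?thesis ..
qed

lemma deleted_subset_Pow: "F \<subseteq> Pow (insert x X) \<Longrightarrow> deleted x F \<subseteq> Pow X"
  by (auto simp: deleted_def)

lemma doubled_subset_Pow: "F \<subseteq> Pow (insert x X) \<Longrightarrow> doubled x F \<subseteq> Pow X"
  by (auto simp: doubled_def)

text \<open>Deletion keeps the dimension and doubling lowers it, which is Pascal's recursion. With
  \<open>a = card X + 1\<close> the crude power bound survives it because
  \<open>(a + 1) * a ^ e \<le> (a + 1) ^ Suc e\<close>.\<close>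

lemma sauer_bound:
  assumes "finite X" "F \<subseteq> Pow X" "vc_le X F d"
  shows "card F \<le> (card X + 1) ^ d"
  using assms
proof (induction X arbitrary: F d rule: finite_induct)
  case empty
  then have "F \<subseteq> {{}}" by simp
  then show ?case using card_mono [of "{{}}" F] by simp
next
  case (insert x X)
  have finF: "finite F" using insert.prems(1) insert.hyps(1) finite_subset by fastforce
  have 0: "card (deleted x F) \<le> (card X + 1) ^ d"
    using insert.IH [OF deleted_subset_Pow vc_le_deleted] insert.prems insert.hyps by blast
  show ?case
  proof (cases "doubled x F = {}")
    case True
    then have "card F \<le> (card X + 1) ^ d" using card_deleted_doubled [OF finF, of x] 0 by simp
    also have "\<dots> \<le> (card (insert x X) + 1) ^ d" by (intro power_mono) (use insert.hyps in auto)
    finally show ?thesis .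
  next
    case False
    obtain e where d: "d = Suc e" and e: "vc_le X (doubled x F) e"
      using vc_le_doubled [OF insert.prems(2) insert.hyps(2,1) False] by (cases d) auto
    have 1: "card (doubled x F) \<le> (card X + 1) ^ e"
      using insert.IH [OF doubled_subset_Pow e] insert.prems by blast
    have "card F \<le> (card X + 1) ^ d + (card X + 1) ^ e"
      using card_deleted_doubled [OF finF, of x] 0 1 by simp
    also have "\<dots> = (card X + 2) * (card X + 1) ^ e" by (simp add: d algebra_simps)
    also have "\<dots> \<le> (card X + 2) * (card X + 2) ^ e" by (intro mult_left_mono power_mono) auto
    also have "\<dots> = (card (insert x X) + 1) ^ d" using insert.hyps by (simp add: d)
    finally show ?thesis .
  qed
qed

section \<open>Edges of the one-inclusion graph, counted by direction\<close>

definition inclusion_edges :: "'b set \<Rightarrow> 'b set set \<Rightarrow> nat" where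
  "inclusion_edges X F = (\<Sum>x\<in>X. card (doubled x F))"

text \<open>The edges in direction \<open>y\<close> are split along \<open>x\<close>. Only an
  inequality holds because an edge of the deleted family may come from two sets that differ at
  \<open>x\<close> as well.\<close>

lemma card_doubled_le:
  assumes "finite F" "y \<noteq> x"
  shows "card (doubled y F) \<le> card (doubled y (deleted x F)) + card (doubled y (doubled x F))"
proof -
  have "card (doubled y F) = card (deleted x (doubled y F)) + card (doubled x (doubled y F))"
    by (rule card_deleted_doubled) (use assms in \<open>auto simp: doubled_def\<close>)
  also have "deleted x (doubled y F) \<subseteq> doubled y (deleted x F)"
  proof
    fix B assume "B \<in> deleted x (doubled y F)"
    then obtain A where A: "A \<in> F" "y \<notin> A" "insert y A \<in> F" "B = A - {x}"
      by (auto simp: deleted_def doubled_def)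
    moreover have "insert y B = insert y A - {x}" using A assms by auto
    ultimately show "B \<in> doubled y (deleted x F)" unfolding doubled_def deleted_def by blast
  qed
  then have "card (deleted x (doubled y F)) \<le> card (doubled y (deleted x F))"
    by (rule card_mono [rotated]) (use assms in \<open>auto simp: doubled_def deleted_def\<close>)
  also have "doubled x (doubled y F) = doubled y (doubled x F)"
    using assms by (auto simp: doubled_def insert_commute)
  finally show ?thesis by simp
qed

text \<open>The density bound of Haussler, Littlestone and Warmuth. In the induction the direction
  \<open>x\<close> contributes \<open>card (doubled x F)\<close> edges, exactly what the lower
  dimension of the doubled family saves.\<close>

lemma inclusion_edges_le:
  assumes "finite X" "F \<subseteq> Pow X" "vc_le X F d"
  shows "inclusion_edges X F \<le> d * card F"
  using assms
proof (induction X arbitrary: F d rule: finite_induct)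
  case empty
  then show ?case by (simp add: inclusion_edges_def)
next
  case (insert x X)
  have finF: "finite F" using insert.prems(1) insert.hyps(1) finite_subset by fastforce
  have 0: "inclusion_edges X (deleted x F) \<le> d * card (deleted x F)"
    using insert.IH [OF deleted_subset_Pow vc_le_deleted] insert.prems insert.hyps by blast
  have "inclusion_edges (insert x X) F = card (doubled x F) + (\<Sum>y\<in>X. card (doubled y F))"
    using insert.hyps by (simp add: inclusion_edges_def)
  also have "(\<Sum>y\<in>X. card (doubled y F)) \<le>
      (\<Sum>y\<in>X. card (doubled y (deleted x F)) + card (doubled y (doubled x F)))"
    using insert.hyps(2) by (intro sum_mono card_doubled_le [OF finF]) auto
  also have "\<dots> = inclusion_edges X (deleted x F) + inclusion_edges X (doubled x F)"
    by (simp add: inclusion_edges_def sum.distrib)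
  finally have le: "inclusion_edges (insert x X) F \<le>
      card (doubled x F) + (inclusion_edges X (deleted x F) + inclusion_edges X (doubled x F))"
    by simp
  show ?case
  proof (cases "doubled x F = {}")
    case True
    then have "inclusion_edges X (doubled x F) = 0"
      by (simp add: inclusion_edges_def) (auto simp: doubled_def)
    then show ?thesis using le 0 True card_deleted_doubled [OF finF, of x] by simp
  next
    case False
    obtain e where d: "d = Suc e" and e: "vc_le X (doubled x F) e"
      using vc_le_doubled [OF insert.prems(2) insert.hyps(2,1) False] by (cases d) auto
    have "inclusion_edges X (doubled x F) \<le> e * card (doubled x F)"
      using insert.IH [OF doubled_subset_Pow e] insert.prems by blast
    then have "inclusion_edges (insert x X) F \<le> d * card (deleted x F) + d * card (doubled x F)"
      using le 0 by (simp add: d)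
    then show ?thesis by (simp add: card_deleted_doubled [OF finF, of x] algebra_simps)
  qed
qed

text \<open>Several members of a family may have the same trace on a sample, so vertices carry
  multiplicities. The \<open>min\<close> of the two ends is the number of levels at which both ends
  are present.\<close>

lemma weighted_inclusion_edges_le:
  fixes w :: "'b set \<Rightarrow> nat"
  assumes "finite X" "vc_le X {B\<in>Pow X. w B \<noteq> 0} d"
  shows "(\<Sum>x\<in>X. \<Sum>B\<in>Pow (X - {x}). min (w B) (w (insert x B))) \<le> d * (\<Sum>B\<in>Pow X. w B)"
proof -
  \<comment> \<open>Layer-cake decomposition: apply the unweighted bound to each superlevel set \<open>G t\<close> of \<open>w\<close>.\<close>
  define T where "T = (\<Sum>B\<in>Pow X. w B)"
  define G where "G t = {B\<in>Pow X. Suc t \<le> w B}" for t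
  have wT: "w B \<le> T" if "B \<in> Pow X" for B
    unfolding T_def using assms(1) that by (intro member_le_sum) auto
  have G_le: "inclusion_edges X (G t) \<le> d * card (G t)" for t
  proof (rule inclusion_edges_le)
    have "G t \<subseteq> {B\<in>Pow X. w B \<noteq> 0}" by (auto simp: G_def)
    then show "vc_le X (G t) d" using assms(2) shatters_mono unfolding vc_le_def by blast
  qed (use assms in \<open>auto simp: G_def\<close>)
  have layer: "min a b = (\<Sum>t<T. of_bool (Suc t \<le> a \<and> Suc t \<le> b))" if "a \<le> T" for a b :: nat
  proof -
    have "{..<T} \<inter> {t. Suc t \<le> a \<and> Suc t \<le> b} = {..<min a b}" using that by auto
    then have "card ({..<T} \<inter> {t. Suc t \<le> a \<and> Suc t \<le> b}) = min a b" by simp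
    then show ?thesis by (subst sum_of_bool_eq) (simp_all add: Int_def)
  qed
  have "(\<Sum>x\<in>X. \<Sum>B\<in>Pow (X - {x}). min (w B) (w (insert x B))) =
      (\<Sum>x\<in>X. \<Sum>B\<in>Pow (X - {x}). \<Sum>t<T. of_bool (Suc t \<le> w B \<and> Suc t \<le> w (insert x B)))"
    by (intro sum.cong refl layer wT) auto
  also have "\<dots> = (\<Sum>t<T. \<Sum>x\<in>X. \<Sum>B\<in>Pow (X - {x}). of_bool (Suc t \<le> w B \<and> Suc t \<le> w (insert x B)))"
  proof -
    have "(\<Sum>B\<in>Pow (X - {x}). \<Sum>t<T. of_bool (Suc t \<le> w B \<and> Suc t \<le> w (insert x B))) =
        (\<Sum>t<T. \<Sum>B\<in>Pow (X - {x}). of_bool (Suc t \<le> w B \<and> Suc t \<le> w (insert x B)))" for x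
      by (rule sum.swap)
    from sum.cong [OF refl this] show ?thesis by (rule trans) (rule sum.swap)
  qed
  also have "\<dots> = (\<Sum>t<T. inclusion_edges X (G t))"
    unfolding inclusion_edges_def
  proof (intro sum.cong refl)
    fix t x assume "x \<in> X"
    have "Pow (X - {x}) \<inter> {B. Suc t \<le> w B \<and> Suc t \<le> w (insert x B)} = doubled x (G t)"
      using \<open>x \<in> X\<close> by (auto simp: doubled_def G_def)
    then show "(\<Sum>B\<in>Pow (X - {x}). of_bool (Suc t \<le> w B \<and> Suc t \<le> w (insert x B))) =
        card (doubled x (G t))"
      using assms(1) by (subst sum_of_bool_eq) (simp_all add: Int_def)
  qed
  also have "\<dots> \<le> (\<Sum>t<T. d * card (G t))" by (intro sum_mono G_le)
  also have "\<dots> = d * (\<Sum>t<T. card (G t))" by (simp add: sum_distrib_left)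
  \<comment> \<open>The repeated conjunct makes this the case of equal arguments of
    \<open>layer\<close>, which then sums the levels back to \<open>w B\<close>.\<close>
  also have "(\<Sum>t<T. card (G t)) = (\<Sum>t<T. \<Sum>B\<in>Pow X. of_bool (Suc t \<le> w B \<and> Suc t \<le> w B))"
    unfolding G_def using assms(1) by (subst sum_of_bool_eq) (simp_all add: Int_def)
  also have "\<dots> = (\<Sum>B\<in>Pow X. w B)"
    by (subst sum.swap, rule sum.cong [OF refl], subst layer [OF wT, symmetric]) auto
  finally show ?thesis .
qed

section \<open>Separated families and random samples\<close>

definition set_dist :: "'b set \<Rightarrow> 'b set \<Rightarrow> nat" where
  "set_dist A B = card (A - B) + card (B - A)"

lemma card_filter_eq_sum: "finite A \<Longrightarrow> card {x\<in>A. P x} = (\<Sum>x\<in>A. of_bool (P x))"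
  by (subst sum_of_bool_eq) (simp_all add: Int_def)

text \<open>Triples of an element and two sets that it separates, counted in two ways. The products
  see only the elements of \<open>B - A\<close>, while \<open>set_dist\<close> sees both
  differences; hence the factor 2.\<close>

lemma sum_split_products:
  assumes "finite C" "finite X" "\<And>A. A \<in> C \<Longrightarrow> A \<subseteq> X"
  shows "2 * (\<Sum>x\<in>X. card {A\<in>C. x \<notin> A} * card {A\<in>C. x \<in> A}) =
    (\<Sum>A\<in>C. \<Sum>B\<in>C. set_dist A B)"
proof -
  have card: "card (B - A) = (\<Sum>x\<in>X. of_bool (x \<notin> A) * of_bool (x \<in> B))" if "B \<in> C" for A B
  proof -
    have "B - A = {x\<in>X. x \<notin> A \<and> x \<in> B}" using assms(3) [OF that] by auto
    then show ?thesis using assms(2) by (simp only: card_filter_eq_sum of_bool_conj)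
  qed
  have "(\<Sum>x\<in>X. card {A\<in>C. x \<notin> A} * card {A\<in>C. x \<in> A}) =
      (\<Sum>x\<in>X. \<Sum>A\<in>C. \<Sum>B\<in>C. of_bool (x \<notin> A) * of_bool (x \<in> B))"
    using assms(1) by (simp only: card_filter_eq_sum sum_product)
  also have "\<dots> = (\<Sum>A\<in>C. \<Sum>x\<in>X. \<Sum>B\<in>C. of_bool (x \<notin> A) * of_bool (x \<in> B))"
    by (rule sum.swap)
  also have "\<dots> = (\<Sum>A\<in>C. \<Sum>B\<in>C. \<Sum>x\<in>X. of_bool (x \<notin> A) * of_bool (x \<in> B))"
    by (intro sum.cong refl sum.swap)
  also have "\<dots> = (\<Sum>A\<in>C. \<Sum>B\<in>C. card (B - A))"
    by (intro sum.cong refl card [symmetric])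
  finally have 1: "(\<Sum>x\<in>X. card {A\<in>C. x \<notin> A} * card {A\<in>C. x \<in> A}) =
      (\<Sum>A\<in>C. \<Sum>B\<in>C. card (B - A))" .
  have 2: "(\<Sum>A\<in>C. \<Sum>B\<in>C. card (A - B)) = (\<Sum>A\<in>C. \<Sum>B\<in>C. card (B - A))"
    by (rule sum.swap)
  show ?thesis unfolding 1 set_dist_def by (simp add: sum.distrib 2)
qed

text \<open>A typical element must split a separated family well. The term with \<open>m\<close> is
  the price of a set not being separated from itself: each member has only \<open>card C - 1\<close>
  partners.\<close>

lemma separated_split:
  assumes "finite C" "finite X" "\<And>A. A \<in> C \<Longrightarrow> A \<subseteq> X"
    and sep: "\<And>A B. A \<in> C \<Longrightarrow> B \<in> C \<Longrightarrow> A \<noteq> B \<Longrightarrow> m \<le> q * set_dist A B"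
  shows "card C * m \<le>
    2 * q * (\<Sum>x\<in>X. min (card {A\<in>C. x \<notin> A}) (card {A\<in>C. x \<in> A})) + of_bool (C \<noteq> {}) * m"
proof (cases "C = {}")
  case False
  define c where "c = card C"
  have c: "c > 0" using assms(1) False by (simp add: c_def card_gt_0_iff)
  \<comment> \<open>The larger of two numbers with sum \<open>c\<close> is at most \<open>c\<close>.
    This trades the product for a minimum, which later is the weight of an edge.\<close>
  have prod: "a * b \<le> c * min a b" if "a + b = c" for a b :: nat
    using that by (cases "a \<le> b") (auto simp: min_def algebra_simps)
  have split: "card {A\<in>C. x \<notin> A} + card {A\<in>C. x \<in> A} = c" for x
  proof -
    have "card ({A\<in>C. x \<notin> A} \<union> {A\<in>C. x \<in> A}) = card {A\<in>C. x \<notin> A} + card {A\<in>C. x \<in> A}"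
      by (rule card_Un_disjoint) (use assms in auto)
    moreover have "{A\<in>C. x \<notin> A} \<union> {A\<in>C. x \<in> A} = C" by auto
    ultimately show ?thesis by (simp add: c_def)
  qed
  have "c * ((c - 1) * m) = (\<Sum>A\<in>C. (c - 1) * m)" by (simp add: c_def)
  also have "\<dots> = (\<Sum>A\<in>C. \<Sum>B\<in>C - {A}. m)"
    using assms(1) by (intro sum.cong refl) (simp add: c_def)
  also have "\<dots> \<le> (\<Sum>A\<in>C. \<Sum>B\<in>C - {A}. q * set_dist A B)"
    by (intro sum_mono sep) auto
  also have "\<dots> \<le> (\<Sum>A\<in>C. \<Sum>B\<in>C. q * set_dist A B)"
    using assms(1) by (intro sum_mono sum_mono2) auto
  also have "\<dots> = q * (2 * (\<Sum>x\<in>X. card {A\<in>C. x \<notin> A} * card {A\<in>C. x \<in> A}))"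
    using sum_split_products [OF assms(1-3)] by (simp add: sum_distrib_left)
  also have "\<dots> \<le> q * (2 * (\<Sum>x\<in>X. c * min (card {A\<in>C. x \<notin> A}) (card {A\<in>C. x \<in> A})))"
    by (intro mult_left_mono sum_mono prod split) auto
  also have "\<dots> = c * (2 * q * (\<Sum>x\<in>X. min (card {A\<in>C. x \<notin> A}) (card {A\<in>C. x \<in> A})))"
    by (simp add: sum_distrib_left [symmetric])
  finally have "(c - 1) * m \<le> 2 * q * (\<Sum>x\<in>X. min (card {A\<in>C. x \<notin> A}) (card {A\<in>C. x \<in> A}))"
    using c by simp
  then show ?thesis using False c by (cases c) (simp_all add: c_def)
qed simp

text \<open>Swapping a fresh element with coordinate \<open>i\<close> is an involution on pairs of a
  tuple and an element, so a resampled tuple is as uniform as the original one.\<close>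

lemma sum_PiE_upd:
  fixes g :: "('i \<Rightarrow> 'b) \<Rightarrow> 'c::comm_semiring_1"
  assumes "i \<in> I"
  shows "(\<Sum>t\<in>Pi\<^sub>E I (\<lambda>_. X). \<Sum>x\<in>X. g (t(i := x))) = of_nat (card X) * (\<Sum>t\<in>Pi\<^sub>E I (\<lambda>_. X). g t)"
proof -
  let ?\<Omega> = "Pi\<^sub>E I (\<lambda>_. X)"
  let ?h = "\<lambda>(t, x). (t(i := x), t i)"
  have "(\<Sum>p\<in>?\<Omega> \<times> X. g (fst (?h p))) = (\<Sum>p\<in>?\<Omega> \<times> X. g (fst p))"
  proof (rule sum.reindex_bij_witness [where i = ?h and j = ?h])
    fix p assume p: "p \<in> ?\<Omega> \<times> X"
    obtain t x where tx: "p = (t, x)" "t \<in> ?\<Omega>" "x \<in> X" using p by auto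
    show "?h p \<in> ?\<Omega> \<times> X" using tx assms by (auto simp: PiE_iff extensional_def)
    show "?h (?h p) = p" using tx by simp
  qed (auto simp: assms PiE_iff extensional_def)
  moreover have "(\<Sum>p\<in>?\<Omega> \<times> X. g (fst (?h p))) = (\<Sum>t\<in>?\<Omega>. \<Sum>x\<in>X. g (t(i := x)))"
    by (simp add: sum.cartesian_product case_prod_unfold)
  moreover have "(\<Sum>p\<in>?\<Omega> \<times> X. g (fst p)) = (\<Sum>t\<in>?\<Omega>. \<Sum>x\<in>X. g t)"
    by (simp only: sum.cartesian_product case_prod_unfold)
  ultimately show ?thesis by (simp add: sum_distrib_left)
qed

text \<open>Repeated sample points do no harm: no trace tells two indices with the same point apart,
  so \<open>t\<close> is injective on a shattered index set and maps it to a shattered set of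
  points.\<close>

lemma vc_le_trace:
  assumes "vc_le X F d" "\<And>i. i \<in> I \<Longrightarrow> t i \<in> X"
  shows "vc_le I ((\<lambda>A. {i\<in>I. t i \<in> A}) ` F) d"
  unfolding vc_le_def
proof (intro allI impI)
  fix S assume S: "S \<subseteq> I" and sh: "shatters ((\<lambda>A. {i\<in>I. t i \<in> A}) ` F) S"
  have ex: "\<exists>A\<in>F. \<forall>i\<in>S. t i \<in> A \<longleftrightarrow> i \<in> B" if "B \<subseteq> S" for B
  proof -
    have "\<exists>A\<in>(\<lambda>A. {i\<in>I. t i \<in> A}) ` F. A \<inter> S = B"
      using sh that unfolding shatters_def by simp
    then obtain A where "A \<in> F" "{i\<in>I. t i \<in> A} \<inter> S = B" by auto
    then show ?thesis using S by (intro bexI [of _ A]) auto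
  qed
  have inj: "inj_on t S"
  proof (rule inj_onI)
    fix i j assume ij: "i \<in> S" "j \<in> S" "t i = t j"
    have "{i} \<subseteq> S" using ij(1) by simp
    from ex [OF this] obtain A
      where "A \<in> F" and A: "\<forall>l\<in>S. t l \<in> A \<longleftrightarrow> l \<in> {i}" ..
    have "t i \<in> A" using bspec [OF A ij(1)] by simp
    then have "t j \<in> A" by (simp only: ij(3))
    then show "i = j" using bspec [OF A ij(2)] by simp
  qed
  have "shatters F (t ` S)" unfolding shatters_def
  proof (intro allI impI)
    fix B assume B: "B \<subseteq> t ` S"
    have "{i\<in>S. t i \<in> B} \<subseteq> S" by auto
    from ex [OF this] obtain A
      where A: "A \<in> F" and *: "\<forall>i\<in>S. t i \<in> A \<longleftrightarrow> i \<in> {i\<in>S. t i \<in> B}" ..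
    have "A \<inter> t ` S = B"
    proof (intro set_eqI iffI)
      fix x assume "x \<in> A \<inter> t ` S"
      then show "x \<in> B" using * by auto
    next
      fix x assume "x \<in> B"
      moreover from this obtain i where "i \<in> S" "x = t i" using B by auto
      ultimately show "x \<in> A \<inter> t ` S" using * by auto
    qed
    then show "\<exists>A\<in>F. A \<inter> t ` S = B" using A by (intro bexI)
  qed
  moreover have "t ` S \<subseteq> X" using S assms(2) by auto
  ultimately have "card (t ` S) \<le> d" using assms(1) by (simp add: vc_le_def)
  then show "card S \<le> d" by (simp add: card_image [OF inj])
qed

text \<open>
  Chazelle's proof of Haussler's packing lemma: restrict \<open>F\<close> to a uniformly random tuple of
  length \<open>s\<close>. The weighted one-inclusion graph of the trace has at most \<open>d * card F\<close> edges, while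
  in each direction the separation forces an expected number of about \<open>card F / (2 * q)\<close>.
\<close>
lemma haussler_packing:
  assumes "finite X" "F \<subseteq> Pow X" "vc_le X F d" "0 < q"
    and sep: "\<And>A B. A \<in> F \<Longrightarrow> B \<in> F \<Longrightarrow> A \<noteq> B \<Longrightarrow> card X \<le> q * set_dist A B"
  shows "card F \<le> 2 * (4 * (d + 1) * q) ^ d"
proof (cases "X = {}")
  case True
  then have "F \<subseteq> {{}}" using assms(2) by simp
  then have "card F \<le> 1" using card_mono [of "{{}}" F] by simp
  also have "1 \<le> 2 * (4 * (d + 1) * q) ^ d" using assms(4) by simp
  finally show ?thesis .
next
  case False
  define m where "m = card X"
  have m: "0 < m" using False assms(1) by (simp add: m_def card_gt_0_iff)
  have finF: "finite F" using assms(1,2) finite_subset by fastforce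
  have sub: "\<And>A. A \<in> F \<Longrightarrow> A \<subseteq> X" using assms(2) by auto
  \<comment> \<open>The sample is long enough for \<open>4 * q * d \<le> s\<close>, so that at the
    end the edge term is absorbed by half of the left side. With \<open>d + 1\<close> in place of
    \<open>d\<close> it is also nonempty for \<open>d = 0\<close>.\<close>
  define s where "s = 4 * (d + 1) * q"
  have s: "0 < s" using assms(4) by (simp add: s_def)
  define I where "I = {..<s}"
  define \<Omega> where "\<Omega> = Pi\<^sub>E I (\<lambda>_. X)"
  have fin\<Omega>: "finite \<Omega>" unfolding \<Omega>_def I_def using assms(1) by (intro finite_PiE) auto
  have card\<Omega>: "0 < card \<Omega>"
    using fin\<Omega> False by (simp add: card_gt_0_iff \<Omega>_def PiE_eq_empty_iff)
  define tr where "tr t A = {i\<in>I. t i \<in> A}" for t :: "nat \<Rightarrow> 'a" and A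
  define w where "w t B = card {A\<in>F. tr t A = B}" for t B
  define W where "W t i = (\<Sum>B\<in>Pow (I - {i}). min (w t B) (w t (insert i B)))" for t i
  have upper: "(\<Sum>i\<in>I. W t i) \<le> d * card F" if "t \<in> \<Omega>" for t
  proof -
    have "vc_le I {B\<in>Pow I. w t B \<noteq> 0} d"
    proof -
      have "vc_le I (tr t ` F) d"
        using vc_le_trace [OF assms(3), of I t] that unfolding tr_def \<Omega>_def by auto
      moreover have "{B\<in>Pow I. w t B \<noteq> 0} \<subseteq> tr t ` F"
        by (auto simp: w_def card_eq_0_iff)
      ultimately show ?thesis using shatters_mono [of _ _ "tr t ` F"] by (simp add: vc_le_def)
    qed
    then have "(\<Sum>i\<in>I. W t i) \<le> d * (\<Sum>B\<in>Pow I. w t B)"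
      unfolding W_def by (intro weighted_inclusion_edges_le) (simp_all add: I_def)
    also have "(\<Sum>B\<in>Pow I. w t B) = card F"
    proof -
      have "(\<Sum>B\<in>Pow I. \<Sum>A\<in>{A\<in>F. tr t A = B}. 1) = (\<Sum>A\<in>F. 1::nat)"
        by (rule sum.group) (auto simp: finF I_def tr_def)
      then show ?thesis by (simp add: w_def)
    qed
    finally show ?thesis .
  qed
  \<comment> \<open>All coordinates but \<open>i\<close> are fixed; they divide \<open>F\<close>
    into the fibres \<open>C B\<close>. A fresh point \<open>x\<close> splits each fibre, and the
    smaller half is the weight of an edge in direction \<open>i\<close>. Each nonempty fibre loses
    one \<open>m\<close>, and \<open>sauer_bound\<close> limits their number.\<close>
  have lower: "card F * m \<le> 2 * q * (\<Sum>x\<in>X. W (t(i := x)) i) + s ^ d * m"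
    if t: "t \<in> \<Omega>" and i: "i \<in> I" for t i
  proof -
    define C where "C B = {A\<in>F. {j\<in>I - {i}. t j \<in> A} = B}" for B
    have w0: "w (t(i := x)) B = card {A\<in>C B. x \<notin> A}"
      and w1: "w (t(i := x)) (insert i B) = card {A\<in>C B. x \<in> A}" if "B \<subseteq> I - {i}" for x B
    proof -
      have tr: "tr (t(i := x)) A = {j\<in>I - {i}. t j \<in> A} \<union> (if x \<in> A then {i} else {})" for A
        using i by (auto simp: tr_def)
      have "tr (t(i := x)) A = B \<longleftrightarrow> {j\<in>I - {i}. t j \<in> A} = B \<and> x \<notin> A"
        "tr (t(i := x)) A = insert i B \<longleftrightarrow> {j\<in>I - {i}. t j \<in> A} = B \<and> x \<in> A" for A
        unfolding tr using that by auto
      then show "w (t(i := x)) B = card {A\<in>C B. x \<notin> A}"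
        "w (t(i := x)) (insert i B) = card {A\<in>C B. x \<in> A}"
        by (simp_all add: w_def C_def conj_assoc)
    qed
    have "vc_le (I - {i}) ((\<lambda>A. {j\<in>I - {i}. t j \<in> A}) ` F) d"
      using t by (intro vc_le_trace [OF assms(3)]) (auto simp: \<Omega>_def)
    then have "card ((\<lambda>A. {j\<in>I - {i}. t j \<in> A}) ` F) \<le> (card (I - {i}) + 1) ^ d"
      by (intro sauer_bound) (auto simp: I_def)
    also have "card (I - {i}) + 1 = s" using i s by (simp add: I_def)
    finally have sauer: "card ((\<lambda>A. {j\<in>I - {i}. t j \<in> A}) ` F) \<le> s ^ d" .
    have "card F * m = (\<Sum>B\<in>Pow (I - {i}). card (C B)) * m"
    proof -
      have "(\<Sum>B\<in>Pow (I - {i}). \<Sum>A\<in>{A\<in>F. {j\<in>I - {i}. t j \<in> A} = B}. 1) = (\<Sum>A\<in>F. 1::nat)"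
        by (rule sum.group) (auto simp: finF I_def)
      then show ?thesis by (simp add: C_def)
    qed
    also have "\<dots> = (\<Sum>B\<in>Pow (I - {i}). card (C B) * m)" by (simp add: sum_distrib_right)
    also have "\<dots> \<le> (\<Sum>B\<in>Pow (I - {i}).
        2 * q * (\<Sum>x\<in>X. min (card {A\<in>C B. x \<notin> A}) (card {A\<in>C B. x \<in> A})) +
        of_bool (C B \<noteq> {}) * m)"
      using assms(1) finF sub sep by (intro sum_mono separated_split) (auto simp: C_def m_def)
    also have "\<dots> = 2 * q * (\<Sum>B\<in>Pow (I - {i}). \<Sum>x\<in>X.
        min (card {A\<in>C B. x \<notin> A}) (card {A\<in>C B. x \<in> A})) +
        (\<Sum>B\<in>Pow (I - {i}). of_bool (C B \<noteq> {})) * m"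
      by (simp only: sum.distrib sum_distrib_left sum_distrib_right)
    also have "(\<Sum>B\<in>Pow (I - {i}). \<Sum>x\<in>X.
        min (card {A\<in>C B. x \<notin> A}) (card {A\<in>C B. x \<in> A})) =
        (\<Sum>B\<in>Pow (I - {i}). \<Sum>x\<in>X. min (w (t(i := x)) B) (w (t(i := x)) (insert i B)))"
      by (intro sum.cong refl) (simp add: w0 w1)
    also have "\<dots> = (\<Sum>x\<in>X. W (t(i := x)) i)" unfolding W_def by (rule sum.swap)
    also have "(\<Sum>B\<in>Pow (I - {i}). of_bool (C B \<noteq> {})) =
        card {B\<in>Pow (I - {i}). C B \<noteq> {}}"
      by (subst card_filter_eq_sum) (simp_all add: I_def)
    also have "{B\<in>Pow (I - {i}). C B \<noteq> {}} = (\<lambda>A. {j\<in>I - {i}. t j \<in> A}) ` F"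
      by (auto simp: C_def)
    finally show ?thesis using sauer by (meson add_left_mono le_trans mult_right_mono zero_le)
  qed
  have dir: "card \<Omega> * card F \<le> 2 * q * (\<Sum>t\<in>\<Omega>. W t i) + card \<Omega> * s ^ d" if i: "i \<in> I" for i
  proof -
    have "m * (card \<Omega> * card F) = (\<Sum>t\<in>\<Omega>. card F * m)" by simp
    also have "\<dots> \<le> (\<Sum>t\<in>\<Omega>. 2 * q * (\<Sum>x\<in>X. W (t(i := x)) i) + s ^ d * m)"
      using i by (intro sum_mono lower)
    also have "\<dots> = 2 * q * (\<Sum>t\<in>\<Omega>. \<Sum>x\<in>X. W (t(i := x)) i) + card \<Omega> * (s ^ d * m)"
      by (simp add: sum.distrib sum_distrib_left)
    \<comment> \<open>Averaging over a fresh point in place \<open>i\<close> and over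
      \<open>t\<close> is the same as averaging over \<open>t\<close> alone.\<close>
    also have "(\<Sum>t\<in>\<Omega>. \<Sum>x\<in>X. W (t(i := x)) i) = m * (\<Sum>t\<in>\<Omega>. W t i)"
      unfolding \<Omega>_def m_def using sum_PiE_upd [OF i, of "\<lambda>t. W t i" X] by simp
    finally have "m * (card \<Omega> * card F) \<le> m * (2 * q * (\<Sum>t\<in>\<Omega>. W t i) + card \<Omega> * s ^ d)"
      by (simp add: algebra_simps)
    then show ?thesis using m by simp
  qed
  have "card \<Omega> * (s * card F) = (\<Sum>i\<in>I. card \<Omega> * card F)" by (simp add: I_def)
  also have "\<dots> \<le> (\<Sum>i\<in>I. 2 * q * (\<Sum>t\<in>\<Omega>. W t i) + card \<Omega> * s ^ d)"
    by (intro sum_mono dir)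
  also have "\<dots> = 2 * q * (\<Sum>i\<in>I. \<Sum>t\<in>\<Omega>. W t i) + s * (card \<Omega> * s ^ d)"
    by (simp add: sum.distrib sum_distrib_left I_def)
  also have "(\<Sum>i\<in>I. \<Sum>t\<in>\<Omega>. W t i) = (\<Sum>t\<in>\<Omega>. \<Sum>i\<in>I. W t i)" by (rule sum.swap)
  also have "2 * q * \<dots> + s * (card \<Omega> * s ^ d) \<le>
      2 * q * (\<Sum>t\<in>\<Omega>. d * card F) + s * (card \<Omega> * s ^ d)"
    by (intro add_right_mono mult_left_mono sum_mono upper) auto
  also have "\<dots> = card \<Omega> * (2 * q * d * card F + s * s ^ d)" by (simp add: algebra_simps)
  finally have "s * card F \<le> 2 * q * d * card F + s * s ^ d" using card\<Omega> by simp
  then have "2 * (s * card F) \<le> 4 * q * d * card F + 2 * (s * s ^ d)" by simp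
  also have "4 * q * d * card F \<le> s * card F" by (simp add: s_def algebra_simps)
  finally have "s * card F \<le> s * (2 * s ^ d)" by simp
  then show ?thesis using s by (simp add: s_def)
qed

section \<open>Non-homogeneous tuples\<close>

definition mix :: "'i set \<Rightarrow> ('i \<Rightarrow> 'a) \<Rightarrow> ('i \<Rightarrow> 'a) \<Rightarrow> 'i \<Rightarrow> 'a" where
  "mix J x y = (\<lambda>i. if i \<in> J then y i else x i)"

lemma mix_PiE: "x \<in> Pi\<^sub>E I P \<Longrightarrow> y \<in> Pi\<^sub>E I P \<Longrightarrow> mix J x y \<in> Pi\<^sub>E I P"
  by (auto simp: mix_def PiE_iff extensional_def)

lemma mix_mix: "mix J (mix J x y) (mix J y x) = x"
  by (auto simp: mix_def)

text \<open>
  Exchanging the coordinates in \<open>J\<close> is an involution on pairs of tuples. It turns a change of \<open>f\<close>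
  along the walk from \<open>x\<close> to \<open>y\<close> into a change of \<open>f\<close> at the first component of a pair.
\<close>
lemma card_mix_le:
  assumes "finite J" "finite (Pi\<^sub>E I P)" "J \<subseteq> I"
  shows "card {p \<in> Pi\<^sub>E I P \<times> Pi\<^sub>E I P. f (fst p) \<noteq> f (mix J (fst p) (snd p))} \<le>
    (\<Sum>i\<in>J. card {p \<in> Pi\<^sub>E I P \<times> Pi\<^sub>E I P. f (fst p) \<noteq> f ((fst p)(i := snd p i))})"
  using assms
proof (induction J rule: finite_induct)
  case empty
  then show ?case by (simp add: mix_def)
next
  case (insert i J)
  let ?O = "Pi\<^sub>E I P \<times> Pi\<^sub>E I P"
  let ?m = "\<lambda>p. (mix J (fst p) (snd p), mix J (snd p) (fst p))"
  let ?A = "{p \<in> ?O. f (fst p) \<noteq> f (mix J (fst p) (snd p))}"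
  let ?B = "{p \<in> ?O. f (fst (?m p)) \<noteq> f ((fst (?m p))(i := snd (?m p) i))}"
  let ?C = "{p \<in> ?O. f (fst p) \<noteq> f ((fst p)(i := snd p i))}"
  have fin: "finite ?O" using insert.prems by simp
  have upd: "mix (insert i J) x y = (mix J x y)(i := mix J y x i)" for x y :: "'a \<Rightarrow> 'b"
    using insert.hyps by (auto simp: mix_def)
  have "inj_on ?m ?B"
    by (rule inj_on_inverseI [where g = ?m]) (simp add: mix_mix)
  then have "card ?B \<le> card ?C"
  proof (rule card_inj_on_le)
    show "?m ` ?B \<subseteq> ?C" by (rule image_subsetI) (simp add: mem_Times_iff mix_PiE)
    show "finite ?C" using fin by simp
  qed
  moreover have "card ?A \<le> (\<Sum>i\<in>J. card {p \<in> ?O. f (fst p) \<noteq> f ((fst p)(i := snd p i))})"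
    by (rule insert.IH) (use insert.prems in auto)
  moreover have "card {p \<in> ?O. f (fst p) \<noteq> f (mix (insert i J) (fst p) (snd p))} \<le> card (?A \<union> ?B)"
  proof (rule card_mono)
    show "finite (?A \<union> ?B)" using fin by simp
    show "{p \<in> ?O. f (fst p) \<noteq> f (mix (insert i J) (fst p) (snd p))} \<subseteq> ?A \<union> ?B"
      unfolding upd by auto
  qed
  ultimately show ?case
    unfolding sum.insert [OF insert.hyps] using card_Un_le [of ?A ?B] by linarith
qed

lemma card_discordant_pairs_le:
  assumes "finite I" "finite (Pi\<^sub>E I P)"
  shows "card {p \<in> Pi\<^sub>E I P \<times> Pi\<^sub>E I P. f (fst p) \<noteq> f (snd p)} \<le>
    (\<Sum>i\<in>I. card {p \<in> Pi\<^sub>E I P \<times> Pi\<^sub>E I P. f (fst p) \<noteq> f ((fst p)(i := snd p i))})"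
proof -
  have "mix I x y = y" if "x \<in> Pi\<^sub>E I P" "y \<in> Pi\<^sub>E I P" for x y
    using that by (auto simp: mix_def PiE_iff extensional_def)
  then have "{p \<in> Pi\<^sub>E I P \<times> Pi\<^sub>E I P. f (fst p) \<noteq> f (snd p)} =
      {p \<in> Pi\<^sub>E I P \<times> Pi\<^sub>E I P. f (fst p) \<noteq> f (mix I (fst p) (snd p))}"
    by auto
  then show ?thesis using card_mix_le [OF assms subset_refl] by simp
qed

text \<open>Only coordinate \<open>i\<close> of the second tuple is read; its other coordinates
  contribute a free factor.\<close>

lemma card_resample_le:
  assumes "finite I" "\<And>i. i \<in> I \<Longrightarrow> finite (P i)" "i \<in> I"
  shows "card {p \<in> Pi\<^sub>E I P \<times> Pi\<^sub>E I P. f (fst p) \<noteq> f ((fst p)(i := snd p i))} \<le>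
    (\<Prod>j\<in>I - {i}. card (P j)) * card {(x, b) \<in> Pi\<^sub>E I P \<times> P i. f x \<noteq> f (x(i := b))}"
proof -
  let ?L = "{p \<in> Pi\<^sub>E I P \<times> Pi\<^sub>E I P. f (fst p) \<noteq> f ((fst p)(i := snd p i))}"
  let ?T = "{(x, b) \<in> Pi\<^sub>E I P \<times> P i. f x \<noteq> f (x(i := b))}"
  let ?g = "\<lambda>p. (restrict (snd p) (I - {i}), fst p, snd p i)"
  have "card ?L \<le> card (Pi\<^sub>E (I - {i}) P \<times> ?T)"
  proof (rule card_inj_on_le)
    show "inj_on ?g ?L"
    proof (rule inj_onI)
      fix p p' assume p: "p \<in> ?L" "p' \<in> ?L" and eq: "?g p = ?g p'"
      have "snd p j = snd p' j" for j
      proof (cases "j \<in> I - {i}")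
        case True
        then show ?thesis using eq by (metis prod.inject restrict_apply')
      next
        case False
        then show ?thesis
        proof (cases "j = i")
          case True
          then show ?thesis using eq by simp
        next
          case neq: False
          have "j \<notin> I" using False neq by simp
          then show ?thesis using p by (auto simp: PiE_iff extensional_def)
        qed
      qed
      then have "snd p = snd p'" by (rule ext)
      then show "p = p'" using eq by (simp add: prod_eq_iff)
    qed
    show "?g ` ?L \<subseteq> Pi\<^sub>E (I - {i}) P \<times> ?T"
      using assms(3) by (auto simp: PiE_iff split: if_splits)
    have "finite (Pi\<^sub>E I P \<times> P i)" using assms by (auto intro!: finite_PiE)
    then have "finite ?T" by (rule rev_finite_subset) auto
    then show "finite (Pi\<^sub>E (I - {i}) P \<times> ?T)" using assms by (auto intro!: finite_PiE)
  qed
  also have "\<dots> = (\<Prod>j\<in>I - {i}. card (P j)) * card ?T"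
    using assms(1) by (simp add: card_cartesian_product card_PiE)
  finally show ?thesis .
qed

lemma disjoint_family_onE:
  "disjoint_family_on P A \<Longrightarrow> i \<in> A \<Longrightarrow> j \<in> A \<Longrightarrow> x \<in> P i \<Longrightarrow> x \<in> P j \<Longrightarrow> i = j"
  unfolding disjoint_family_on_def by blast

lemma inj_on_transversal:
  assumes "disjoint_family_on P A" "I \<subseteq> A" "x \<in> Pi\<^sub>E I P"
  shows "inj_on x I"
proof (rule inj_onI)
  fix i j assume ij: "i \<in> I" "j \<in> I" "x i = x j"
  have "x i \<in> P i" "x i \<in> P j" using assms(3) ij by (auto simp: PiE_iff)
  then show "i = j" using disjoint_family_onE [OF assms(1)] ij assms(2) by (meson subsetD)
qed

text \<open>Membership in \<open>cross_edges\<close> does not ask an edge to lie inside the union of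
  the parts. It does lie there, because it has only \<open>card I\<close> vertices and meets
  \<open>card I\<close> disjoint parts; so it is the image of exactly one transversal.\<close>

lemma card_cross_edges:
  assumes disj: "disjoint_family_on P A" and I: "I \<subseteq> A" "finite I"
    and E: "\<And>e. e \<in> E \<Longrightarrow> finite e \<and> card e = card I"
  shows "card (cross_edges E P I) = card {x \<in> Pi\<^sub>E I P. x ` I \<in> E}"
proof -
  let ?T = "{x \<in> Pi\<^sub>E I P. x ` I \<in> E}"
  have int: "x ` I \<inter> P i = {x i}" if x: "x \<in> Pi\<^sub>E I P" and i: "i \<in> I" for x i
  proof (intro set_eqI iffI)
    fix v assume "v \<in> x ` I \<inter> P i"
    then obtain j where j: "j \<in> I" "v = x j" "x j \<in> P i" by auto
    moreover have "x j \<in> P j" using x j by (auto simp: PiE_iff)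
    ultimately have "i = j" using disjoint_family_onE [OF disj] I(1) i by (meson subsetD)
    then show "v \<in> {x i}" using j by simp
  next
    fix v assume "v \<in> {x i}"
    then show "v \<in> x ` I \<inter> P i" using x i by (auto simp: PiE_iff)
  qed
  have inj: "inj_on (\<lambda>x. x ` I) ?T"
  proof (rule inj_onI)
    fix x y assume xy: "x \<in> ?T" "y \<in> ?T" "x ` I = y ` I"
    have "x \<in> Pi\<^sub>E I P" "y \<in> Pi\<^sub>E I P" using xy by auto
    then show "x = y"
    proof (rule PiE_ext)
      fix i assume i: "i \<in> I"
      have "{x i} = {y i}" using int [of x i] int [of y i] xy i by simp
      then show "x i = y i" by simp
    qed
  qed
  have "(\<lambda>x. x ` I) ` ?T = cross_edges E P I"
  proof (intro set_eqI iffI)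
    fix e assume "e \<in> (\<lambda>x. x ` I) ` ?T"
    then obtain x where "x \<in> Pi\<^sub>E I P" "x ` I \<in> E" "e = x ` I" by blast
    then show "e \<in> cross_edges E P I" by (simp add: cross_edges_def int)
  next
    fix e assume e: "e \<in> cross_edges E P I"
    then have eE: "e \<in> E" and one: "\<And>i. i \<in> I \<Longrightarrow> card (e \<inter> P i) = 1"
      by (simp_all add: cross_edges_def)
    define x where "x = (\<lambda>i\<in>I. the_elem (e \<inter> P i))"
    have xi: "e \<inter> P i = {x i}" if i: "i \<in> I" for i
    proof -
      obtain v where "e \<inter> P i = {v}" using one [OF i] by (rule card_1_singletonE)
      then show ?thesis using i by (simp add: x_def)
    qed
    have "x i \<in> P i" if "i \<in> I" for i using xi [OF that] by auto
    then have x: "x \<in> Pi\<^sub>E I P" by (auto simp: PiE_iff x_def)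
    have "x i \<in> e" if "i \<in> I" for i using xi [OF that] by auto
    then have "x ` I \<subseteq> e" by auto
    moreover have "card (x ` I) = card e"
      using card_image [OF inj_on_transversal [OF disj I(1) x]] E [OF eE] by simp
    ultimately have "x ` I = e" by (intro card_subset_eq) (use E [OF eE] in auto)
    then show "e \<in> (\<lambda>x. x ` I) ` ?T" using x eE by blast
  qed
  then show ?thesis using card_image [OF inj] by simp
qed

lemma card_discordant_pairs:
  assumes "finite S"
  shows "card {p \<in> S \<times> S. f (fst p) \<noteq> f (snd p)} = 2 * (card {x\<in>S. f x} * (card S - card {x\<in>S. f x}))"
proof -
  let ?A = "{x\<in>S. f x}" and ?B = "{x\<in>S. \<not> f x}"
  have "?B = S - ?A" by auto
  then have B: "card ?B = card S - card ?A" using assms by (simp add: card_Diff_subset)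
  have "{p \<in> S \<times> S. f (fst p) \<noteq> f (snd p)} = ?A \<times> ?B \<union> ?B \<times> ?A" by auto
  moreover have "card (?A \<times> ?B \<union> ?B \<times> ?A) = card (?A \<times> ?B) + card (?B \<times> ?A)"
    by (rule card_Un_disjoint) (use assms in auto)
  ultimately show ?thesis by (simp add: card_cartesian_product B)
qed

text \<open>The switches of all tuples through \<open>i\<close> are charged together to the pairs
  inside \<open>P i\<close>. No multiplicity arises: the parts are disjoint, so the vertices of a
  transversal outside \<open>P i\<close> determine both \<open>I\<close> and the transversal away
  from \<open>i\<close>.\<close>

lemma sum_switches_le:
  fixes P :: "nat \<Rightarrow> 'a set"
  assumes V: "finite V" and P: "\<And>i. i < K \<Longrightarrow> P i \<subseteq> V" and disj: "disjoint_family_on P {..<K}"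
    and G: "G \<subseteq> nsets {..<K} k" and i: "i < K"
  shows "(\<Sum>I\<in>{I\<in>G. i \<in> I}. card {(x, b) \<in> Pi\<^sub>E I P \<times> P i. (x ` I \<in> E) \<noteq> ((x(i := b)) ` I \<in> E)})
    \<le> (\<Sum>a\<in>P i. \<Sum>b\<in>P i. set_dist (nbhd k V E a) (nbhd k V E b))"
proof -
  define T where "T I = {(x, b) \<in> Pi\<^sub>E I P \<times> P i. (x ` I \<in> E) \<noteq> ((x(i := b)) ` I \<in> E)}" for I
  define N where "N = nbhd k V E"
  have I: "I \<subseteq> {..<K}" "finite I" "card I = k" if "I \<in> G" for I
    using G that by (auto simp: nsets_def)
  have finP: "finite (P j)" if "j < K" for j by (rule finite_subset [OF P [OF that] V])
  have finG: "finite G" by (rule finite_subset [OF G]) (simp add: finite_imp_finite_nsets)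
  have finN: "finite (N a)" for a
    unfolding N_def nbhd_def using finite_imp_finite_nsets [OF V] by simp
  have finT: "finite (T I)" if "I \<in> G" for I
  proof -
    have "finite (Pi\<^sub>E I P \<times> P i)"
      using I [OF that] finP i by (auto intro!: finite_PiE)
    then show ?thesis by (rule rev_finite_subset) (auto simp: T_def)
  qed
  define R where "R = (SIGMA p : P i \<times> P i. (N (fst p) - N (snd p)) \<union> (N (snd p) - N (fst p)))"
  let ?g = "\<lambda>(I, x, b). ((x i, b), x ` (I - {i}))"
  have "card (SIGMA I : {I\<in>G. i \<in> I}. T I) \<le> card R"
  proof (rule card_inj_on_le)
    show "finite R" unfolding R_def using finP i finN by auto
    show "?g ` (SIGMA I : {I\<in>G. i \<in> I}. T I) \<subseteq> R"
    proof (rule image_subsetI)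
      fix q assume "q \<in> (SIGMA I : {I\<in>G. i \<in> I}. T I)"
      then obtain I x b where q: "q = (I, x, b)" "I \<in> G" "i \<in> I" "x \<in> Pi\<^sub>E I P" "b \<in> P i"
        and sw: "(x ` I \<in> E) \<noteq> ((x(i := b)) ` I \<in> E)" by (auto simp: T_def)
      let ?S = "x ` (I - {i})"
      have "x ` I = ?S \<union> {x i}" using q(3) by auto
      moreover have "(x(i := b)) ` I = ?S \<union> {b}" using q(3) by auto
      ultimately have sw: "(?S \<union> {x i} \<in> E) \<noteq> (?S \<union> {b} \<in> E)" using sw by (simp only: not_False_eq_True)
      have "inj_on x I" by (rule inj_on_transversal [OF disj I(1) [OF q(2)] q(4)])
      then have "inj_on x (I - {i})" by (rule inj_on_subset) auto
      then have "card ?S = card (I - {i})" by (rule card_image)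
      then have "card ?S = k - 1" using I [OF q(2)] q(3) by simp
      moreover have "?S \<subseteq> V"
      proof
        fix v assume "v \<in> ?S"
        then obtain j where "j \<in> I" "v = x j" by auto
        then have "v \<in> P j" "j < K" using q(4) I(1) [OF q(2)] by (auto simp: PiE_iff)
        then show "v \<in> V" using P by blast
      qed
      ultimately have "?S \<in> nsets V (k - 1)" using I(2) [OF q(2)] by (simp add: nsets_def)
      then have "?S \<in> (N (x i) - N b) \<union> (N b - N (x i))" using sw by (auto simp: N_def nbhd_def)
      moreover have "x i \<in> P i" using q by (auto simp: PiE_iff)
      ultimately show "?g q \<in> R" using q by (simp add: R_def)
    qed
    show "inj_on ?g (SIGMA I : {I\<in>G. i \<in> I}. T I)"
    proof (rule inj_onI)
      fix q q' assume qS: "q \<in> (SIGMA I : {I\<in>G. i \<in> I}. T I)"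
        and q'S: "q' \<in> (SIGMA I : {I\<in>G. i \<in> I}. T I)" and eq: "?g q = ?g q'"
      obtain I x b where q: "q = (I, x, b)" "I \<in> G" "i \<in> I" "x \<in> Pi\<^sub>E I P"
        using qS by (auto simp: T_def)
      obtain I' x' b' where q': "q' = (I', x', b')" "I' \<in> G" "i \<in> I'" "x' \<in> Pi\<^sub>E I' P"
        using q'S by (auto simp: T_def)
      have eqs: "x i = x' i" "b = b'" "x ` (I - {i}) = x' ` (I' - {i})" using eq q q' by auto
      \<comment> \<open>The part in which a vertex lies gives back its index. Both index sets and
        both tuples are generalised so that the two inclusions follow from one fact.\<close>
      have step: "j \<in> I' \<and> x j = x' j"
        if J: "I \<in> G" "I' \<in> G" "x \<in> Pi\<^sub>E I P" "x' \<in> Pi\<^sub>E I' P"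
          "x ` (I - {i}) = x' ` (I' - {i})" "j \<in> I - {i}" for I I' x x' j
      proof -
        have "x j \<in> x' ` (I' - {i})" unfolding J(5) [symmetric] using J(6) by (rule imageI)
        then obtain l where l: "l \<in> I'" "x j = x' l" by auto
        have "x j \<in> P j" "x j \<in> P l" using J l by (auto simp: PiE_iff)
        moreover have "j \<in> {..<K}" "l \<in> {..<K}" using I(1) [OF J(1)] I(1) [OF J(2)] J(6) l(1) by auto
        ultimately have "j = l" using disjoint_family_onE [OF disj] by simp
        then show ?thesis using l by simp
      qed
      have "j \<in> I'" if "j \<in> I" for j
        using step [OF q(2) q'(2) q(4) q'(4) eqs(3), of j] that q' by (cases "j = i") auto
      moreover have "j \<in> I" if "j \<in> I'" for j
        using step [OF q'(2) q(2) q'(4) q(4) eqs(3) [symmetric], of j] that q by (cases "j = i") auto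
      ultimately have II: "I = I'" by blast
      have "x = x'"
      proof (rule PiE_ext [OF q(4)])
        show "x' \<in> Pi\<^sub>E I P" using q'(4) II by simp
        show "x j = x' j" if "j \<in> I" for j
          using step [OF q(2) q'(2) q(4) q'(4) eqs(3), of j] that eqs(1) by (cases "j = i") auto
      qed
      then show "q = q'" using q q' II eqs by simp
    qed
  qed
  moreover have "card (SIGMA I : {I\<in>G. i \<in> I}. T I) = (\<Sum>I\<in>{I\<in>G. i \<in> I}. card (T I))"
    using finG finT by (subst card_SigmaI) auto
  moreover have "card R = (\<Sum>a\<in>P i. \<Sum>b\<in>P i. set_dist (N a) (N b))"
  proof -
    have "card ((N a - N b) \<union> (N b - N a)) = set_dist (N a) (N b)" for a b
      unfolding set_dist_def using finN by (intro card_Un_disjoint) auto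
    then have "card R = (\<Sum>p\<in>P i \<times> P i. set_dist (N (fst p)) (N (snd p)))"
      unfolding R_def using finP i finN by (subst card_SigmaI) auto
    then show ?thesis by (simp only: sum.cartesian_product case_prod_unfold)
  qed
  ultimately show ?thesis by (simp add: T_def N_def)
qed

text \<open>At density \<open>t\<close> the share of discordant ordered pairs is
  \<open>2 * t * (1 - t)\<close>. Between \<open>\<epsilon>\<close> and
  \<open>1 - \<epsilon>\<close> this is smallest at the ends, and there
  \<open>1 - \<epsilon>\<close> exceeds \<open>3 / 4\<close>.\<close>

lemma discordant_pairs_ge:
  assumes "\<not> homogeneous \<epsilon> E P I" "0 < \<epsilon>" "\<epsilon> < 1 / 4"
    and disj: "disjoint_family_on P A" and I: "I \<subseteq> A" "finite I"
    and E: "\<And>e. e \<in> E \<Longrightarrow> finite e \<and> card e = card I"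
    and P: "\<And>i. i \<in> I \<Longrightarrow> finite (P i)"
  shows "3 / 2 * \<epsilon> * (\<Prod>i\<in>I. real (card (P i)))\<^sup>2 \<le>
    real (card {p \<in> Pi\<^sub>E I P \<times> Pi\<^sub>E I P. (fst p ` I \<in> E) \<noteq> (snd p ` I \<in> E)})"
proof -
  define m where "m = (\<Prod>i\<in>I. card (P i))"
  define e where "e = card (cross_edges E P I)"
  have fin: "finite (Pi\<^sub>E I P)" using I P by (auto intro!: finite_PiE)
  have m: "card (Pi\<^sub>E I P) = m" using I by (simp add: m_def card_PiE)
  have e: "card {x \<in> Pi\<^sub>E I P. x ` I \<in> E} = e"
    unfolding e_def by (rule card_cross_edges [OF disj I E, symmetric])
  have le: "e \<le> m" unfolding e [symmetric] m [symmetric] by (intro card_mono fin) auto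
  have dens: "\<epsilon> \<le> real e / real m" "real e / real m \<le> 1 - \<epsilon>"
    using assms(1) by (auto simp: homogeneous_def density_def e_def m_def)
  \<comment> \<open>An empty part would give the density \<open>0 / 0 = 0\<close>, which is
    homogeneous.\<close>
  then have pos: "0 < real m" using assms(2) by (cases "m = 0") auto
  have "\<epsilon> * (1 - \<epsilon>) \<le> real e / real m * (1 - real e / real m)"
  proof -
    have "0 \<le> (real e / real m - \<epsilon>) * (1 - \<epsilon> - real e / real m)"
      using dens by (intro mult_nonneg_nonneg) auto
    then show ?thesis by (simp add: algebra_simps)
  qed
  moreover have "\<epsilon> * (3 / 4) \<le> \<epsilon> * (1 - \<epsilon>)" using assms(2,3) by (intro mult_left_mono) auto
  ultimately have "\<epsilon> * (3 / 4) \<le> real e / real m * (1 - real e / real m)" by linarith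
  then have "\<epsilon> * (3 / 4) * (real m)\<^sup>2 \<le> real e / real m * (1 - real e / real m) * (real m)\<^sup>2"
    by (rule mult_right_mono) simp
  also have "\<dots> = real e * (real m - real e)"
    using pos by (simp add: field_simps power2_eq_square)
  finally have "3 / 2 * \<epsilon> * (real m)\<^sup>2 \<le> 2 * (real e * (real m - real e))" by simp
  also have "\<dots> = real (2 * (e * (m - e)))" using le by (simp add: of_nat_diff)
  also have "2 * (e * (m - e)) =
      card {p \<in> Pi\<^sub>E I P \<times> Pi\<^sub>E I P. (fst p ` I \<in> E) \<noteq> (snd p ` I \<in> E)}"
    using card_discordant_pairs [OF fin, of "\<lambda>x. x ` I \<in> E"] e m by simp
  finally show ?thesis by (simp add: m_def)
qed

text \<open>Each bad tuple has many discordant pairs, a discordant pair contains a switch up to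
  \<open>hi ^ (k - 1)\<close> free choices, and the diameters bound the supply of switches. Parts
  outside \<open>J\<close> have no diameter bound, so the tuples in \<open>G\<close> avoid
  them.\<close>

lemma irregular_tuples_bound:
  fixes P :: "nat \<Rightarrow> 'a set" and lo hi \<Delta> \<epsilon> :: real
  assumes H: "uniform_hypergraph k V E" and P: "\<And>i. i < K \<Longrightarrow> P i \<subseteq> V"
    and disj: "disjoint_family_on P {..<K}" and "0 < k"
    and size: "\<And>i. i < K \<Longrightarrow> lo \<le> card (P i) \<and> card (P i) \<le> hi" and "0 < lo"
    and J: "J \<subseteq> {..<K}" and \<epsilon>: "0 < \<epsilon>" "\<epsilon> < 1 / 4" and "0 \<le> \<Delta>"
    and close: "\<And>i a b. i \<in> J \<Longrightarrow> a \<in> P i \<Longrightarrow> b \<in> P i \<Longrightarrow>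
      set_dist (nbhd k V E a) (nbhd k V E b) \<le> \<Delta>"
    and G: "G \<subseteq> nsets {..<K} k" "\<And>I. I \<in> G \<Longrightarrow> I \<subseteq> J" "\<And>I. I \<in> G \<Longrightarrow> \<not> homogeneous \<epsilon> E P I"
  shows "real (card G) * (3 / 2 * \<epsilon> * lo ^ (2 * k)) \<le> hi ^ (k - 1) * (real K * (hi\<^sup>2 * \<Delta>))"
proof (cases "K = 0")
  case True
  then have "G = {}" using G(1) assms(4) by (auto simp: nsets_def)
  then show ?thesis using True by simp
next
  case False
  have V: "finite V" using H by (simp add: uniform_hypergraph_def)
  have finP: "finite (P i)" if "i < K" for i by (rule finite_subset [OF P [OF that] V])
  have finG: "finite G" by (rule finite_subset [OF G(1)]) (simp add: finite_imp_finite_nsets)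
  have hi: "0 \<le> hi" using size [of 0] \<open>0 < lo\<close> False by simp
  have finJ: "finite J" by (rule finite_subset [OF J]) simp
  define T where "T I i = card {(x, b) \<in> Pi\<^sub>E I P \<times> P i. (x ` I \<in> E) \<noteq> ((x(i := b)) ` I \<in> E)}" for I i
  have one: "3 / 2 * \<epsilon> * lo ^ (2 * k) \<le> hi ^ (k - 1) * (\<Sum>i\<in>{i\<in>J. i \<in> I}. real (T I i))"
    if I: "I \<in> G" for I
  proof -
    have IK: "I \<subseteq> {..<K}" "finite I" "card I = k" using I G(1) by (auto simp: nsets_def)
    have less: "i < K" if "i \<in> I" for i using that IK(1) by auto
    have finI: "finite (P i)" if "i \<in> I" for i using finP [OF less [OF that]] .
    have E: "finite e \<and> card e = card I" if "e \<in> E" for e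
      using that H IK(3) by (auto simp: uniform_hypergraph_def nsets_def)
    have "lo ^ k = (\<Prod>i\<in>I. lo)" using IK by simp
    also have "\<dots> \<le> (\<Prod>i\<in>I. real (card (P i)))"
      using size less \<open>0 < lo\<close> by (intro prod_mono) auto
    finally have "(lo ^ k)\<^sup>2 \<le> (\<Prod>i\<in>I. real (card (P i)))\<^sup>2"
      using \<open>0 < lo\<close> by (intro power_mono) auto
    then have "3 / 2 * \<epsilon> * lo ^ (2 * k) \<le> 3 / 2 * \<epsilon> * (\<Prod>i\<in>I. real (card (P i)))\<^sup>2"
      using \<epsilon> by (intro mult_left_mono) (auto simp: power_mult [symmetric] mult.commute)
    also have "\<dots> \<le> real (card {p \<in> Pi\<^sub>E I P \<times> Pi\<^sub>E I P. (fst p ` I \<in> E) \<noteq> (snd p ` I \<in> E)})"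
      by (rule discordant_pairs_ge [OF G(3) [OF I] \<epsilon> disj IK(1,2) E finI])
    also have "\<dots> \<le> real (\<Sum>i\<in>I. card {p \<in> Pi\<^sub>E I P \<times> Pi\<^sub>E I P.
        (fst p ` I \<in> E) \<noteq> ((fst p)(i := snd p i) ` I \<in> E)})"
      unfolding of_nat_le_iff using IK(2) finI
      by (intro card_discordant_pairs_le [where f = "\<lambda>x. x ` I \<in> E"] finite_PiE)
    also have "\<dots> \<le> real (\<Sum>i\<in>I. (\<Prod>j\<in>I - {i}. card (P j)) * T I i)"
      unfolding of_nat_le_iff T_def
      by (intro sum_mono card_resample_le [where f = "\<lambda>x. x ` I \<in> E"] IK(2) finI)
    also have "\<dots> = (\<Sum>i\<in>I. (\<Prod>j\<in>I - {i}. real (card (P j))) * real (T I i))" by simp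
    also have "\<dots> \<le> (\<Sum>i\<in>I. hi ^ (k - 1) * real (T I i))"
    proof (intro sum_mono mult_right_mono)
      fix i assume i: "i \<in> I"
      have "(\<Prod>j\<in>I - {i}. real (card (P j))) \<le> (\<Prod>j\<in>I - {i}. hi)"
        using size less by (intro prod_mono) auto
      also have "\<dots> = hi ^ (k - 1)" using IK i by simp
      finally show "(\<Prod>j\<in>I - {i}. real (card (P j))) \<le> hi ^ (k - 1)" .
    qed simp
    also have "\<dots> = hi ^ (k - 1) * (\<Sum>i\<in>I. real (T I i))" by (simp add: sum_distrib_left)
    also have "(\<Sum>i\<in>I. real (T I i)) = (\<Sum>i\<in>{i\<in>J. i \<in> I}. real (T I i))"
      using G(2) [OF I] by (intro sum.cong) auto
    finally show ?thesis .
  qed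
  have "real (card G) * (3 / 2 * \<epsilon> * lo ^ (2 * k)) = (\<Sum>I\<in>G. 3 / 2 * \<epsilon> * lo ^ (2 * k))" by simp
  also have "\<dots> \<le> (\<Sum>I\<in>G. hi ^ (k - 1) * (\<Sum>i\<in>{i\<in>J. i \<in> I}. real (T I i)))"
    by (intro sum_mono one)
  also have "\<dots> = hi ^ (k - 1) * (\<Sum>I\<in>G. \<Sum>i\<in>{i\<in>J. i \<in> I}. real (T I i))"
    by (simp add: sum_distrib_left)
  \<comment> \<open>Counting by parts instead of tuples gives a bound that does not grow with the
    number of tuples through a part.\<close>
  also have "(\<Sum>I\<in>G. \<Sum>i\<in>{i\<in>J. i \<in> I}. real (T I i)) = (\<Sum>i\<in>J. \<Sum>I\<in>{I\<in>G. i \<in> I}. real (T I i))"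
    by (rule sum.swap_restrict [OF finG finJ])
  also have "hi ^ (k - 1) * \<dots> \<le> hi ^ (k - 1) * (\<Sum>i\<in>J. hi\<^sup>2 * \<Delta>)"
  proof (intro mult_left_mono sum_mono)
    fix i assume i: "i \<in> J"
    then have iK: "i < K" using J by auto
    have "(\<Sum>I\<in>{I\<in>G. i \<in> I}. T I i) \<le> (\<Sum>a\<in>P i. \<Sum>b\<in>P i. set_dist (nbhd k V E a) (nbhd k V E b))"
      unfolding T_def by (rule sum_switches_le [OF V P disj G(1) iK])
    then have "(\<Sum>I\<in>{I\<in>G. i \<in> I}. real (T I i)) \<le>
        (\<Sum>a\<in>P i. \<Sum>b\<in>P i. real (set_dist (nbhd k V E a) (nbhd k V E b)))"
      by (simp only: of_nat_sum [symmetric] of_nat_le_iff)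
    also have "\<dots> \<le> (\<Sum>a\<in>P i. \<Sum>b\<in>P i. \<Delta>)" using i by (intro sum_mono close)
    also have "\<dots> = (real (card (P i)))\<^sup>2 * \<Delta>" by (simp add: power2_eq_square)
    also have "\<dots> \<le> hi\<^sup>2 * \<Delta>"
      using size [OF iK] \<open>0 \<le> \<Delta>\<close> by (intro mult_right_mono power_mono) auto
    finally show "(\<Sum>I\<in>{I\<in>G. i \<in> I}. real (T I i)) \<le> hi\<^sup>2 * \<Delta>" .
  qed (simp add: hi)
  also have "\<dots> \<le> hi ^ (k - 1) * (real K * (hi\<^sup>2 * \<Delta>))"
  proof -
    have "card J \<le> K" using card_mono [OF _ J] by simp
    then show ?thesis using hi \<open>0 \<le> \<Delta>\<close> by (simp add: mult_left_mono mult_right_mono)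
  qed
  finally show ?thesis .
qed

section \<open>Equal slices of an ordering\<close>

definition slice :: "nat \<Rightarrow> nat \<Rightarrow> nat \<Rightarrow> nat set" where
  "slice n K i = {r. r < n \<and> r * K div n = i}"

text \<open>The slice is the interval between the ceilings of \<open>i * n / K\<close> and
  \<open>(i + 1) * n / K\<close>; adding \<open>K - 1\<close> before the division rounds up.\<close>

lemma card_slice:
  assumes "0 < n" "0 < K" "i < K"
  shows "n div K \<le> card (slice n K i) \<and> card (slice n K i) \<le> n div K + 1"
proof -
  let ?A = "i * n + (K - 1)"
  have ceil: "a \<le> r * K \<longleftrightarrow> (a + (K - 1)) div K \<le> r" for a r
  proof -
    have "(a + (K - 1)) div K < Suc r \<longleftrightarrow> a + (K - 1) < Suc r * K"
      using assms(2) by (rule div_less_iff_less_mult)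
    also have "\<dots> \<longleftrightarrow> a \<le> r * K" using assms(2) by auto
    finally show ?thesis by auto
  qed
  have "r \<in> slice n K i \<longleftrightarrow> r \<in> {?A div K..<(?A + n) div K}" for r
  proof -
    have "r * K div n = i \<longleftrightarrow> i * n \<le> r * K \<and> r * K < Suc i * n"
      using assms(1) by (metis div_less_iff_less_mult le_antisym less_Suc_eq_le less_eq_div_iff_mult_less_eq order_refl)
    moreover have "r < n" if "r * K < Suc i * n"
    proof (rule ccontr)
      assume "\<not> r < n"
      then have "n * K \<le> r * K" by simp
      moreover have "Suc i * n \<le> K * n" using assms(3) by (intro mult_right_mono) auto
      ultimately show False using that unfolding mult.commute [of n K] by linarith
    qed
    ultimately have "r \<in> slice n K i \<longleftrightarrow> i * n \<le> r * K \<and> \<not> i * n + n \<le> r * K"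
      by (auto simp: slice_def)
    then show ?thesis unfolding ceil by (auto simp: add.commute add.left_commute)
  qed
  then have "slice n K i = {?A div K..<(?A + n) div K}" by blast
  \<comment> \<open>Consecutive ceilings differ by \<open>n div K\<close> plus a carry, and the
    carry is at most 1.\<close>
  then have "card (slice n K i) = n div K + (?A mod K + n mod K) div K"
    by (simp only: card_atLeastLessThan div_add1_eq [of ?A n K])
  moreover have "(?A mod K + n mod K) div K \<le> 1"
  proof -
    have "?A mod K < K" "n mod K < K" using assms(2) by auto
    then have "?A mod K + n mod K < 2 * K" by linarith
    then have "(?A mod K + n mod K) div K < 2" using assms(2) by (simp add: div_less_iff_less_mult)
    then show ?thesis by simp
  qed
  ultimately show ?thesis by simp
qed

lemma slice_less:
  assumes "i < j" "r \<in> slice n K i" "r' \<in> slice n K j"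
  shows "r < r'"
proof (rule ccontr)
  assume "\<not> r < r'"
  then have "r' * K div n \<le> r * K div n" by (intro div_le_mono mult_right_mono) auto
  then show False using assms by (simp add: slice_def)
qed

lemma card_nsets: "finite A \<Longrightarrow> card (nsets A k) = card A choose k"
  by (subst n_subsets [symmetric]) (auto simp: nsets_def finite_subset intro!: arg_cong [where f = card])

lemma card_nsets_containing:
  assumes "finite A" "i \<in> A" "0 < k"
  shows "card {I\<in>nsets A k. i \<in> I} \<le> (card A - 1) choose (k - 1)"
proof -
  have "card {I\<in>nsets A k. i \<in> I} \<le> card (nsets (A - {i}) (k - 1))"
  proof (rule card_inj_on_le)
    show "inj_on (\<lambda>I. I - {i}) {I\<in>nsets A k. i \<in> I}"
      by (rule inj_on_inverseI [where g = "insert i"]) (simp add: insert_absorb)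
    show "(\<lambda>I. I - {i}) ` {I\<in>nsets A k. i \<in> I} \<subseteq> nsets (A - {i}) (k - 1)"
      by (auto simp: nsets_def)
    show "finite (nsets (A - {i}) (k - 1))" using assms(1) by (simp add: finite_imp_finite_nsets)
  qed
  then show ?thesis using assms by (simp add: card_nsets)
qed

text \<open>A union bound over \<open>B\<close>: a fixed index lies in the fraction
  \<open>k / K\<close> of all \<open>k\<close>-sets.\<close>

lemma card_nsets_meeting:
  assumes "B \<subseteq> {..<K}" "0 < k" "0 < K"
  shows "real (card {I\<in>nsets {..<K} k. I \<inter> B \<noteq> {}}) \<le> real (card B) * real k / real K * real (K choose k)"
proof -
  have finB: "finite B" by (rule finite_subset [OF assms(1)]) simp
  have "{I\<in>nsets {..<K} k. I \<inter> B \<noteq> {}} = (\<Union>i\<in>B. {I\<in>nsets {..<K} k. i \<in> I})" by auto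
  then have "card {I\<in>nsets {..<K} k. I \<inter> B \<noteq> {}} \<le> (\<Sum>i\<in>B. card {I\<in>nsets {..<K} k. i \<in> I})"
    using card_UN_le [OF finB] by simp
  also have "\<dots> \<le> (\<Sum>i\<in>B. (K - 1) choose (k - 1))"
    using card_nsets_containing [of "{..<K}"] assms by (intro sum_mono) auto
  also have "\<dots> = card B * ((K - 1) choose (k - 1))" by simp
  finally have "real (card {I\<in>nsets {..<K} k. I \<inter> B \<noteq> {}}) * real K \<le>
      real (card B) * (real K * real ((K - 1) choose (k - 1)))"
    using mult_right_mono [of _ _ "real K"] by (simp add: mult.assoc mult.commute flip: of_nat_mult)
  also have "real K * real ((K - 1) choose (k - 1)) = real k * real (K choose k)"
    using times_binomial_minus1_eq [OF assms(2), of K] by (simp flip: of_nat_mult)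
  finally show ?thesis using assms(3) by (simp add: field_simps)
qed

lemma UN_slices:
  assumes "0 < K"
  shows "(\<Union>i<K. slice n K i) = {..<n}"
proof (intro set_eqI iffI)
  fix r assume "r \<in> {..<n}"
  then have "r < n" by simp
  then have "r * K < K * n" using assms by simp
  then have "r * K div n < K" using \<open>r < n\<close> by (simp add: div_less_iff_less_mult)
  moreover have "r \<in> slice n K (r * K div n)" using \<open>r < n\<close> by (simp add: slice_def)
  ultimately show "r \<in> (\<Union>i<K. slice n K i)" by blast
qed (auto simp: slice_def)

text \<open>Each split slice is mapped to the larger of two labels in it. All labels of a later
  slice are at least that large, and its chosen label exceeds another one of the same slice; so the
  chosen labels are distinct.\<close>

lemma few_split_slices:
  assumes mono: "\<And>r r'. r \<le> r' \<Longrightarrow> r' < n \<Longrightarrow> \<kappa> r \<le> \<kappa> r'" and less: "\<And>r. r < n \<Longrightarrow> \<kappa> r < (M::nat)"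
  shows "card {i. i < K \<and> (\<exists>r\<in>slice n K i. \<exists>r'\<in>slice n K i. \<kappa> r < \<kappa> r')} \<le> M"
proof -
  let ?B = "{i. i < K \<and> (\<exists>r\<in>slice n K i. \<exists>r'\<in>slice n K i. \<kappa> r < \<kappa> r')}"
  have "\<forall>i\<in>?B. \<exists>r r'. r \<in> slice n K i \<and> r' \<in> slice n K i \<and> \<kappa> r < \<kappa> r'" by auto
  then obtain l where "\<forall>i\<in>?B. \<exists>r'. l i \<in> slice n K i \<and> r' \<in> slice n K i \<and> \<kappa> (l i) < \<kappa> r'"
    unfolding bchoice_iff by blast
  then obtain h where lh: "\<forall>i\<in>?B. l i \<in> slice n K i \<and> h i \<in> slice n K i \<and> \<kappa> (l i) < \<kappa> (h i)"
    unfolding bchoice_iff by blast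
  have lt: "\<kappa> (h i) < \<kappa> (h j)" if "i \<in> ?B" "j \<in> ?B" "i < j" for i j
  proof -
    have i: "h i \<in> slice n K i" and j: "l j \<in> slice n K j" "\<kappa> (l j) < \<kappa> (h j)"
      using lh that(1,2) by auto
    have "h i < l j" by (rule slice_less [OF that(3) i j(1)])
    moreover have "l j < n" using j(1) by (simp add: slice_def)
    ultimately have "\<kappa> (h i) \<le> \<kappa> (l j)" by (intro mono) auto
    then show ?thesis using j(2) by simp
  qed
  have "inj_on (\<kappa> \<circ> h) ?B"
  proof (rule linorder_inj_onI')
    fix i j assume "i \<in> ?B" "j \<in> ?B" "i < j"
    from lt [OF this] show "(\<kappa> \<circ> h) i \<noteq> (\<kappa> \<circ> h) j" by simp
  qed
  moreover have "(\<kappa> \<circ> h) ` ?B \<subseteq> {..<M}"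
  proof (rule image_subsetI)
    fix i assume "i \<in> ?B"
    then have "h i \<in> slice n K i" using lh by blast
    then show "(\<kappa> \<circ> h) i \<in> {..<M}" using less by (simp add: slice_def)
  qed
  ultimately have "card ?B \<le> card {..<M}" by (rule card_inj_on_le) simp
  then show ?thesis by simp
qed

text \<open>Here \<open>u\<close> is the mean part size, and parts have between \<open>u / 2\<close>
  and \<open>2 * u\<close> vertices. All powers of \<open>u\<close> cancel. The constant required of
  \<open>q\<close> collects the rest: \<open>2 ^ (2 * k)\<close> from the lower size,
  \<open>2 ^ (k + 1)\<close> from the upper size, 2 from the diameter, 2 from clearing
  \<open>3 / 2\<close>, and \<open>k ^ k\<close> from comparing \<open>K ^ k\<close> with a binomial
  coefficient.\<close>

lemma irregular_count_arith:
  fixes c \<epsilon> u q \<Delta> :: real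
  assumes "0 < k" "0 < \<epsilon>" "0 < u" "0 < q" "0 < K"
    and \<Delta>: "\<Delta> = 2 * (u * real K) ^ (k - 1) / q"
    and q: "2 ^ (3 * k + 3) * real k ^ k \<le> \<epsilon>\<^sup>2 * q"
    and le: "c * (3 / 2 * \<epsilon> * (u / 2) ^ (2 * k)) \<le> (2 * u) ^ (k - 1) * (real K * ((2 * u)\<^sup>2 * \<Delta>))"
  shows "c \<le> \<epsilon> / 3 * (real K / real k) ^ k"
proof -
  obtain m where k: "k = Suc m" using assms(1) by (cases k) auto
  define U where "U = u ^ (2 * k)"
  have U: "0 < U" using assms(3) by (simp add: U_def)
  have "2 * k = m + m + 2" by (simp add: k)
  then have U': "U = u ^ m * u ^ m * (u * u)"
    unfolding U_def by (simp only: power_add power2_eq_square)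
  have "(2 * u) ^ (k - 1) * (real K * ((2 * u)\<^sup>2 * \<Delta>)) =
      2 ^ m * u ^ m * (real K * ((2 * u) * (2 * u) * (2 * (u ^ m * real K ^ m) / q)))"
    by (simp only: \<Delta> k diff_Suc_1 power_mult_distrib power2_eq_square)
  also have "\<dots> = U * (8 * 2 ^ m * real K ^ k / q)" by (simp add: U' k)
  finally have rhs: "(2 * u) ^ (k - 1) * (real K * ((2 * u)\<^sup>2 * \<Delta>)) = U * (8 * 2 ^ m * real K ^ k / q)" .
  have "c * (3 / 2 * \<epsilon> * (u / 2) ^ (2 * k)) = U * (c * (3 / 2 * \<epsilon>) / 2 ^ (2 * k))"
    by (simp add: U_def power_divide)
  with le rhs have "U * (c * (3 / 2 * \<epsilon>) / 2 ^ (2 * k)) \<le> U * (8 * 2 ^ m * real K ^ k / q)"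
    by (simp only:)
  then have "c * (3 / 2 * \<epsilon>) / 2 ^ (2 * k) \<le> 8 * 2 ^ m * real K ^ k / q"
    using U by (simp only: mult_le_cancel_left_pos)
  then have "c * (3 / 2 * \<epsilon>) * q \<le> 8 * 2 ^ m * real K ^ k * 2 ^ (2 * k)"
    using assms(4) by (simp only: pos_divide_le_eq pos_le_divide_eq zero_less_power zero_less_numeral times_divide_eq_left)
  also have "\<dots> = 2 ^ (3 * k + 3) / 2 * real K ^ k"
  proof -
    have "3 * k + 3 = m + 2 * k + 4" by (simp add: k)
    then have "(2::real) ^ (3 * k + 3) = 2 ^ m * 2 ^ (2 * k) * 16" by (simp only: power_add) simp
    then show ?thesis by simp
  qed
  finally have 1: "c * (3 / 2 * \<epsilon>) * q \<le> 2 ^ (3 * k + 3) / 2 * real K ^ k" .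
  have "c * (3 * \<epsilon>) * q * real k ^ k \<le> 2 ^ (3 * k + 3) * real k ^ k * real K ^ k"
    using mult_right_mono [OF 1, of "2 * real k ^ k"] by (simp add: algebra_simps)
  also have "\<dots> \<le> \<epsilon>\<^sup>2 * q * real K ^ k" using q by (rule mult_right_mono) simp
  finally have "(\<epsilon> * q) * (c * 3 * real k ^ k) \<le> (\<epsilon> * q) * (\<epsilon> * real K ^ k)"
    by (simp add: power2_eq_square algebra_simps)
  then have "c * 3 * real k ^ k \<le> \<epsilon> * real K ^ k"
    using assms(2,4) by (simp only: mult_le_cancel_left_pos mult_pos_pos)
  then show ?thesis using assms(1) by (simp add: power_divide field_simps)
qed

text \<open>The labels \<open>\<kappa>\<close> are cluster indices along the ordering. The budget
  \<open>\<epsilon>\<close> is divided: \<open>\<epsilon> / 2\<close> for tuples that meet a split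
  slice, which dictates \<open>K\<close>, and \<open>\<epsilon> / 3\<close> for bad tuples of
  unsplit slices, which dictates \<open>q\<close>.\<close>

lemma regular_of_ordering:
  fixes y :: "nat \<Rightarrow> 'a" and \<epsilon> :: real
  assumes H: "uniform_hypergraph k V E" and "0 < k" and \<epsilon>: "0 < \<epsilon>" "\<epsilon> < 1 / 4"
    and bij: "bij_betw y {..<n} V"
    and mono: "\<And>r r'. r \<le> r' \<Longrightarrow> r' < n \<Longrightarrow> \<kappa> r \<le> \<kappa> r'" and less: "\<And>r. r < n \<Longrightarrow> \<kappa> r < (M::nat)"
    and close: "\<And>r r'. r < n \<Longrightarrow> r' < n \<Longrightarrow> \<kappa> r = \<kappa> r' \<Longrightarrow>
      set_dist (nbhd k V E (y r)) (nbhd k V E (y r')) * q \<le> 2 * n ^ (k - 1)"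
    and K: "K \<le> n" "0 < n" "2 * real k * real M \<le> \<epsilon> * real K"
    and q: "2 ^ (3 * k + 3) * real k ^ k \<le> \<epsilon>\<^sup>2 * real q"
  shows "equitable_partition V K (\<lambda>i. y ` slice n K i)"
    and "\<forall>i<K. y ` slice n K i \<noteq> {}"
    and "real (card {I \<in> nsets {..<K} k. \<not> homogeneous \<epsilon> E (\<lambda>i. y ` slice n K i) I}) \<le>
      \<epsilon> * real (K choose k)"
proof -
  define P where "P = (\<lambda>i. y ` slice n K i)"
  have M: "0 < M" using less [OF K(2)] by simp
  \<comment> \<open>This permits the lower bound \<open>(K / k) ^ k\<close> for
    \<open>K choose k\<close>.\<close>
  have kK: "k \<le> K"
  proof -
    have "2 * real k * 1 \<le> 2 * real k * real M" using M by (intro mult_left_mono) auto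
    also have "\<dots> \<le> \<epsilon> * real K" by (rule K)
    also have "\<dots> \<le> 1 * real K" using \<epsilon> by (intro mult_right_mono) auto
    finally show ?thesis by simp
  qed
  then have K0: "0 < K" using \<open>0 < k\<close> by simp
  have q0: "0 < real q"
  proof (rule ccontr)
    assume "\<not> 0 < real q"
    then have "2 ^ (3 * k + 3) * real k ^ k \<le> 0" using q by simp
    moreover have "0 < 2 ^ (3 * k + 3) * real k ^ k" using \<open>0 < k\<close> by simp
    ultimately show False by linarith
  qed
  have inj: "inj_on y {..<n}" and img: "y ` {..<n} = V" using bij by (auto simp: bij_betw_def)
  have sub: "slice n K i \<subseteq> {..<n}" for i by (auto simp: slice_def)
  have cardP: "card (P i) = card (slice n K i)" for i
    unfolding P_def by (rule card_image [OF inj_on_subset [OF inj sub]])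
  have size: "n div K \<le> card (P i)" "card (P i) \<le> n div K + 1" if "i < K" for i
    unfolding cardP using card_slice [OF K(2) K0 that] by auto
  have PV: "P i \<subseteq> V" for i unfolding P_def img [symmetric] by (rule image_mono [OF sub])
  have disj: "disjoint_family_on P {..<K}" unfolding disjoint_family_on_def
  proof (intro ballI impI)
    fix i j :: nat assume "i \<noteq> j"
    then have "slice n K i \<inter> slice n K j = {}" by (auto simp: slice_def)
    then show "P i \<inter> P j = {}"
      unfolding P_def inj_on_image_Int [OF inj sub sub, symmetric] by simp
  qed
  have "(\<Union>i<K. P i) = V" by (simp only: P_def image_UN [symmetric] UN_slices [OF K0] img)
  moreover have "card (P i) \<le> card (P j) + 1" if "i < K" "j < K" for i j
    using size(2) [OF that(1)] size(1) [OF that(2)] by linarith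
  ultimately show "equitable_partition V K (\<lambda>i. y ` slice n K i)"
    using disj by (simp add: equitable_partition_def P_def)
  have nK: "1 \<le> n div K" using K(1) K0 by (simp add: Suc_le_eq div_greater_zero_iff)
  have "P i \<noteq> {}" if "i < K" for i using size(1) [OF that] nK by auto
  then show "\<forall>i<K. y ` slice n K i \<noteq> {}" by (simp add: P_def)
  define u where "u = real n / real K"
  have u: "0 < u" using K(2) K0 by (simp add: u_def)
  \<comment> \<open>Rounding \<open>u\<close> down at most halves it, because the quotient
    \<open>n div K\<close> is at least 1.\<close>
  have lo: "u / 2 \<le> real (n div K)"
  proof -
    have "n < K + n div K * K" by (rule dividend_less_div_times [OF K0])
    also have "\<dots> \<le> n div K * K + n div K * K" using nK by (intro add_right_mono) simp
    finally have "real n \<le> real (n div K * K + n div K * K)" unfolding of_nat_le_iff by (rule less_imp_le)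
    then show ?thesis using K0 by (simp add: u_def field_simps)
  qed
  have hi: "real (n div K + 1) \<le> 2 * u"
  proof -
    have "real (n div K) \<le> u" unfolding u_def by (rule of_nat_div_le_of_nat)
    moreover have "1 \<le> u" using K(1) K0 by (simp add: u_def)
    ultimately show ?thesis by simp
  qed
  define B where "B = {i. i < K \<and> (\<exists>r\<in>slice n K i. \<exists>r'\<in>slice n K i. \<kappa> r < \<kappa> r')}"
  have cardB: "card B \<le> M" unfolding B_def by (rule few_split_slices [OF mono less])
  define J where "J = {..<K} - B"
  define \<Delta> where "\<Delta> = 2 * (u * real K) ^ (k - 1) / real q"
  have uK: "u * real K = real n" using K0 by (simp add: u_def)
  have closeJ: "real (set_dist (nbhd k V E a) (nbhd k V E b)) \<le> \<Delta>"
    if ij: "i \<in> J" "a \<in> P i" "b \<in> P i" for i a b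
  proof -
    obtain r r' where r: "r \<in> slice n K i" "r' \<in> slice n K i" "a = y r" "b = y r'"
      using ij by (auto simp: P_def)
    have "i < K" "i \<notin> B" using ij by (auto simp: J_def)
    then have "\<not> \<kappa> r < \<kappa> r'" "\<not> \<kappa> r' < \<kappa> r" using r by (auto simp: B_def)
    then have "\<kappa> r = \<kappa> r'" by simp
    then have "set_dist (nbhd k V E a) (nbhd k V E b) * q \<le> 2 * n ^ (k - 1)"
      using close r sub by (auto simp: slice_def)
    then have "real (set_dist (nbhd k V E a) (nbhd k V E b) * q) \<le> real (2 * n ^ (k - 1))"
      unfolding of_nat_le_iff .
    then show ?thesis using q0 by (simp add: \<Delta>_def uK field_simps)
  qed
  define G where "G = {I \<in> nsets {..<K} k. I \<subseteq> J \<and> \<not> homogeneous \<epsilon> E P I}"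
  have "real (card G) * (3 / 2 * \<epsilon> * (u / 2) ^ (2 * k)) \<le>
      (2 * u) ^ (k - 1) * (real K * ((2 * u)\<^sup>2 * \<Delta>))"
  proof (rule irregular_tuples_bound [OF H PV disj \<open>0 < k\<close> _ _ _ \<epsilon> _ closeJ])
    fix i assume "i < K"
    from size [OF this] lo hi show "u / 2 \<le> real (card (P i)) \<and> real (card (P i)) \<le> 2 * u"
      by (meson of_nat_le_iff order_trans)
  next
    show "J \<subseteq> {..<K}" by (auto simp: J_def)
    show "0 \<le> \<Delta>" using u q0 by (simp add: \<Delta>_def)
  qed (use u in \<open>auto simp: G_def\<close>)
  then have "real (card G) \<le> \<epsilon> / 3 * (real K / real k) ^ k"
    by (rule irregular_count_arith [OF \<open>0 < k\<close> \<epsilon>(1) u q0 K0 \<Delta>_def q])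
  also have "\<dots> \<le> \<epsilon> / 3 * real (K choose k)"
    using \<epsilon> binomial_ge_n_over_k_pow_k [OF kK, where ?'a = real] by (intro mult_left_mono) auto
  finally have cardG: "real (card G) \<le> \<epsilon> / 3 * real (K choose k)" .
  have "real (card {I \<in> nsets {..<K} k. I \<inter> B \<noteq> {}}) \<le> real (card B) * real k / real K * real (K choose k)"
    by (rule card_nsets_meeting) (use \<open>0 < k\<close> K0 in \<open>auto simp: B_def\<close>)
  also have "\<dots> \<le> \<epsilon> / 2 * real (K choose k)"
  proof (rule mult_right_mono)
    have "real (card B) * real k \<le> real M * real k" using cardB by (intro mult_right_mono) auto
    also have "\<dots> \<le> \<epsilon> / 2 * real K" using K(3) by (simp add: algebra_simps)
    finally show "real (card B) * real k / real K \<le> \<epsilon> / 2" using K0 by (simp add: field_simps)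
  qed simp
  finally have cardM: "real (card {I \<in> nsets {..<K} k. I \<inter> B \<noteq> {}}) \<le> \<epsilon> / 2 * real (K choose k)" .
  have "{I \<in> nsets {..<K} k. \<not> homogeneous \<epsilon> E P I} \<subseteq> G \<union> {I \<in> nsets {..<K} k. I \<inter> B \<noteq> {}}"
    by (auto simp: G_def J_def nsets_def)
  then have "card {I \<in> nsets {..<K} k. \<not> homogeneous \<epsilon> E P I} \<le> card (G \<union> {I \<in> nsets {..<K} k. I \<inter> B \<noteq> {}})"
    by (rule card_mono [rotated]) (simp add: G_def finite_imp_finite_nsets)
  also have "\<dots> \<le> card G + card {I \<in> nsets {..<K} k. I \<inter> B \<noteq> {}}" by (rule card_Un_le)
  finally have "real (card {I \<in> nsets {..<K} k. \<not> homogeneous \<epsilon> E P I}) \<le>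
      real (card G) + real (card {I \<in> nsets {..<K} k. I \<inter> B \<noteq> {}})"
    unfolding of_nat_add [symmetric] of_nat_le_iff .
  also have "\<dots> \<le> \<epsilon> / 3 * real (K choose k) + \<epsilon> / 2 * real (K choose k)"
    by (rule add_mono [OF cardG cardM])
  also have "\<dots> = (\<epsilon> / 3 + \<epsilon> / 2) * real (K choose k)" by (simp only: distrib_right)
  also have "\<dots> \<le> \<epsilon> * real (K choose k)" using \<epsilon> by (intro mult_right_mono) auto
  finally show "real (card {I \<in> nsets {..<K} k. \<not> homogeneous \<epsilon> E (\<lambda>i. y ` slice n K i) I}) \<le>
      \<epsilon> * real (K choose k)"
    by (simp add: P_def)
qed

text \<open>The only candidate for a crossing edge is the union of the parts, so the density is 0 or
  1; an empty part gives \<open>0 / 0 = 0\<close>.\<close>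

lemma homogeneous_singletons:
  assumes H: "uniform_hypergraph k V E" and disj: "disjoint_family_on P I" and I: "finite I" "card I = k"
    and one: "\<And>i. i \<in> I \<Longrightarrow> finite (P i) \<and> card (P i) \<le> 1" and "0 < \<epsilon>"
  shows "homogeneous \<epsilon> E P I"
proof (cases "\<exists>i\<in>I. card (P i) = 0")
  case True
  then have "(\<Prod>i\<in>I. card (P i)) = 0" using I(1) by (auto intro: prod_zero)
  then have "density E P I = 0" unfolding density_def by (simp only: of_nat_0 div_by_0)
  then show ?thesis using assms by (simp add: homogeneous_def)
next
  case False
  have card1: "card (P i) = 1" if "i \<in> I" for i using one [OF that] False that by force
  have "cross_edges E P I \<subseteq> {\<Union>i\<in>I. P i}"
  proof
    fix e assume e: "e \<in> cross_edges E P I"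
    then have e': "finite e" "card e = k" and ei: "\<And>i. i \<in> I \<Longrightarrow> card (e \<inter> P i) = 1"
      using H by (auto simp: cross_edges_def uniform_hypergraph_def nsets_def)
    have "P i \<subseteq> e" if i: "i \<in> I" for i
    proof -
      have "e \<inter> P i = P i" by (rule card_subset_eq) (use one card1 ei i in auto)
      then show ?thesis by auto
    qed
    then have "(\<Union>i\<in>I. P i) \<subseteq> e" by auto
    moreover have "card (\<Union>i\<in>I. P i) = (\<Sum>i\<in>I. card (P i))"
      by (rule card_UN_disjoint) (use I one disj in \<open>auto simp: disjoint_family_on_def\<close>)
    then have "card (\<Union>i\<in>I. P i) = card e" using card1 I e' by simp
    ultimately have "(\<Union>i\<in>I. P i) = e" by (intro card_subset_eq e'(1))
    then show "e \<in> {\<Union>i\<in>I. P i}" by simp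
  qed
  then have "card (cross_edges E P I) \<le> card {\<Union>i\<in>I. P i}" by (rule card_mono [rotated]) simp
  then have "card (cross_edges E P I) = 0 \<or> card (cross_edges E P I) = 1" by auto
  then show ?thesis using \<open>0 < \<epsilon>\<close> card1 by (auto simp: homogeneous_def density_def)
qed

section \<open>The adjacency tensor\<close>

lemma digits_inject:
  fixes j j' n :: nat
  assumes "j < n ^ m" "j' < n ^ m" "\<And>i. i < m \<Longrightarrow> j div n ^ i mod n = j' div n ^ i mod n"
  shows "j = j'"
  using assms
proof (induction m arbitrary: j j')
  case (Suc m)
  have "0 < n" using Suc.prems(1) by (cases n) auto
  have "j div n = j' div n"
  proof (rule Suc.IH)
    show "j div n < n ^ m" "j' div n < n ^ m"
      using Suc.prems(1,2) \<open>0 < n\<close> by (simp_all add: div_less_iff_less_mult mult.commute)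
    fix i assume "i < m"
    then have "j div n ^ Suc i mod n = j' div n ^ Suc i mod n" by (intro Suc.prems(3)) simp
    then show "j div n div n ^ i mod n = j' div n div n ^ i mod n" by (simp add: div_mult2_eq)
  qed
  moreover have "j mod n = j' mod n" using Suc.prems(3) [of 0] by simp
  ultimately show ?case by (metis div_mult_mod_eq)
qed simp

definition digit_tuple :: "nat \<Rightarrow> nat \<Rightarrow> nat \<Rightarrow> nat \<Rightarrow> nat" where
  "digit_tuple n m j = (\<lambda>i\<in>{..<m}. j div n ^ i mod n)"

text \<open>The order of the digits is forgotten, and repeated digits leave fewer than
  \<open>m\<close> elements. The ordered version \<open>digit_tuple\<close> lives in a
  \<open>PiE\<close>, where tuples can be counted.\<close>

definition digits :: "nat \<Rightarrow> nat \<Rightarrow> nat \<Rightarrow> nat set" where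
  "digits n m j = (\<lambda>i. j div n ^ i mod n) ` {..<m}"

lemma digit_tuple_image: "digit_tuple n m j ` {..<m} = digits n m j"
  unfolding digits_def digit_tuple_def by (rule image_cong) auto

lemma inj_on_digit_tuple: "inj_on (digit_tuple n m) {..<n ^ m}"
proof (rule inj_onI)
  fix j j' assume j: "j \<in> {..<n ^ m}" "j' \<in> {..<n ^ m}" and eq: "digit_tuple n m j = digit_tuple n m j'"
  show "j = j'"
  proof (rule digits_inject)
    fix i assume "i < m"
    then show "j div n ^ i mod n = j' div n ^ i mod n"
      using fun_cong [OF eq, of i] by (simp add: digit_tuple_def)
  qed (use j in auto)
qed

text \<open>An injection between two finite sets of size \<open>n ^ m\<close> is onto.\<close>

lemma digit_tuple_surj:
  assumes "0 < n" "x \<in> Pi\<^sub>E {..<m} (\<lambda>_. {..<n})"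
  shows "\<exists>j<n ^ m. digit_tuple n m j = x"
proof -
  have sub: "digit_tuple n m ` {..<n ^ m} \<subseteq> Pi\<^sub>E {..<m} (\<lambda>_. {..<n})"
    using assms(1) by (simp add: image_subset_iff digit_tuple_def restrict_PiE_iff)
  have "card (digit_tuple n m ` {..<n ^ m}) = card (Pi\<^sub>E {..<m} (\<lambda>_. {..<n}))"
    by (simp add: card_image [OF inj_on_digit_tuple] card_PiE)
  then have "digit_tuple n m ` {..<n ^ m} = Pi\<^sub>E {..<m} (\<lambda>_. {..<n})"
    by (intro card_subset_eq sub) (auto intro: finite_PiE)
  then have "x \<in> digit_tuple n m ` {..<n ^ m}" using assms(2) by simp
  then show ?thesis by auto
qed

text \<open>The Hamming distance of two slices of the tensor: \<open>u + n * j\<close> has lowest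
  digit \<open>u\<close>, and its other digits are those of \<open>j\<close>.\<close>

definition tensor_dist :: "nat \<Rightarrow> nat \<Rightarrow> nat set set \<Rightarrow> nat \<Rightarrow> nat \<Rightarrow> nat" where
  "tensor_dist k n E u v =
    card {j. j < n ^ (k - 1) \<and> adjacency k n E (u + n * j) \<noteq> adjacency k n E (v + n * j)}"

lemma tensor_index_less:
  fixes u n j :: nat
  assumes "0 < k" "u < n" "j < n ^ (k - 1)"
  shows "u + n * j < n ^ k"
proof -
  obtain m where k: "k = Suc m" using assms(1) by (cases k) auto
  have "u + n * j < n * Suc j" using assms(2) by simp
  also have "\<dots> \<le> n * n ^ m" using assms(3) by (intro mult_left_mono) (auto simp: k)
  finally show ?thesis by (simp add: k)
qed

lemma adjacency_eq:
  assumes "0 < k" "u < n" "j < n ^ (k - 1)"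
  shows "adjacency k n E (u + n * j) = of_bool (insert u (digits n (k - 1) j) \<in> E)"
proof -
  obtain m where k: "k = Suc m" using assms(1) by (cases k) auto
  have "(\<lambda>i. (u + n * j) div n ^ i mod n) ` {..<Suc m} = insert u (digits n m j)"
  proof -
    have "(u + n * j) div n ^ Suc i mod n = j div n ^ i mod n" for i
      using assms(2) by (simp add: div_mult2_eq)
    then show ?thesis
      using assms(2) unfolding lessThan_Suc_eq_insert_0 digits_def by (simp add: image_image)
  qed
  then show ?thesis using tensor_index_less [OF assms] by (simp add: adjacency_def k)
qed

text \<open>Tuples with repeated digits are harmless: they have fewer than \<open>k - 1\<close>
  distinct values, so one more vertex cannot complete them to an edge.\<close>

lemma digits_mem_nbhd:
  assumes "uniform_hypergraph k {..<n} E" "0 < k" "u < n" "j < n ^ (k - 1)"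
  shows "insert u (digits n (k - 1) j) \<in> E \<longleftrightarrow> digits n (k - 1) j \<in> nbhd k {..<n} E u"
proof
  let ?S = "digits n (k - 1) j"
  have fin: "finite ?S" by (simp add: digits_def)
  assume e: "insert u ?S \<in> E"
  then have "insert u ?S \<subseteq> {..<n}" "card (insert u ?S) = k"
    using assms(1) by (auto simp: uniform_hypergraph_def nsets_def)
  moreover have "card (insert u ?S) \<le> Suc (card ?S)" using fin by (simp add: card_insert_if)
  moreover have "card ?S \<le> k - 1" unfolding digits_def using card_image_le [of "{..<k - 1}"] by simp
  ultimately have "?S \<in> nsets {..<n} (k - 1)" using assms(2) fin by (simp add: nsets_def)
  then show "?S \<in> nbhd k {..<n} E u" using e by (simp add: nbhd_def)
qed (simp add: nbhd_def)

text \<open>A \<open>(k - 1)\<close>-set is coded by at least one index, through an enumeration of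
  its elements, and by at most as many as there are maps from the \<open>k - 1\<close> positions
  into it.\<close>

lemma tensor_dist_bounds:
  assumes H: "uniform_hypergraph k {..<n} E" and "0 < k" "u < n" "v < n"
  shows "set_dist (nbhd k {..<n} E u) (nbhd k {..<n} E v) \<le> tensor_dist k n E u v"
    and "tensor_dist k n E u v \<le>
      (k - 1) ^ (k - 1) * set_dist (nbhd k {..<n} E u) (nbhd k {..<n} E v)"
proof -
  define m where "m = k - 1"
  define N where "N = nbhd k {..<n} E"
  define X where "X = (N u - N v) \<union> (N v - N u)"
  have NX: "N w \<subseteq> nsets {..<n} m" for w by (auto simp: N_def m_def nbhd_def)
  have finN: "finite (N w)" for w
    by (rule finite_subset [OF NX]) (simp add: finite_imp_finite_nsets)
  have finX: "finite X" using finN by (simp add: X_def)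
  have cardX: "card X = set_dist (N u) (N v)"
    unfolding X_def set_dist_def using finN by (intro card_Un_disjoint) auto
  define L where "L = {j. j < n ^ m \<and> digits n m j \<in> X}"
  have finL: "finite L" by (simp add: L_def)
  have L: "tensor_dist k n E u v = card L"
  proof -
    have "adjacency k n E (u + n * j) \<noteq> adjacency k n E (v + n * j) \<longleftrightarrow> digits n m j \<in> X"
      if "j < n ^ m" for j
    proof -
      have j: "j < n ^ (k - 1)" using that by (simp add: m_def)
      show ?thesis
        unfolding adjacency_eq [OF assms(2,3) j] adjacency_eq [OF assms(2,4) j]
          digits_mem_nbhd [OF assms(1-3) j] digits_mem_nbhd [OF assms(1,2,4) j]
        by (auto simp: X_def N_def m_def)
    qed
    then show ?thesis unfolding tensor_dist_def L_def m_def by meson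
  qed
  have S: "finite S \<and> card S = m \<and> S \<subseteq> {..<n}" if "S \<in> X" for S
  proof -
    have "S \<in> nsets {..<n} m" using that NX [of u] NX [of v] by (auto simp: X_def)
    then show ?thesis by (simp add: nsets_def)
  qed
  have "X \<subseteq> digits n m ` L"
  proof
    fix S assume SX: "S \<in> X"
    then obtain f where f: "bij_betw f {..<m} S"
      using S [OF SX] by (metis card_lessThan finite_lessThan finite_same_card_bij)
    then have fS: "f ` {..<m} = S" by (simp add: bij_betw_def)
    let ?x = "restrict f {..<m}"
    have "f i < n" if "i < m" for i using fS S [OF SX] that by auto
    then have x: "?x \<in> Pi\<^sub>E {..<m} (\<lambda>_. {..<n})" by (simp add: restrict_PiE_iff)
    have "0 < n" using assms(3) by simp
    from digit_tuple_surj [OF this x] obtain j where j: "j < n ^ m" "digit_tuple n m j = ?x" by auto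
    have "digits n m j = S"
      unfolding digit_tuple_image [symmetric] j(2) using fS by simp
    then show "S \<in> digits n m ` L" using SX j(1) by (auto simp: L_def)
  qed
  then have "card X \<le> card L" using finL by (rule surj_card_le [rotated])
  then show "set_dist (nbhd k {..<n} E u) (nbhd k {..<n} E v) \<le> tensor_dist k n E u v"
    by (simp add: L cardX N_def)
  have fibre: "card {j. j < n ^ m \<and> digits n m j = S} \<le> m ^ m" if "S \<in> X" for S
  proof -
    have "card {j. j < n ^ m \<and> digits n m j = S} \<le> card (Pi\<^sub>E {..<m} (\<lambda>_. S))"
    proof (rule card_inj_on_le)
      show "inj_on (digit_tuple n m) {j. j < n ^ m \<and> digits n m j = S}"
        by (rule inj_on_subset [OF inj_on_digit_tuple]) auto
      show "digit_tuple n m ` {j. j < n ^ m \<and> digits n m j = S} \<subseteq> Pi\<^sub>E {..<m} (\<lambda>_. S)"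
        by (auto simp: image_subset_iff digit_tuple_def digits_def restrict_PiE_iff)
      show "finite (Pi\<^sub>E {..<m} (\<lambda>_. S))" using S [OF that] by (intro finite_PiE) auto
    qed
    then show ?thesis using S [OF that] by (simp add: card_PiE)
  qed
  have "L = (\<Union>S\<in>X. {j. j < n ^ m \<and> digits n m j = S})" by (auto simp: L_def)
  then have "card L \<le> (\<Sum>S\<in>X. card {j. j < n ^ m \<and> digits n m j = S})"
    using card_UN_le [OF finX] by simp
  also have "\<dots> \<le> (\<Sum>S\<in>X. m ^ m)" by (intro sum_mono fibre)
  finally show "tensor_dist k n E u v \<le>
      (k - 1) ^ (k - 1) * set_dist (nbhd k {..<n} E u) (nbhd k {..<n} E v)"
    by (simp add: L cardX N_def m_def mult.commute)
qed

lemma tensor_dist_self: "tensor_dist k n E u u = 0"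
  by (simp add: tensor_dist_def)

section \<open>Greedy clustering\<close>

lemma set_dist_triangle:
  assumes "finite A" "finite B" "finite C"
  shows "set_dist A C \<le> set_dist A B + set_dist B C"
proof -
  have 1: "card (A - C) \<le> card (A - B) + card (B - C)"
    if "finite A" "finite B" for A B C :: "'a set"
  proof -
    have "card (A - C) \<le> card ((A - B) \<union> (B - C))" by (intro card_mono) (use that in auto)
    also have "\<dots> \<le> card (A - B) + card (B - C)" by (rule card_Un_le)
    finally show ?thesis .
  qed
  show ?thesis using 1 [OF assms(1,2), of C] 1 [OF assms(3,2), of A] by (simp add: set_dist_def)
qed

lemma set_dist_commute: "set_dist A B = set_dist B A"
  by (simp add: set_dist_def)

lemma finite_nbhd: "finite V \<Longrightarrow> finite (nbhd k V E v)"
  by (simp add: nbhd_def finite_imp_finite_nsets)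

lemma vc_le_nbhd:
  assumes "finite V" "has_dual_vc_dim k V E d"
  shows "vc_le (nsets V (k - 1)) (nbhd k V E ` V) d"
  unfolding vc_le_def
proof (intro allI impI)
  fix S assume S: "S \<subseteq> nsets V (k - 1)" "shatters (nbhd k V E ` V) S"
  have "finite S" by (rule finite_subset [OF S(1)]) (simp add: assms(1) finite_imp_finite_nsets)
  then have "S \<in> nsets (nsets V (k - 1)) (card S)" using S(1) by (simp add: nsets_def)
  then show "card S \<le> d" using assms(2) S(2) by (auto simp: has_dual_vc_dim_def has_vc_dim_def)
qed

lemma dual_vc_dim_nonempty:
  assumes "has_dual_vc_dim k V E d"
  shows "V \<noteq> {}"
  using assms by (auto simp: has_dual_vc_dim_def has_vc_dim_def shatters_def)

lemma binomial_le_power: "n choose r \<le> n ^ r"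
  by (cases "r \<le> n") (simp_all add: binomial_le_pow binomial_eq_0)

text \<open>Separation is measured against \<open>card V ^ (k - 1)\<close>, the length of a tensor
  slice, which dominates the size of the ground set in \<open>haussler_packing\<close>. That lemma
  counts neighbourhoods; distinct centres have distinct ones because their distance is
  positive.\<close>

lemma separated_vertices_bound:
  assumes "finite V" "has_dual_vc_dim k V E d" "0 < q" "C \<subseteq> V"
    and sep: "\<And>u v. u \<in> C \<Longrightarrow> v \<in> C \<Longrightarrow> u \<noteq> v \<Longrightarrow>
      card V ^ (k - 1) \<le> q * set_dist (nbhd k V E u) (nbhd k V E v)"
  shows "card C \<le> 2 * (4 * (d + 1) * q) ^ d"
proof -
  let ?X = "nsets V (k - 1)" and ?N = "nbhd k V E"
  have X: "finite ?X" by (simp add: assms(1) finite_imp_finite_nsets)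
  have pos: "0 < card V ^ (k - 1)"
    using dual_vc_dim_nonempty [OF assms(2)] assms(1) by (simp add: card_gt_0_iff)
  have inj: "inj_on ?N C"
  proof (rule inj_onI, rule ccontr)
    fix u v assume uv: "u \<in> C" "v \<in> C" "?N u = ?N v" "u \<noteq> v"
    have "set_dist (?N u) (?N v) = 0" unfolding uv(3) by (simp add: set_dist_def)
    then show False using sep [OF uv(1,2,4)] pos by simp
  qed
  have "card (?N ` C) \<le> 2 * (4 * (d + 1) * q) ^ d"
  proof (rule haussler_packing [OF X])
    show "?N ` C \<subseteq> Pow ?X" by (auto simp: nbhd_def)
    have "?N ` C \<subseteq> ?N ` V" using assms(4) by (rule image_mono)
    then show "vc_le ?X (?N ` C) d"
      using vc_le_nbhd [OF assms(1,2)] shatters_mono [of "?N ` C" _ "?N ` V"] by (simp add: vc_le_def)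
    fix A B assume "A \<in> ?N ` C" "B \<in> ?N ` C" "A \<noteq> B"
    then obtain u v where uv: "u \<in> C" "v \<in> C" "u \<noteq> v" "A = ?N u" "B = ?N v" by auto
    have "card ?X \<le> card V ^ (k - 1)" using assms(1) by (simp add: card_nsets binomial_le_power)
    then show "card ?X \<le> q * set_dist A B" using sep [OF uv(1-3)] uv(4,5) by simp
  qed (rule assms(3))
  then show ?thesis by (simp add: card_image [OF inj])
qed

text \<open>A snapshot of the clustering: \<open>cs\<close> holds the centres so far,
  \<open>ys\<close> the vertices placed so far, \<open>\<kappa>\<close> the cluster indices. It
  demands neither that \<open>ys\<close> exhausts \<open>V\<close> nor that centres are placed, so
  it also holds halfway through a cluster. Sortedness keeps clusters contiguous.\<close>

definition cluster_order ::
  "('a \<Rightarrow> 'a \<Rightarrow> bool) \<Rightarrow> 'a set \<Rightarrow> 'a list \<Rightarrow> ('a \<Rightarrow> nat) \<Rightarrow> 'a list \<Rightarrow> bool" where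
  "cluster_order near V cs \<kappa> ys \<longleftrightarrow>
    distinct ys \<and> set ys \<subseteq> V \<and> sorted (map \<kappa> ys) \<and>
    (\<forall>v\<in>set ys. \<kappa> v < length cs \<and> near (cs ! \<kappa> v) v) \<and>
    set cs \<subseteq> V \<and> (\<forall>j<length cs. \<forall>i<j. \<not> near (cs ! i) (cs ! j))"

lemma cluster_order_new_centre:
  assumes "cluster_order near V cs \<kappa> ys" "u \<in> V" "\<And>c. c \<in> set cs \<Longrightarrow> \<not> near c u"
  shows "cluster_order near V (cs @ [u]) \<kappa> ys"
  using assms by (auto simp: cluster_order_def nth_append less_Suc_eq)

text \<open>The newest centre has the largest index, so a vertex of its cluster can go to the end of
  the list.\<close>

lemma cluster_order_append:
  assumes "cluster_order near V (cs @ [u]) \<kappa> ys" "v \<in> V" "v \<notin> set ys" "near u v"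
  shows "cluster_order near V (cs @ [u]) (\<kappa>(v := length cs)) (ys @ [v])"
proof -
  have "map (\<kappa>(v := length cs)) ys = map \<kappa> ys" using assms(3) by (intro map_cong) auto
  moreover have "\<kappa> w \<le> length cs" if "w \<in> set ys" for w
    using assms(1) that by (auto simp: cluster_order_def less_Suc_eq_le)
  ultimately show ?thesis
    using assms unfolding cluster_order_def by (auto simp: sorted_append)
qed

text \<open>Mere existence needs no incremental placement: a maximal list of pairwise far centres is
  built, every vertex chooses a near centre, and the vertices are sorted by their choice.\<close>

lemma ex_cluster_order:
  assumes "finite V" and refl: "\<And>v. near v v" and sym: "\<And>u v. near u v = near v u"
  shows "\<exists>cs \<kappa> ys. cluster_order near V cs \<kappa> ys \<and> set ys = V"
proof -
  obtain vs where vs: "set vs = V" "distinct vs" using finite_distinct_list [OF assms(1)] by auto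
  have "\<exists>cs. set cs \<subseteq> set us \<and> (\<forall>v\<in>set us. \<exists>c\<in>set cs. near c v) \<and>
      (\<forall>j<length cs. \<forall>i<j. \<not> near (cs ! i) (cs ! j))" for us
  proof (induction us)
    case (Cons u us)
    then obtain cs where cs: "set cs \<subseteq> set us" "\<forall>v\<in>set us. \<exists>c\<in>set cs. near c v"
      "\<forall>j<length cs. \<forall>i<j. \<not> near (cs ! i) (cs ! j)" by auto
    show ?case
    proof (cases "\<exists>c\<in>set cs. near c u")
      case True
      then show ?thesis using cs by (intro exI [of _ cs]) auto
    next
      case False
      then have "\<forall>j<length (cs @ [u]). \<forall>i<j. \<not> near ((cs @ [u]) ! i) ((cs @ [u]) ! j)"
        using cs(3) by (auto simp: nth_append less_Suc_eq)
      moreover have "\<forall>v\<in>set (u # us). \<exists>c\<in>set (cs @ [u]). near c v" using cs(2) refl by auto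
      ultimately show ?thesis using cs(1) by (intro exI [of _ "cs @ [u]"]) auto
    qed
  qed simp
  from this [of vs] obtain cs where cs: "set cs \<subseteq> V" "\<forall>v\<in>V. \<exists>c\<in>set cs. near c v"
    "\<forall>j<length cs. \<forall>i<j. \<not> near (cs ! i) (cs ! j)" using vs(1) by auto
  have "\<forall>v\<in>V. \<exists>i. i < length cs \<and> near (cs ! i) v"
    using cs(2) by (metis in_set_conv_nth)
  then obtain \<kappa> where \<kappa>: "\<forall>v\<in>V. \<kappa> v < length cs \<and> near (cs ! \<kappa> v) v"
    unfolding bchoice_iff by blast
  have "cluster_order near V cs \<kappa> (sort_key \<kappa> vs)"
    using vs cs \<kappa> by (simp add: cluster_order_def)
  moreover have "set (sort_key \<kappa> vs) = V" using vs(1) by simp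
  ultimately show ?thesis by (intro exI conjI)
qed

text \<open>Centres that are far in terms of \<open>D\<close> may be closer by the factor
  \<open>A\<close> in terms of \<open>set_dist\<close>, so packing is applied with
  \<open>q * A\<close> in place of \<open>q\<close>.\<close>

lemma cluster_order_length_le:
  assumes V: "finite V" and vc: "has_dual_vc_dim k V E d" and "0 < q" "0 < A"
    and D: "\<And>u v. u \<in> V \<Longrightarrow> v \<in> V \<Longrightarrow> D u v \<le> A * set_dist (nbhd k V E u) (nbhd k V E v)"
    and near: "\<And>u v. near u v \<longleftrightarrow> D u v * q < card V ^ (k - 1)"
    and order: "cluster_order near V cs \<kappa> ys"
  shows "length cs \<le> 2 * (4 * (d + 1) * (q * A)) ^ d"
proof -
  have cs: "set cs \<subseteq> V" "\<And>i j. j < length cs \<Longrightarrow> i < j \<Longrightarrow> \<not> near (cs ! i) (cs ! j)"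
    using order by (auto simp: cluster_order_def)
  have V0: "0 < card V" using dual_vc_dim_nonempty [OF vc] V by (simp add: card_gt_0_iff)
  have far: "card V ^ (k - 1) \<le> q * A * set_dist (nbhd k V E (cs ! i)) (nbhd k V E (cs ! j))"
    if "j < length cs" "i < j" for i j
  proof -
    have mem: "cs ! i \<in> V" "cs ! j \<in> V"
      using that subsetD [OF cs(1) nth_mem, of i] subsetD [OF cs(1) nth_mem, of j] by simp_all
    have "card V ^ (k - 1) \<le> D (cs ! i) (cs ! j) * q"
      using cs(2) [OF that] near by simp
    also have "\<dots> \<le> A * set_dist (nbhd k V E (cs ! i)) (nbhd k V E (cs ! j)) * q"
      by (intro mult_right_mono D mem) simp
    finally show ?thesis by (simp add: mult.commute mult.left_commute)
  qed
  have far': "card V ^ (k - 1) \<le> q * A * set_dist (nbhd k V E (cs ! i)) (nbhd k V E (cs ! j))"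
    if "i < length cs" "j < length cs" "i \<noteq> j" for i j
  proof (cases "i < j")
    case False
    then show ?thesis using far [of i j] that(1,3) by (subst set_dist_commute) (simp add: far)
  qed (use far that in simp)
  \<comment> \<open>Packing bounds a set of vertices, so the list must be free of repetitions; a
    repeated centre would be at distance 0 from itself.\<close>
  have "distinct cs" unfolding distinct_conv_nth
  proof (intro allI impI)
    fix i j assume ij: "i < length cs" "j < length cs" "i \<noteq> j"
    show "cs ! i \<noteq> cs ! j"
    proof
      assume "cs ! i = cs ! j"
      then have "set_dist (nbhd k V E (cs ! i)) (nbhd k V E (cs ! j)) = 0" by (simp add: set_dist_def)
      then show False using far' [OF ij] V0 by simp
    qed
  qed
  then have "length cs = card (set cs)" by (simp add: distinct_card)
  also have "\<dots> \<le> 2 * (4 * (d + 1) * (q * A)) ^ d"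
  proof (rule separated_vertices_bound [OF V vc _ cs(1)])
    show "0 < q * A" using \<open>0 < q\<close> \<open>0 < A\<close> by simp
    fix u v assume "u \<in> set cs" "v \<in> set cs" "u \<noteq> v"
    then obtain i j where "i < length cs" "j < length cs" "i \<noteq> j" "u = cs ! i" "v = cs ! j"
      by (metis in_set_conv_nth)
    then show "card V ^ (k - 1) \<le> q * A * set_dist (nbhd k V E u) (nbhd k V E v)"
      using far' by simp
  qed
  finally show ?thesis .
qed

text \<open>
  The distance \<open>D\<close> may overcount by a factor \<open>A\<close>, as the tensor distance does: a \<open>(k - 1)\<close>-set
  occurs there once per ordering.
\<close>
lemma regular_of_cluster_order:
  fixes \<epsilon> :: real
  assumes H: "uniform_hypergraph k V E" and vc: "has_dual_vc_dim k V E d"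
    and "0 < k" and \<epsilon>: "0 < \<epsilon>" "\<epsilon> < 1 / 4"
    and D: "\<And>u v. u \<in> V \<Longrightarrow> v \<in> V \<Longrightarrow> set_dist (nbhd k V E u) (nbhd k V E v) \<le> D u v"
      "\<And>u v. u \<in> V \<Longrightarrow> v \<in> V \<Longrightarrow> D u v \<le> A * set_dist (nbhd k V E u) (nbhd k V E v)"
    and "0 < A"
    and near: "\<And>u v. near u v \<longleftrightarrow> D u v * q < card V ^ (k - 1)"
    and order: "cluster_order near V cs \<kappa> ys" "set ys = V"
    and q: "2 ^ (3 * k + 3) * real k ^ k \<le> \<epsilon>\<^sup>2 * real q"
    and K: "K \<le> card V" "2 * real k * real (2 * (4 * (d + 1) * (q * A)) ^ d) \<le> \<epsilon> * real K"
  shows "equitable_partition V K (\<lambda>i. (!) ys ` slice (card V) K i)"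
    and "\<forall>i<K. (!) ys ` slice (card V) K i \<noteq> {}"
    and "real (card {I \<in> nsets {..<K} k. \<not> homogeneous \<epsilon> E (\<lambda>i. (!) ys ` slice (card V) K i) I}) \<le>
      \<epsilon> * real (K choose k)"
proof -
  have V: "finite V" using H by (simp add: uniform_hypergraph_def)
  have ys: "distinct ys" "sorted (map \<kappa> ys)"
    and \<kappa>: "\<And>v. v \<in> V \<Longrightarrow> \<kappa> v < length cs \<and> near (cs ! \<kappa> v) v"
    and cs: "set cs \<subseteq> V"
    using order by (auto simp: cluster_order_def)
  have len: "length ys = card V" using ys(1) order(2) distinct_card by force
  have V0: "0 < card V" using dual_vc_dim_nonempty [OF vc] V by (simp add: card_gt_0_iff)
  have q0: "0 < q"
  proof (rule ccontr)
    assume "\<not> 0 < q"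
    then have "2 ^ (3 * k + 3) * real k ^ k \<le> 0" using q by simp
    moreover have "0 < 2 ^ (3 * k + 3) * real k ^ k" using \<open>0 < k\<close> by simp
    ultimately show False by linarith
  qed
  have M: "length cs \<le> 2 * (4 * (d + 1) * (q * A)) ^ d"
    by (rule cluster_order_length_le [OF V vc q0 \<open>0 < A\<close> D(2) near order(1)])
  have mem: "ys ! r \<in> V" if "r < card V" for r using that len order(2) nth_mem [of r ys] by simp
  have bij: "bij_betw ((!) ys) {..<card V} V"
    by (rule bij_betw_nth) (use ys len order in auto)
  \<comment> \<open>Small diameters rest on the lower estimate for \<open>D\<close>, whereas the
    number of centres rests on the upper one.\<close>
  have half: "set_dist (nbhd k V E (cs ! \<kappa> v)) (nbhd k V E v) * q < card V ^ (k - 1)" if "v \<in> V" for v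
  proof -
    have "cs ! \<kappa> v \<in> V" using \<kappa> [OF that] subsetD [OF cs nth_mem, of "\<kappa> v"] by simp
    then have "set_dist (nbhd k V E (cs ! \<kappa> v)) (nbhd k V E v) * q \<le> D (cs ! \<kappa> v) v * q"
      using D(1) that by (intro mult_right_mono) auto
    then show ?thesis using \<kappa> [OF that] near by (meson le_less_trans)
  qed
  \<comment> \<open>Two vertices of a cluster are compared through their common centre, which
    doubles the radius.\<close>
  have close: "set_dist (nbhd k V E (ys ! r)) (nbhd k V E (ys ! r')) * q \<le> 2 * card V ^ (k - 1)"
    if r: "r < card V" "r' < card V" "\<kappa> (ys ! r) = \<kappa> (ys ! r')" for r r'
  proof -
    let ?c = "nbhd k V E (cs ! \<kappa> (ys ! r))"
    have "set_dist (nbhd k V E (ys ! r)) (nbhd k V E (ys ! r')) * q \<le>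
        (set_dist (nbhd k V E (ys ! r)) ?c + set_dist ?c (nbhd k V E (ys ! r'))) * q"
      by (intro mult_right_mono set_dist_triangle finite_nbhd V) simp
    also have "\<dots> = set_dist ?c (nbhd k V E (ys ! r)) * q + set_dist ?c (nbhd k V E (ys ! r')) * q"
      by (simp add: distrib_right set_dist_commute)
    also have "\<dots> \<le> 2 * card V ^ (k - 1)"
      using half [OF mem [OF r(1)]] half [OF mem [OF r(2)]] r(3) by simp
    finally show ?thesis .
  qed
  have mono: "\<kappa> (ys ! r) \<le> \<kappa> (ys ! r')" if "r \<le> r'" "r' < card V" for r r'
    using sorted_nth_mono [OF ys(2), of r r'] that len by simp
  have less: "\<kappa> (ys ! r) < 2 * (4 * (d + 1) * (q * A)) ^ d" if "r < card V" for r
    using \<kappa> [OF mem [OF that]] M by simp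
  note reg = regular_of_ordering [where \<kappa> = "\<lambda>r. \<kappa> (ys ! r)",
      OF H \<open>0 < k\<close> \<epsilon> bij mono less close K(1) V0 K(2) q]
  show "equitable_partition V K (\<lambda>i. (!) ys ` slice (card V) K i)" by (rule reg(1))
  show "\<forall>i<K. (!) ys ` slice (card V) K i \<noteq> {}" by (rule reg(2))
  show "real (card {I \<in> nsets {..<K} k. \<not> homogeneous \<epsilon> E (\<lambda>i. (!) ys ` slice (card V) K i) I}) \<le>
      \<epsilon> * real (K choose k)" by (rule reg(3))
qed

section \<open>The algorithm\<close>

text \<open>
  Assertions see the elapsed time, so that a loop invariant can charge an expensive round to the
  cluster centre that it creates.
\<close>
definition wp :: "nat \<Rightarrow> prog \<Rightarrow> (nat \<Rightarrow> ram \<Rightarrow> bool) \<Rightarrow> nat \<Rightarrow> ram \<Rightarrow> bool" where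
  "wp W p Q T s \<longleftrightarrow> (\<exists>t s'. run W p s t s' \<and> Q (T + t) s')"

lemma wpE:
  assumes "wp W p Q T s"
  obtains t s' where "run W p s t s'" "Q (T + t) s'"
  using assms unfolding wp_def by blast

lemma wp_Skip: "Q (T + 1) s \<Longrightarrow> wp W Skip Q T s"
  unfolding wp_def using run.Skip by blast

lemma wp_Assign:
  "fits W s e \<Longrightarrow> Q (T + (cost e + 1)) ((fst s)(r := val s e), snd s) \<Longrightarrow> wp W (Assign r e) Q T s"
  unfolding wp_def using run.Assign by blast

lemma wp_Store:
  "fits W s e1 \<Longrightarrow> fits W s e2 \<Longrightarrow>
    Q (T + (cost e1 + cost e2 + 1)) (fst s, (snd s)(a := (snd s a)(val s e1 := val s e2))) \<Longrightarrow>
    wp W (Store a e1 e2) Q T s"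
  unfolding wp_def using run.Store by blast

lemma wp_Seq:
  assumes "wp W p (wp W q Q) T s"
  shows "wp W (Seq p q) Q T s"
proof -
  obtain t s' where 1: "run W p s t s'" "wp W q Q (T + t) s'" using assms by (rule wpE)
  obtain t' s'' where 2: "run W q s' t' s''" "Q (T + t + t') s''" using 1(2) by (rule wpE)
  have "run W (Seq p q) s (t + t') s''" using 1(1) 2(1) by (rule run.Seq)
  then show ?thesis using 2(2) unfolding wp_def by (intro exI conjI) (auto simp: add.assoc)
qed

lemma wp_Cond:
  assumes "fits W s e"
    and "val s e \<noteq> 0 \<Longrightarrow> wp W p Q (T + (cost e + 1)) s"
    and "val s e = 0 \<Longrightarrow> wp W q Q (T + (cost e + 1)) s"
  shows "wp W (Cond e p q) Q T s"
proof (cases "val s e = 0")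
  case True
  obtain t s' where 1: "run W q s t s'" "Q (T + (cost e + 1) + t) s'"
    using assms(3) [OF True] by (rule wpE)
  have "run W (Cond e p q) s (cost e + 1 + t) s'" using assms(1) True 1(1) by (rule run.CondF)
  then show ?thesis using 1(2) unfolding wp_def by (intro exI conjI) (auto simp: add.assoc)
next
  case False
  obtain t s' where 1: "run W p s t s'" "Q (T + (cost e + 1) + t) s'"
    using assms(2) [OF False] by (rule wpE)
  have "run W (Cond e p q) s (cost e + 1 + t) s'" using assms(1) False 1(1) by (rule run.CondT)
  then show ?thesis using 1(2) unfolding wp_def by (intro exI conjI) (auto simp: add.assoc)
qed

text \<open>Indexing the invariant by the number of completed rounds, with \<open>N\<close> known in
  advance, gives termination by induction on \<open>N - i\<close> and lets the invariant bound the
  time as a function of the round.\<close>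

lemma wp_Loop:
  assumes init: "Inv 0 T s"
    and guard: "\<And>i T s. Inv i T s \<Longrightarrow> i \<le> N \<and> fits W s e \<and> (val s e \<noteq> 0 \<longleftrightarrow> i < N)"
    and body: "\<And>i T s. Inv i T s \<Longrightarrow> i < N \<Longrightarrow> wp W p (Inv (Suc i)) (T + (cost e + 1)) s"
    and post: "\<And>T s. Inv N T s \<Longrightarrow> Q (T + (cost e + 1)) s"
  shows "wp W (Loop e p) Q T s"
proof -
  have "wp W (Loop e p) Q T s" if "Inv i T s" "n = N - i" for n i T s
    using that
  proof (induction n arbitrary: i T s)
    case 0
    then have "i = N" "fits W s e" "val s e = 0" using guard [OF 0(1)] by auto
    then have "run W (Loop e p) s (cost e + 1) s" by (intro run.LoopF)
    then show ?case using post 0(1) \<open>i = N\<close> unfolding wp_def by blast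
  next
    case (Suc n)
    then have g: "i < N" "fits W s e" "val s e \<noteq> 0" using guard [OF Suc(2)] by auto
    obtain t s' where 1: "run W p s t s'" "Inv (Suc i) (T + (cost e + 1) + t) s'"
      using body [OF Suc(2) g(1)] by (rule wpE)
    have "n = N - Suc i" using Suc(3) g(1) by simp
    from Suc.IH [OF 1(2) this] obtain t' s'' where
      2: "run W (Loop e p) s' t' s''" "Q (T + (cost e + 1) + t + t') s''" by (rule wpE)
    have "run W (Loop e p) s (cost e + 1 + t + t') s''"
      using g(2,3) 1(1) 2(1) by (rule run.LoopT)
    then show ?case using 2(2) unfolding wp_def by (intro exI conjI) (auto simp: add.assoc)
  qed
  then show ?thesis using init by blast
qed

text \<open>The machine has no power operation. For a fixed exponent a product of copies of register
  0 has constant cost.\<close>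

fun pow_expr :: "nat \<Rightarrow> expr" where
  "pow_expr 0 = Lit 1"
| "pow_expr (Suc m) = Bin Times (pow_expr m) (Reg 0)"

lemma val_pow_expr: "val s (pow_expr m) = fst s 0 ^ m"
  by (induction m) (simp_all add: mult.commute)

lemma cost_pow_expr: "cost (pow_expr m) = 2 * m + 1"
  by (induction m) simp_all

lemma fits_pow_expr: "0 < fst s 0 \<Longrightarrow> fst s 0 ^ m \<le> W \<Longrightarrow> fst s 0 \<le> W \<Longrightarrow> fits W s (pow_expr m)"
proof (induction m)
  case (Suc m)
  have "fst s 0 ^ m \<le> fst s 0 ^ Suc m" using Suc.prems(1) by (intro power_increasing) auto
  then have "fst s 0 ^ m \<le> W" using Suc.prems(2) by (rule le_trans)
  then show ?case using Suc by (simp add: val_pow_expr mult.commute)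
qed simp

text \<open>Registers: 0 holds \<open>n\<close>, 1 the centre \<open>u\<close>, 2 the vertex \<open>v\<close>, 3 the tensor index, 4 the
  distance, 5 the number of vertices placed. Array 2 flags the placed vertices.\<close>

definition dist_prog :: "nat \<Rightarrow> prog" where
  "dist_prog m =
    (let a = Arr 0 (Bin Plus (Reg 1) (Bin Times (Reg 0) (Reg 3)));
         b = Arr 0 (Bin Plus (Reg 2) (Bin Times (Reg 0) (Reg 3)))
     in Seq (Assign 3 (Lit 0)) (Seq (Assign 4 (Lit 0))
        (Loop (Bin Minus (pow_expr m) (Reg 3))
          (Seq (Assign 4 (Bin Plus (Reg 4) (Bin Plus (Bin Minus a b) (Bin Minus b a))))
               (Assign 3 (Bin Plus (Reg 3) (Lit 1)))))))"

text \<open>Subtraction truncates at 0, so a guard of the form \<open>a - b\<close> tests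
  \<open>b < a\<close>. Here it is the nearness test, with the denominator \<open>q\<close>
  cleared.\<close>

definition place_prog :: "nat \<Rightarrow> nat \<Rightarrow> nat \<Rightarrow> prog" where
  "place_prog m q K =
    Cond (Bin Minus (pow_expr m) (Bin Times (Reg 4) (Lit q)))
      (Seq (Store 2 (Reg 2) (Lit 1))
      (Seq (Store 1 (Reg 2) (Bin Div (Bin Times (Reg 5) (Lit K)) (Reg 0)))
           (Assign 5 (Bin Plus (Reg 5) (Lit 1)))))
      Skip"

definition cluster_prog :: "nat \<Rightarrow> nat \<Rightarrow> nat \<Rightarrow> prog" where
  "cluster_prog m q K =
    Seq (Assign 2 (Lit 0))
      (Loop (Bin Minus (Reg 0) (Reg 2))
        (Seq (Cond (Arr 2 (Reg 2)) Skip (Seq (dist_prog m) (place_prog m q K)))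
             (Assign 2 (Bin Plus (Reg 2) (Lit 1)))))"

definition greedy_prog :: "nat \<Rightarrow> nat \<Rightarrow> nat \<Rightarrow> prog" where
  "greedy_prog m q K =
    Seq (Assign 1 (Lit 0))
      (Loop (Bin Minus (Reg 0) (Reg 1))
        (Seq (Cond (Arr 2 (Reg 1)) Skip (cluster_prog m q K))
             (Assign 1 (Bin Plus (Reg 1) (Lit 1)))))"

text \<open>By truncated subtraction the last assignment puts the maximum of \<open>n\<close> and
  \<open>K0\<close> into register 0.\<close>

definition singleton_prog :: "nat \<Rightarrow> prog" where
  "singleton_prog K0 =
    Seq (Assign 2 (Lit 0))
   (Seq (Loop (Bin Minus (Reg 0) (Reg 2))
          (Seq (Store 1 (Reg 2) (Reg 2)) (Assign 2 (Bin Plus (Reg 2) (Lit 1)))))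
        (Assign 0 (Bin Plus (Reg 0) (Bin Minus (Lit K0) (Reg 0)))))"

text \<open>The numbers \<open>q\<close>, \<open>K\<close> and \<open>K0\<close> derive from the
  real \<open>\<epsilon>\<close>, which is not part of the input. They are literals, so each
  \<open>\<epsilon>\<close> has its own program.\<close>

definition partition_prog :: "nat \<Rightarrow> nat \<Rightarrow> nat \<Rightarrow> nat \<Rightarrow> prog" where
  "partition_prog m q K K0 =
    Cond (Bin Minus (Lit K) (Reg 0)) (singleton_prog K0)
      (Seq (greedy_prog m q K) (Assign 0 (Lit K)))"

section \<open>Correctness, word size and running time of the programs\<close>

lemma wp_dist_prog:
  assumes s: "fst s 0 = n" "snd s 0 = adjacency k n E" "fst s 1 = u" "fst s 2 = v"
    and "u < n" "v < n" "0 < k" and W: "n ^ k \<le> W"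
    and Q: "\<And>T' s'. T' \<le> T + (4 * (k - 1) + 46) * n ^ (k - 1) \<Longrightarrow> snd s' = snd s \<Longrightarrow>
      fst s' 4 = tensor_dist k n E u v \<Longrightarrow> (\<And>r. r \<notin> {3, 4} \<Longrightarrow> fst s' r = fst s r) \<Longrightarrow> Q T' s'"
  shows "wp W (dist_prog (k - 1)) Q T s"
proof -
  define m where "m = k - 1"
  have n0: "0 < n" using assms by simp
  have nk: "n ^ k = n * n ^ m" using \<open>0 < k\<close> by (cases k) (simp_all add: m_def)
  have "n ^ m \<le> n ^ k" "n \<le> n ^ k" "0 < n ^ m" using n0 by (simp_all add: nk)
  then have W': "n ^ m \<le> W" "n \<le> W" "1 \<le> W" using W n0 by simp_all
  let ?P = "\<lambda>j. adjacency k n E (u + n * j) \<noteq> adjacency k n E (v + n * j)"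
  have count: "card {j. j < Suc i \<and> ?P j} = card {j. j < i \<and> ?P j} + of_bool (?P i)" for i
  proof -
    have "{j. j < Suc i \<and> ?P j} = (if ?P i then insert i {j. j < i \<and> ?P j} else {j. j < i \<and> ?P j})"
      by (auto simp: less_Suc_eq)
    then show ?thesis by simp
  qed
  have count_le: "card {j. j < i \<and> ?P j} \<le> i" for i
    using card_mono [of "{..<i}" "{j. j < i \<and> ?P j}"] by auto
  have adj: "adjacency k n E j = 0 \<or> adjacency k n E j = 1" for j by (simp add: adjacency_def)
  \<comment> \<open>A round costs \<open>2 * m + 4\<close> for the guard, 30 for the accumulation
    and 4 for the increment; the two initial assignments cost 4.\<close>
  define Inv where "Inv i T' s' \<longleftrightarrow> i \<le> n ^ m \<and> T' \<le> T + 4 + i * (2 * m + 38) \<and> snd s' = snd s \<and>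
      fst s' 3 = i \<and> fst s' 4 = card {j. j < i \<and> ?P j} \<and> (\<forall>r. r \<notin> {3, 4} \<longrightarrow> fst s' r = fst s r)"
    for i T' and s' :: ram
  have "wp W (dist_prog m) Q T s"
    unfolding dist_prog_def Let_def
  proof (intro wp_Seq wp_Assign wp_Loop [where N = "n ^ m" and Inv = Inv])
    fix i T' s' assume I: "Inv i T' s'"
    then show "i \<le> n ^ m \<and> fits W s' (Bin Minus (pow_expr m) (Reg 3)) \<and>
        (val s' (Bin Minus (pow_expr m) (Reg 3)) \<noteq> 0 \<longleftrightarrow> i < n ^ m)"
      using W' n0 s by (auto simp: Inv_def val_pow_expr intro!: fits_pow_expr)
    assume i: "i < n ^ m"
    have regs: "fst s' 0 = n" "fst s' 1 = u" "fst s' 2 = v" "fst s' 3 = i"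
      "fst s' 4 = card {j. j < i \<and> ?P j}" "snd s' 0 = adjacency k n E"
      using I s by (auto simp: Inv_def)
    have idx: "u + n * i < n ^ k" "v + n * i < n ^ k"
      using tensor_index_less [OF \<open>0 < k\<close>] assms(5,6) i by (simp_all add: m_def)
    let ?e = "Bin Plus (Reg 4)
      (Bin Plus (Bin Minus (Arr 0 (Bin Plus (Reg 1) (Bin Times (Reg 0) (Reg 3))))
                           (Arr 0 (Bin Plus (Reg 2) (Bin Times (Reg 0) (Reg 3)))))
                (Bin Minus (Arr 0 (Bin Plus (Reg 2) (Bin Times (Reg 0) (Reg 3))))
                           (Arr 0 (Bin Plus (Reg 1) (Bin Times (Reg 0) (Reg 3))))))"
    \<comment> \<open>The entries are 0 or 1 and subtraction truncates, so the two differences add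
      up to 1 exactly where the entries disagree.\<close>
    have val: "val s' ?e = card {j. j < Suc i \<and> ?P j}"
      unfolding count using regs adj [of "u + n * i"] adj [of "v + n * i"] by auto
    have "n * i \<le> n ^ k" using idx by simp
    then show "fits W s' ?e"
      using regs W W' idx i count_le [of i] val count_le [of "Suc i"]
        adj [of "u + n * i"] adj [of "v + n * i"] assms(5,6) by auto
    let ?s1 = "((fst s')(4 := val s' ?e), snd s')"
    show "fits W ?s1 (Bin Plus (Reg 3) (Lit 1))" using regs i W' by simp
    show "Inv (Suc i) (T' + (cost (Bin Minus (pow_expr m) (Reg 3)) + 1) + (cost ?e + 1) +
        (cost (Bin Plus (Reg 3) (Lit 1)) + 1)) ((fst ?s1)(3 := val ?s1 (Bin Plus (Reg 3) (Lit 1))), snd ?s1)"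
      using I i regs val by (simp add: Inv_def cost_pow_expr)
  next
    fix T' s' assume I: "Inv (n ^ m) T' s'"
    show "Q (T' + (cost (Bin Minus (pow_expr m) (Reg 3)) + 1)) s'"
    proof (rule Q)
      have "T' + (2 * m + 4) \<le> T + (2 * m + 8) + n ^ m * (2 * m + 38)" using I by (simp add: Inv_def)
      also have "\<dots> \<le> T + (2 * m + 8) * n ^ m + n ^ m * (2 * m + 38)"
      proof -
        have "1 \<le> n ^ m" using \<open>0 < n ^ m\<close> by linarith
        then have "(2 * m + 8) * 1 \<le> (2 * m + 8) * n ^ m" by (rule mult_le_mono2)
        then show ?thesis unfolding mult_1_right by (intro add_right_mono add_left_mono)
      qed
      finally show "T' + (cost (Bin Minus (pow_expr m) (Reg 3)) + 1) \<le>
          T + (4 * (k - 1) + 46) * n ^ (k - 1)"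
        by (simp add: cost_pow_expr m_def algebra_simps)
    qed (use I in \<open>auto simp: Inv_def tensor_dist_def m_def\<close>)
  next
    show "Inv 0 (T + (cost (Lit 0) + 1) + (cost (Lit 0) + 1))
        ((fst ((fst s)(3 := val s (Lit 0)), snd s))(4 := val ((fst s)(3 := val s (Lit 0)), snd s) (Lit 0)),
          snd ((fst s)(3 := val s (Lit 0)), snd s))"
      by (auto simp: Inv_def)
  qed simp_all
  then show ?thesis by (simp add: m_def)
qed

definition tensor_near :: "nat \<Rightarrow> nat \<Rightarrow> nat set set \<Rightarrow> nat \<Rightarrow> nat \<Rightarrow> nat \<Rightarrow> bool" where
  "tensor_near k n E q u v \<longleftrightarrow> tensor_dist k n E u v * q < n ^ (k - 1)"

text \<open>The list \<open>ys\<close> is not stored by the machine; arrays 1 and 2 and register 5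
  are its only traces. A part index depends on the position alone, so it stays valid when later
  vertices are placed.\<close>

definition placed :: "nat \<Rightarrow> nat \<Rightarrow> nat set set \<Rightarrow> nat \<Rightarrow> nat list \<Rightarrow> ram \<Rightarrow> bool" where
  "placed k n E K ys s \<longleftrightarrow> fst s 0 = n \<and> snd s 0 = adjacency k n E \<and> fst s 5 = length ys \<and>
    (\<forall>w<n. snd s 2 w = of_bool (w \<in> set ys)) \<and> (\<forall>r<length ys. snd s 1 (ys ! r) = r * K div n)"

lemma placed_upd:
  assumes "placed k n E K ys s" "r \<noteq> 0" "r \<noteq> 5"
  shows "placed k n E K ys ((fst s)(r := x), snd s)"
  using assms by (simp add: placed_def)

lemma cluster_order_length_less:
  assumes "cluster_order near {..<n} cs \<kappa> ys" "v < n" "v \<notin> set ys"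
  shows "length ys < n"
proof -
  have "set ys \<subset> {..<n}" "distinct ys" using assms by (auto simp: cluster_order_def)
  then show ?thesis using psubset_card_mono [of "{..<n}" "set ys"] by (simp add: distinct_card)
qed

lemma tensor_dist_le: "tensor_dist k n E u v \<le> n ^ (k - 1)"
  unfolding tensor_dist_def
  using card_mono [of "{..<n ^ (k - 1)}" "{j. j < n ^ (k - 1) \<and>
    adjacency k n E (u + n * j) \<noteq> adjacency k n E (v + n * j)}"] by auto

text \<open>The two continuations correspond to the outcomes of the nearness test. The word bounds
  cover the products formed on the way: \<open>q\<close> times a distance and \<open>K\<close> times
  a position.\<close>

lemma wp_place_prog:
  assumes placed: "placed k n E K ys s" and v: "fst s 2 = v" "v < n" "v \<notin> set ys"
    and dist: "fst s 4 = tensor_dist k n E u v" and len: "length ys < n"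
    and W: "n ^ (k - 1) \<le> W" "n \<le> W" "K * n \<le> W" "K \<le> W" "q * n ^ (k - 1) \<le> W" "q \<le> W"
    and far: "\<And>T'. T' \<le> T + (2 * (k - 1) + 20) \<Longrightarrow> \<not> tensor_near k n E q u v \<Longrightarrow> Q T' s"
    and near: "\<And>T' s'. T' \<le> T + (2 * (k - 1) + 20) \<Longrightarrow> tensor_near k n E q u v \<Longrightarrow>
      placed k n E K (ys @ [v]) s' \<Longrightarrow> (\<And>r. r \<noteq> 5 \<Longrightarrow> fst s' r = fst s r) \<Longrightarrow> Q T' s'"
  shows "wp W (place_prog (k - 1) q K) Q T s"
proof -
  have n: "fst s 0 = n" "fst s 5 = length ys" using placed by (auto simp: placed_def)
  have n0: "0 < n" using v by simp
  let ?g = "Bin Minus (pow_expr (k - 1)) (Bin Times (Reg 4) (Lit q))"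
  have g: "val s ?g \<noteq> 0 \<longleftrightarrow> tensor_near k n E q u v"
    by (simp add: val_pow_expr n dist tensor_near_def) linarith
  have "q * tensor_dist k n E u v \<le> W"
    using mult_le_mono2 [OF tensor_dist_le] W(5) by (rule le_trans)
  then have "tensor_dist k n E u v * q \<le> W" by (simp only: mult.commute)
  moreover have "tensor_dist k n E u v \<le> W" using tensor_dist_le W(1) by (rule le_trans)
  ultimately have fit_g: "fits W s ?g"
    using W n n0 dist by (auto simp: val_pow_expr intro!: fits_pow_expr)
  have neq: "\<forall>r<length ys. ys ! r \<noteq> v" using v(3) nth_mem by metis
  have lenK: "length ys * K \<le> W" "length ys * K div n \<le> W"
  proof -
    have "K * length ys \<le> K * n" using len by (intro mult_le_mono2) simp
    then have "K * length ys \<le> W" using W(3) by (rule le_trans)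
    then show *: "length ys * K \<le> W" by (simp only: mult.commute)
    show "length ys * K div n \<le> W" using div_le_dividend * by (rule le_trans)
  qed
  show ?thesis
    unfolding place_prog_def
  proof (rule wp_Cond [OF fit_g])
    assume "val s ?g = 0"
    then show "wp W Skip Q (T + (cost ?g + 1)) s"
      using g by (intro wp_Skip far) (simp_all add: cost_pow_expr)
  next
    assume "val s ?g \<noteq> 0"
    then have nr: "tensor_near k n E q u v" using g by simp
    show "wp W (Seq (Store 2 (Reg 2) (Lit 1))
      (Seq (Store 1 (Reg 2) (Bin Div (Bin Times (Reg 5) (Lit K)) (Reg 0)))
           (Assign 5 (Bin Plus (Reg 5) (Lit 1))))) Q (T + (cost ?g + 1)) s"
    proof (intro wp_Seq wp_Store wp_Assign near [OF _ nr])
    qed (use placed n v neq W lenK len in \<open>auto simp: placed_def nth_append less_Suc_eq cost_pow_expr\<close>)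
  qed
qed

text \<open>One pass over all vertices serves the newest centre \<open>u\<close>. Afterwards every
  vertex near \<open>u\<close> is placed, in this cluster or an earlier one, so that an unplaced
  vertex is known to be far from \<open>u\<close>.\<close>

lemma wp_cluster_prog:
  assumes placed: "placed k n E K ys s" and u: "fst s 1 = u" "u < n" and "0 < k"
    and order: "cluster_order (tensor_near k n E q) {..<n} (cs @ [u]) \<kappa> ys"
    and W: "n ^ k \<le> W" "K * n \<le> W" "K \<le> W" "q * n ^ (k - 1) \<le> W" "q \<le> W"
    and Q: "\<And>T' s' \<kappa>' ys'. T' \<le> T + (6 * k + 83) * n ^ k \<Longrightarrow> fst s' 1 = u \<Longrightarrow>
      placed k n E K ys' s' \<Longrightarrow> cluster_order (tensor_near k n E q) {..<n} (cs @ [u]) \<kappa>' ys' \<Longrightarrow>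
      set ys \<subseteq> set ys' \<Longrightarrow> (\<And>w. w < n \<Longrightarrow> tensor_near k n E q u w \<Longrightarrow> w \<in> set ys') \<Longrightarrow> Q T' s'"
  shows "wp W (cluster_prog (k - 1) q K) Q T s"
proof -
  define N where "N = n ^ (k - 1)"
  define near where "near = tensor_near k n E q"
  have n0: "0 < n" using u by simp
  have nk: "n ^ k = n * N" using \<open>0 < k\<close> by (cases k) (simp_all add: N_def)
  have N0: "1 \<le> N" using n0 by (simp add: N_def Suc_le_eq)
  have "N \<le> n * N" "n \<le> n * N" using n0 N0 by simp_all
  then have W': "N \<le> W" "n \<le> W" "1 \<le> W" using W(1) n0 unfolding nk by linarith+
  \<comment> \<open>The labels and the list are ghost data under the existential quantifier. The
    time bound charges each vertex for a full distance computation.\<close>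
  define Inv where "Inv v T' s' \<longleftrightarrow> v \<le> n \<and> fst s' 1 = u \<and> fst s' 2 = v \<and>
      T' \<le> T + 2 + v * ((6 * k + 77) * N) \<and>
      (\<exists>\<kappa> ys'. placed k n E K ys' s' \<and> cluster_order near {..<n} (cs @ [u]) \<kappa> ys' \<and>
        set ys \<subseteq> set ys' \<and> (\<forall>w<v. near u w \<longrightarrow> w \<in> set ys'))" for v T' and s' :: ram
  let ?inc = "Assign 2 (Bin Plus (Reg 2) (Lit 1))"
  have advance: "wp W ?inc (Inv (Suc v)) T' s'"
    if "v < n" "fst s' 1 = u" "fst s' 2 = v" "T' + 4 \<le> T + 2 + Suc v * ((6 * k + 77) * N)"
      "placed k n E K ys' s'" "cluster_order near {..<n} (cs @ [u]) \<kappa>' ys'"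
      "set ys \<subseteq> set ys'" "\<forall>w<v. near u w \<longrightarrow> w \<in> set ys'" "near u v \<Longrightarrow> v \<in> set ys'" for v T' s' \<kappa>' ys'
  proof (rule wp_Assign)
    show "fits W s' (Bin Plus (Reg 2) (Lit 1))" using that W' by simp
    have "placed k n E K ys' ((fst s')(2 := Suc v), snd s')" by (rule placed_upd [OF that(5)]) simp_all
    moreover have "\<forall>w<Suc v. near u w \<longrightarrow> w \<in> set ys'" using that(8,9) by (auto simp: less_Suc_eq)
    ultimately show "Inv (Suc v) (T' + (cost (Bin Plus (Reg 2) (Lit 1)) + 1))
        ((fst s')(2 := val s' (Bin Plus (Reg 2) (Lit 1))), snd s')"
      unfolding Inv_def using that(1-4,6,7) by (intro conjI exI [of _ \<kappa>'] exI [of _ ys']) auto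
  qed
  show ?thesis
    unfolding cluster_prog_def
  proof (intro wp_Seq wp_Assign wp_Loop [where N = n and Inv = Inv])
    fix v T' s' assume I: "Inv v T' s'"
    then obtain \<kappa>' ys' where *: "placed k n E K ys' s'" "cluster_order near {..<n} (cs @ [u]) \<kappa>' ys'"
      "set ys \<subseteq> set ys'" "\<forall>w<v. near u w \<longrightarrow> w \<in> set ys'"
      and v: "v \<le> n" "fst s' 1 = u" "fst s' 2 = v" "T' \<le> T + 2 + v * ((6 * k + 77) * N)"
      unfolding Inv_def by blast
    have s': "fst s' 0 = n" "snd s' 0 = adjacency k n E" "\<And>w. w < n \<Longrightarrow> snd s' 2 w = of_bool (w \<in> set ys')"
      using *(1) by (auto simp: placed_def)
    show "v \<le> n \<and> fits W s' (Bin Minus (Reg 0) (Reg 2)) \<and>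
        (val s' (Bin Minus (Reg 0) (Reg 2)) \<noteq> 0 \<longleftrightarrow> v < n)"
      using v s' W' by auto
    assume vn: "v < n"
    let ?T = "T' + (cost (Bin Minus (Reg 0) (Reg 2)) + 1)"
    have T: "?T + (cost (Arr 2 (Reg 2)) + 1) + (4 * (k - 1) + 46) * N + (2 * (k - 1) + 20) + 4 \<le>
        T + 2 + Suc v * ((6 * k + 77) * N)"
    proof -
      \<comment> \<open>Costs that do not depend on \<open>n\<close> are absorbed by multiples of
        \<open>N\<close>, which is at least 1.\<close>
      have "(2 * (k - 1) + 31) * 1 \<le> (2 * (k - 1) + 31) * N" using N0 by (rule mult_le_mono2)
      then have "(4 * (k - 1) + 46) * N + (2 * (k - 1) + 31) \<le>
          (4 * (k - 1) + 46) * N + (2 * (k - 1) + 31) * N"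
        unfolding mult_1_right by (rule add_left_mono)
      also have "\<dots> = (4 * (k - 1) + 46 + (2 * (k - 1) + 31)) * N" by (rule distrib_right [symmetric])
      also have "\<dots> \<le> (6 * k + 77) * N" by (intro mult_right_mono) auto
      finally show ?thesis using v(4) by simp
    qed
    show "wp W (Cond (Arr 2 (Reg 2)) Skip (Seq (dist_prog (k - 1)) (place_prog (k - 1) q K)))
        (wp W ?inc (Inv (Suc v))) ?T s'"
    proof (rule wp_Cond)
      show "fits W s' (Arr 2 (Reg 2))" using v vn s' W' by simp
    next
      assume "val s' (Arr 2 (Reg 2)) \<noteq> 0"
      then have "v \<in> set ys'" using v vn s' by (simp split: if_splits)
      then show "wp W Skip (wp W ?inc (Inv (Suc v))) (?T + (cost (Arr 2 (Reg 2)) + 1)) s'"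
        by (intro wp_Skip advance [OF vn v(2,3) _ *]) (use T in simp_all)
    next
      assume "val s' (Arr 2 (Reg 2)) = 0"
      then have vys: "v \<notin> set ys'" using v vn s' by (simp split: if_splits)
      show "wp W (Seq (dist_prog (k - 1)) (place_prog (k - 1) q K)) (wp W ?inc (Inv (Suc v)))
          (?T + (cost (Arr 2 (Reg 2)) + 1)) s'"
      proof (rule wp_Seq, rule wp_dist_prog [OF s'(1,2) v(2,3) u(2) vn \<open>0 < k\<close> W(1)])
        fix T1 s1
        assume T1: "T1 \<le> ?T + (cost (Arr 2 (Reg 2)) + 1) + (4 * (k - 1) + 46) * n ^ (k - 1)"
          and s1: "snd s1 = snd s'" "fst s1 4 = tensor_dist k n E u v"
            "\<And>r. r \<notin> {3, 4} \<Longrightarrow> fst s1 r = fst s' r"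
        have placed1: "placed k n E K ys' s1" using *(1) s1 by (simp add: placed_def)
        have regs1: "fst s1 1 = u" "fst s1 2 = v" using s1(3) v by simp_all
        show "wp W (place_prog (k - 1) q K) (wp W ?inc (Inv (Suc v))) T1 s1"
        proof (rule wp_place_prog [OF placed1 regs1(2) vn vys s1(2) cluster_order_length_less [OF *(2) vn vys]])
          show "n ^ (k - 1) \<le> W" using W' by (simp add: N_def)
          fix T2 assume T2: "T2 \<le> T1 + (2 * (k - 1) + 20)" and far: "\<not> tensor_near k n E q u v"
          show "wp W ?inc (Inv (Suc v)) T2 s1"
            by (rule advance [OF vn regs1 _ placed1 *(2-4)]) (use T T1 T2 far in \<open>auto simp: near_def N_def\<close>)
        next
          fix T2 s2 assume T2: "T2 \<le> T1 + (2 * (k - 1) + 20)" and nr: "tensor_near k n E q u v"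
            and placed2: "placed k n E K (ys' @ [v]) s2" and s2: "\<And>r. r \<noteq> 5 \<Longrightarrow> fst s2 r = fst s1 r"
          have order2: "cluster_order near {..<n} (cs @ [u]) (\<kappa>'(v := length cs)) (ys' @ [v])"
            by (rule cluster_order_append [OF *(2)]) (use vn vys nr in \<open>auto simp: near_def\<close>)
          show "wp W ?inc (Inv (Suc v)) T2 s2"
            by (rule advance [OF vn _ _ _ placed2 order2]) (use T T1 T2 regs1 s2 *(3,4) in \<open>auto simp: N_def\<close>)
        qed (use W W' in auto)
      qed
    qed
  next
    fix T' s' assume I: "Inv n T' s'"
    then obtain \<kappa>' ys' where *: "placed k n E K ys' s'" "cluster_order near {..<n} (cs @ [u]) \<kappa>' ys'"
      "set ys \<subseteq> set ys'" "\<forall>w<n. near u w \<longrightarrow> w \<in> set ys'"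
      and s': "fst s' 1 = u" "T' \<le> T + 2 + n * ((6 * k + 77) * N)"
      unfolding Inv_def by blast
    show "Q (T' + (cost (Bin Minus (Reg 0) (Reg 2)) + 1)) s'"
    proof (rule Q [OF _ s'(1) *(1) _ *(3)])
      have "1 \<le> n * N" using n0 N0 by (simp add: Suc_le_eq)
      then have "n * ((6 * k + 77) * N) + 6 \<le> (6 * k + 83) * n ^ k" by (simp add: nk algebra_simps)
      then show "T' + (cost (Bin Minus (Reg 0) (Reg 2)) + 1) \<le> T + (6 * k + 83) * n ^ k" using s'(2) by simp
    qed (use * in \<open>auto simp: near_def\<close>)
  next
    have "placed k n E K ys ((fst s)(2 := 0), snd s)" by (rule placed_upd [OF placed]) simp_all
    then show "Inv 0 (T + (cost (Lit 0) + 1)) ((fst s)(2 := val s (Lit 0)), snd s)"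
      unfolding Inv_def using u order by (intro conjI exI [of _ \<kappa>] exI [of _ ys]) (auto simp: near_def)
  qed simp
qed

text \<open>A pass costs \<open>c\<close>, of order \<open>n ^ k\<close>, and is charged to the
  centre that it serves; a vertex found already placed costs 12 units. Since every vertex near an
  old centre is placed, an unplaced one is far from all centres and may become a new centre.\<close>

lemma wp_greedy_prog:
  assumes placed: "placed k n E K [] s" and "0 < n" "0 < k"
    and W: "n ^ k \<le> W" "K * n \<le> W" "K \<le> W" "q * n ^ (k - 1) \<le> W" "q \<le> W"
    and M: "\<And>cs \<kappa> ys. cluster_order (tensor_near k n E q) {..<n} cs \<kappa> ys \<Longrightarrow> length cs \<le> M"
    and Q: "\<And>T' s' cs \<kappa> ys. T' \<le> T + (18 + M * (6 * k + 83)) * n ^ k \<Longrightarrow> placed k n E K ys s' \<Longrightarrow>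
      cluster_order (tensor_near k n E q) {..<n} cs \<kappa> ys \<Longrightarrow> set ys = {..<n} \<Longrightarrow> Q T' s'"
  shows "wp W (greedy_prog (k - 1) q K) Q T s"
proof -
  define near where "near = tensor_near k n E q"
  define c where "c = (6 * k + 83) * n ^ k"
  have nk: "n \<le> n ^ k" "1 \<le> n ^ k" using \<open>0 < n\<close> \<open>0 < k\<close> by (simp_all add: self_le_power Suc_le_eq)
  have W': "n \<le> W" "1 \<le> W" using nk W(1) by linarith+
  have refl: "near v v" for v
    using \<open>0 < n\<close> by (simp add: near_def tensor_near_def tensor_dist_self)
  define Inv where "Inv u T' s' \<longleftrightarrow> u \<le> n \<and> fst s' 1 = u \<and>
      (\<exists>cs \<kappa> ys. T' \<le> T + 2 + 12 * u + length cs * c \<and> placed k n E K ys s' \<and>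
        cluster_order near {..<n} cs \<kappa> ys \<and> {..<u} \<subseteq> set ys \<and>
        (\<forall>c\<in>set cs. \<forall>w<n. near c w \<longrightarrow> w \<in> set ys))" for u T' and s' :: ram
  let ?inc = "Assign 1 (Bin Plus (Reg 1) (Lit 1))"
  have advance: "wp W ?inc (Inv (Suc u)) T' s'"
    if "u < n" "fst s' 1 = u" "T' + 4 \<le> T + 2 + 12 * Suc u + length cs * c"
      "placed k n E K ys s'" "cluster_order near {..<n} cs \<kappa> ys" "{..<u} \<subseteq> set ys" "u \<in> set ys"
      "\<forall>c\<in>set cs. \<forall>w<n. near c w \<longrightarrow> w \<in> set ys" for u T' s' cs \<kappa> ys
  proof (rule wp_Assign)
    show "fits W s' (Bin Plus (Reg 1) (Lit 1))" using that W' by simp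
    have "placed k n E K ys ((fst s')(1 := Suc u), snd s')" by (rule placed_upd [OF that(4)]) simp_all
    moreover have "{..<Suc u} \<subseteq> set ys" using that(6,7) by (auto simp: less_Suc_eq)
    ultimately show "Inv (Suc u) (T' + (cost (Bin Plus (Reg 1) (Lit 1)) + 1))
        ((fst s')(1 := val s' (Bin Plus (Reg 1) (Lit 1))), snd s')"
      unfolding Inv_def using that(1-3,5,8)
      by (intro conjI exI [of _ cs] exI [of _ \<kappa>] exI [of _ ys]) auto
  qed
  show ?thesis
    unfolding greedy_prog_def
  proof (intro wp_Seq wp_Assign wp_Loop [where N = n and Inv = Inv])
    fix u T' s' assume I: "Inv u T' s'"
    then obtain cs \<kappa> ys where *: "placed k n E K ys s'" "cluster_order near {..<n} cs \<kappa> ys"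
      "{..<u} \<subseteq> set ys" "\<forall>c\<in>set cs. \<forall>w<n. near c w \<longrightarrow> w \<in> set ys"
      and u: "u \<le> n" "fst s' 1 = u" "T' \<le> T + 2 + 12 * u + length cs * c"
      unfolding Inv_def by blast
    have s': "fst s' 0 = n" "\<And>w. w < n \<Longrightarrow> snd s' 2 w = of_bool (w \<in> set ys)"
      using *(1) by (auto simp: placed_def)
    show "u \<le> n \<and> fits W s' (Bin Minus (Reg 0) (Reg 1)) \<and>
        (val s' (Bin Minus (Reg 0) (Reg 1)) \<noteq> 0 \<longleftrightarrow> u < n)"
      using u s' W' by auto
    assume un: "u < n"
    let ?T = "T' + (cost (Bin Minus (Reg 0) (Reg 1)) + 1)"
    show "wp W (Cond (Arr 2 (Reg 1)) Skip (cluster_prog (k - 1) q K)) (wp W ?inc (Inv (Suc u))) ?T s'"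
    proof (rule wp_Cond)
      show "fits W s' (Arr 2 (Reg 1))" using u un s' W' by simp
    next
      assume "val s' (Arr 2 (Reg 1)) \<noteq> 0"
      then have uys: "u \<in> set ys" using u un s' by (simp split: if_splits)
      show "wp W Skip (wp W ?inc (Inv (Suc u))) (?T + (cost (Arr 2 (Reg 1)) + 1)) s'"
        by (intro wp_Skip advance [OF un u(2) _ *(1-3) uys *(4)]) (use u in simp)
    next
      assume "val s' (Arr 2 (Reg 1)) = 0"
      then have uys: "u \<notin> set ys" using u un s' by (simp split: if_splits)
      have order: "cluster_order (tensor_near k n E q) {..<n} (cs @ [u]) \<kappa> ys"
        using cluster_order_new_centre [OF *(2), of u] *(4) un uys by (auto simp: near_def)
      show "wp W (cluster_prog (k - 1) q K) (wp W ?inc (Inv (Suc u))) (?T + (cost (Arr 2 (Reg 1)) + 1)) s'"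
      proof (rule wp_cluster_prog [OF *(1) u(2) un \<open>0 < k\<close> order W])
        fix T1 s1 \<kappa>1 ys1
        assume T1: "T1 \<le> ?T + (cost (Arr 2 (Reg 1)) + 1) + (6 * k + 83) * n ^ k"
          and s1: "fst s1 1 = u" "placed k n E K ys1 s1"
            "cluster_order (tensor_near k n E q) {..<n} (cs @ [u]) \<kappa>1 ys1" "set ys \<subseteq> set ys1"
            "\<And>w. w < n \<Longrightarrow> tensor_near k n E q u w \<Longrightarrow> w \<in> set ys1"
        show "wp W ?inc (Inv (Suc u)) T1 s1"
        proof (rule advance [OF un s1(1) _ s1(2)])
          show "cluster_order near {..<n} (cs @ [u]) \<kappa>1 ys1" using s1(3) by (simp add: near_def)
          show "T1 + 4 \<le> T + 2 + 12 * Suc u + length (cs @ [u]) * c" using T1 u(3) by (simp add: c_def)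
          show "{..<u} \<subseteq> set ys1" using *(3) s1(4) by (rule subset_trans)
          \<comment> \<open>The centre enters its own cluster because nearness is reflexive, which
            is how the prefix of placed vertices grows.\<close>
          show "u \<in> set ys1" using s1(5) un refl by (simp add: near_def)
          show "\<forall>c\<in>set (cs @ [u]). \<forall>w<n. near c w \<longrightarrow> w \<in> set ys1"
            using *(4) s1(4,5) by (auto simp: near_def)
        qed
      qed
    qed
  next
    fix T' s' assume "Inv n T' s'"
    then obtain cs \<kappa> ys where *: "placed k n E K ys s'" "cluster_order near {..<n} cs \<kappa> ys"
      "{..<n} \<subseteq> set ys" and T': "T' \<le> T + 2 + 12 * n + length cs * c"
      unfolding Inv_def by blast
    have order: "cluster_order (tensor_near k n E q) {..<n} cs \<kappa> ys" using *(2) by (simp add: near_def)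
    show "Q (T' + (cost (Bin Minus (Reg 0) (Reg 1)) + 1)) s'"
    proof (rule Q [OF _ *(1) order])
      show "set ys = {..<n}" using *(2,3) by (auto simp: cluster_order_def)
      \<comment> \<open>The packing bound is needed only at the end: it converts the time charged to
        centres into a multiple of \<open>n ^ k\<close>.\<close>
      have "length cs * c \<le> M * c" using M [OF order] by (rule mult_le_mono1)
      also have "M * c = M * (6 * k + 83) * n ^ k" by (simp only: c_def mult.assoc)
      finally have "T' + 4 \<le> T + (12 * n + 6) + M * (6 * k + 83) * n ^ k" using T' by linarith
      also have "12 * n + 6 \<le> 18 * n ^ k" using nk by linarith
      finally show "T' + (cost (Bin Minus (Reg 0) (Reg 1)) + 1) \<le> T + (18 + M * (6 * k + 83)) * n ^ k"
        by (simp add: distrib_right)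
    qed
  next
    have "placed k n E K [] ((fst s)(1 := 0), snd s)" by (rule placed_upd [OF placed]) simp_all
    then show "Inv 0 (T + (cost (Lit 0) + 1)) ((fst s)(1 := val s (Lit 0)), snd s)"
      unfolding Inv_def by (intro conjI exI [of _ "[]"] exI [of _ "\<lambda>_. 0"]) (auto simp: cluster_order_def)
  qed simp
qed

lemma wp_singleton_prog:
  assumes n: "fst s 0 = n" "0 < n" and W: "n + K0 \<le> W"
    and Q: "\<And>T' s'. T' \<le> T + 23 * n \<Longrightarrow> fst s' 0 = n + (K0 - n) \<Longrightarrow> (\<And>v. v < n \<Longrightarrow> snd s' 1 v = v) \<Longrightarrow> Q T' s'"
  shows "wp W (singleton_prog K0) Q T s"
proof -
  define Inv where "Inv v T' s' \<longleftrightarrow> v \<le> n \<and> fst s' 0 = n \<and> fst s' 2 = v \<and> T' \<le> T + 2 + 11 * v \<and>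
      (\<forall>w<v. snd s' 1 w = w)" for v T' and s' :: ram
  show ?thesis
    unfolding singleton_prog_def
  proof (intro wp_Seq wp_Assign wp_Loop [where N = n and Inv = Inv] wp_Store)
    fix v T' s' assume I: "Inv v T' s'"
    then show "v \<le> n \<and> fits W s' (Bin Minus (Reg 0) (Reg 2)) \<and>
        (val s' (Bin Minus (Reg 0) (Reg 2)) \<noteq> 0 \<longleftrightarrow> v < n)"
      using W by (auto simp: Inv_def)
    assume "v < n"
    let ?s = "(fst s', (snd s')(1 := (snd s' 1)(val s' (Reg 2) := val s' (Reg 2))))"
    show "fits W s' (Reg 2)" "fits W s' (Reg 2)" "fits W ?s (Bin Plus (Reg 2) (Lit 1))"
      using I W \<open>v < n\<close> by (auto simp: Inv_def)
    show "Inv (Suc v) (T' + (cost (Bin Minus (Reg 0) (Reg 2)) + 1) + (cost (Reg 2) + cost (Reg 2) + 1) +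
        (cost (Bin Plus (Reg 2) (Lit 1)) + 1)) ((fst ?s)(2 := val ?s (Bin Plus (Reg 2) (Lit 1))), snd ?s)"
      using I \<open>v < n\<close> by (auto simp: Inv_def less_Suc_eq)
  next
    fix T' s' assume I: "Inv n T' s'"
    let ?e = "Bin Plus (Reg 0) (Bin Minus (Lit K0) (Reg 0))"
    show "fits W s' ?e" using I W by (auto simp: Inv_def)
    show "Q (T' + (cost (Bin Minus (Reg 0) (Reg 2)) + 1) + (cost ?e + 1)) ((fst s')(0 := val s' ?e), snd s')"
      by (rule Q) (use I n in \<open>auto simp: Inv_def\<close>)
  qed (use n in \<open>auto simp: Inv_def\<close>)
qed

text \<open>A single constant \<open>C\<close> serves as word bound and as time bound. The summands
  \<open>q\<close>, \<open>K\<close> and \<open>K0\<close> make room for the literals and their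
  products; the others pay for the steps of either branch.\<close>

lemma run_partition_prog:
  assumes "0 < n" "0 < k"
    and M: "\<forall>cs \<kappa> ys. cluster_order (tensor_near k n E q) {..<n} cs \<kappa> ys \<longrightarrow> length cs \<le> M"
    and C: "C = 30 + M * (6 * k + 83) + q + K + K0"
  shows "\<exists>t s. run (C * n ^ k) (partition_prog (k - 1) q K K0) (input k n E) t s \<and> t \<le> C * n ^ k \<and>
    (if n < K then fst s 0 = max n K0 \<and> (\<forall>v<n. snd s 1 v = v)
     else fst s 0 = K \<and> (\<exists>cs \<kappa> ys. cluster_order (tensor_near k n E q) {..<n} cs \<kappa> ys \<and>
       set ys = {..<n} \<and> (\<forall>r<n. snd s 1 (ys ! r) = r * K div n)))"
proof -
  let ?s0 = "input k n E" and ?W = "C * n ^ k"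
  define post where "post T s \<longleftrightarrow> T \<le> ?W \<and>
    (if n < K then fst s 0 = max n K0 \<and> (\<forall>v<n. snd s 1 v = v)
     else fst s 0 = K \<and> (\<exists>cs \<kappa> ys. cluster_order (tensor_near k n E q) {..<n} cs \<kappa> ys \<and>
       set ys = {..<n} \<and> (\<forall>r<n. snd s 1 (ys ! r) = r * K div n)))" for T and s :: ram
  have nk: "n \<le> n ^ k" "1 \<le> n ^ k" using assms(1,2) by (simp_all add: self_le_power Suc_le_eq)
  have mk: "n ^ (k - 1) \<le> n ^ k" using assms(1) by (intro power_increasing) auto
  have mono: "a * b \<le> ?W" if "a \<le> C" "b \<le> n ^ k" for a b using that by (rule mult_le_mono)
  have "n + K0 \<le> (1 + K0) * n ^ k"
    using add_le_mono [OF nk(1) mult_le_mono2 [OF nk(2), of K0]] by simp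
  also have "\<dots> \<le> ?W" by (rule mono) (simp_all add: C)
  finally have "n + K0 \<le> ?W" .
  then have W: "n ^ k \<le> ?W" "K * n \<le> ?W" "K \<le> ?W" "q * n ^ (k - 1) \<le> ?W" "q \<le> ?W" "n + K0 \<le> ?W"
    using mono [of 1 "n ^ k"] mono [of K n, OF _ nk(1)] mono [of K 1, OF _ nk(2)]
      mono [of q "n ^ (k - 1)", OF _ mk] mono [of q 1, OF _ nk(2)]
    by (simp_all add: C)
  have s0: "fst ?s0 0 = n" "placed k n E K [] ?s0" by (simp_all add: input_def placed_def)
  have "wp ?W (partition_prog (k - 1) q K K0) post 0 ?s0"
    unfolding partition_prog_def
  proof (rule wp_Cond)
    show "fits ?W ?s0 (Bin Minus (Lit K) (Reg 0))" using s0 W by auto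
  next
    assume "val ?s0 (Bin Minus (Lit K) (Reg 0)) \<noteq> 0"
    then have "n < K" using s0 by simp
    show "wp ?W (singleton_prog K0) post (0 + (cost (Bin Minus (Lit K) (Reg 0)) + 1)) ?s0"
    proof (rule wp_singleton_prog [OF s0(1) assms(1) W(6)])
      fix T' and s' :: ram
      assume T': "T' \<le> 0 + (cost (Bin Minus (Lit K) (Reg 0)) + 1) + 23 * n"
        and s': "fst s' 0 = n + (K0 - n)" "\<And>v. v < n \<Longrightarrow> snd s' 1 v = v"
      have "T' \<le> 27 * n ^ k" using T' nk by simp
      also have "\<dots> \<le> ?W" by (rule mono) (simp_all add: C)
      finally show "post T' s'" using s' \<open>n < K\<close> by (auto simp: post_def)
    qed
  next
    assume "val ?s0 (Bin Minus (Lit K) (Reg 0)) = 0"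
    then have nK: "\<not> n < K" using s0 by simp
    show "wp ?W (Seq (greedy_prog (k - 1) q K) (Assign 0 (Lit K))) post
        (0 + (cost (Bin Minus (Lit K) (Reg 0)) + 1)) ?s0"
    proof (rule wp_Seq, rule wp_greedy_prog [OF s0(2) assms(1,2) W(1-5) M [rule_format]])
      fix T' s' cs \<kappa> ys
      assume T': "T' \<le> 0 + (cost (Bin Minus (Lit K) (Reg 0)) + 1) + (18 + M * (6 * k + 83)) * n ^ k"
        and s': "placed k n E K ys s'"
        and order: "cluster_order (tensor_near k n E q) {..<n} cs \<kappa> ys" "set ys = {..<n}"
      have len: "length ys = n"
        using order distinct_card [of ys] by (simp add: cluster_order_def)
      show "wp ?W (Assign 0 (Lit K)) post T' s'"
      proof (rule wp_Assign)
        show "fits ?W s' (Lit K)" using W(3) by simp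
        have "T' + 2 \<le> (18 + M * (6 * k + 83)) * n ^ k + 6 * n ^ k" using T' nk(2) by simp
        also have "\<dots> = (24 + M * (6 * k + 83)) * n ^ k" by (simp add: distrib_right)
        also have "\<dots> \<le> ?W" by (rule mono) (simp_all add: C)
        finally show "post (T' + (cost (Lit K) + 1)) ((fst s')(0 := val s' (Lit K)), snd s')"
          unfolding post_def using nK s' order len by (auto simp: placed_def)
      qed
    qed
  qed
  then show ?thesis unfolding wp_def post_def by (simp only: add_0)
qed

section \<open>The regularity lemma\<close>

text \<open>For positive \<open>\<epsilon>\<close> this is the least \<open>q\<close> that
  \<open>irregular_count_arith\<close> admits.\<close>

definition separation :: "nat \<Rightarrow> real \<Rightarrow> nat" where
  "separation k \<epsilon> = nat \<lceil>2 ^ (3 * k + 3) * real k ^ k / \<epsilon>\<^sup>2\<rceil>"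

text \<open>The packing bound with \<open>q * A\<close> in place of \<open>q\<close>, where
  \<open>A = (k - 1) ^ (k - 1)\<close> is the overcount of the tensor distance.\<close>

definition max_clusters :: "nat \<Rightarrow> nat \<Rightarrow> real \<Rightarrow> nat" where
  "max_clusters k d \<epsilon> = 2 * (4 * (d + 1) * (separation k \<epsilon> * (k - 1) ^ (k - 1))) ^ d"

text \<open>The least \<open>K\<close> for which split slices use up at most half of the budget
  \<open>\<epsilon>\<close>.\<close>

definition num_parts :: "nat \<Rightarrow> nat \<Rightarrow> real \<Rightarrow> nat" where
  "num_parts k d \<epsilon> = nat \<lceil>2 * real k * real (max_clusters k d \<epsilon>) / \<epsilon>\<rceil>"

text \<open>Rounding up at most doubles \<open>separation\<close> and \<open>num_parts\<close>. This
  turns the 4 inside the packing bound into 8, and the outer \<open>2 * k * 2\<close> into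
  \<open>8 * k\<close>.\<close>

definition parts_const :: "nat \<Rightarrow> nat \<Rightarrow> real" where
  "parts_const k d = 8 * real k * (8 * real (d + 1) * (2 ^ (3 * k + 3) * real k ^ k) * real ((k - 1) ^ (k - 1))) ^ d"

lemma real_nat_ceiling_bounds:
  assumes "0 \<le> (x::real)"
  shows "x \<le> real (nat \<lceil>x\<rceil>)" "real (nat \<lceil>x\<rceil>) \<le> x + 1"
  using assms by linarith+

lemma separation_bounds:
  assumes "0 < \<epsilon>" "\<epsilon> < 1 / 4" "2 \<le> k"
  shows "2 ^ (3 * k + 3) * real k ^ k \<le> \<epsilon>\<^sup>2 * real (separation k \<epsilon>)"
    and "real (separation k \<epsilon>) \<le> 2 * (2 ^ (3 * k + 3) * real k ^ k) * (1 / \<epsilon>)\<^sup>2"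
    and "0 < separation k \<epsilon>"
proof -
  define a where "a = 2 ^ (3 * k + 3) * real k ^ k"
  have "1 * 1 \<le> 2 ^ (3 * k + 3) * real k ^ k"
    using assms(3) by (intro mult_mono one_le_power) auto
  then have a: "1 \<le> a" by (simp add: a_def)
  have "1 \<le> 1 / \<epsilon>" using assms by (simp add: field_simps)
  then have e: "1 \<le> (1 / \<epsilon>)\<^sup>2" by (rule one_le_power)
  have x: "1 \<le> a * (1 / \<epsilon>)\<^sup>2" using mult_mono [OF a e] a by simp
  have sep: "separation k \<epsilon> = nat \<lceil>a * (1 / \<epsilon>)\<^sup>2\<rceil>"
    by (simp add: separation_def a_def power_divide)
  have bounds: "a * (1 / \<epsilon>)\<^sup>2 \<le> real (separation k \<epsilon>)" "real (separation k \<epsilon>) \<le> a * (1 / \<epsilon>)\<^sup>2 + 1"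
    unfolding sep using real_nat_ceiling_bounds [of "a * (1 / \<epsilon>)\<^sup>2"] x by linarith+
  have "\<epsilon>\<^sup>2 * (a * (1 / \<epsilon>)\<^sup>2) \<le> \<epsilon>\<^sup>2 * real (separation k \<epsilon>)" using bounds(1) by (rule mult_left_mono) simp
  then show "2 ^ (3 * k + 3) * real k ^ k \<le> \<epsilon>\<^sup>2 * real (separation k \<epsilon>)"
    using assms(1) by (simp add: a_def power_divide)
  show "real (separation k \<epsilon>) \<le> 2 * (2 ^ (3 * k + 3) * real k ^ k) * (1 / \<epsilon>)\<^sup>2"
    using bounds(2) x unfolding a_def by linarith
  have "1 \<le> real (separation k \<epsilon>)" using bounds(1) x by linarith
  then show "0 < separation k \<epsilon>" by simp
qed

lemma num_parts_bounds:
  assumes "0 < \<epsilon>" "\<epsilon> < 1 / 4" "2 \<le> k"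
  shows "2 * real k * real (max_clusters k d \<epsilon>) \<le> \<epsilon> * real (num_parts k d \<epsilon>)"
    and "8 / \<epsilon> \<le> real (num_parts k d \<epsilon>)"
    and "real (num_parts k d \<epsilon>) \<le> parts_const k d * (1 / \<epsilon>) ^ (2 * d + 1)"
proof -
  define M where "M = max_clusters k d \<epsilon>"
  define A where "A = (k - 1) ^ (k - 1)"
  define a where "a = 2 ^ (3 * k + 3) * real k ^ k"
  define x where "x = 2 * real k * real M / \<epsilon>"
  have "0 < 4 * (d + 1) * (separation k \<epsilon> * A)" using separation_bounds(3) [OF assms] assms(3) by (simp add: A_def)
  then have "1 \<le> (4 * (d + 1) * (separation k \<epsilon> * A)) ^ d" by (simp add: Suc_le_eq)
  then have M2: "2 \<le> M" by (simp add: M_def max_clusters_def A_def)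
  \<comment> \<open>The lower bound on the number of parts is automatic: \<open>k\<close> and the
    packing bound \<open>M\<close> are both at least 2.\<close>
  have "2 * 2 \<le> real k * real M" using assms(3) M2 by (intro mult_mono) auto
  then have "8 \<le> 2 * real k * real M" unfolding mult.assoc by linarith
  then have x8: "8 / \<epsilon> \<le> x" unfolding x_def using assms(1) by (simp only: divide_right_mono less_imp_le)
  have "1 \<le> 8 / \<epsilon>" using assms by (simp add: field_simps)
  then have x1: "1 \<le> x" using x8 by linarith
  have K: "x \<le> real (num_parts k d \<epsilon>)" "real (num_parts k d \<epsilon>) \<le> x + 1"
    unfolding num_parts_def M_def [symmetric] x_def [symmetric]
    using real_nat_ceiling_bounds [of x] x1 by linarith+
  show "8 / \<epsilon> \<le> real (num_parts k d \<epsilon>)" using x8 K(1) by linarith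
  have "\<epsilon> * x \<le> \<epsilon> * real (num_parts k d \<epsilon>)" using K(1) assms(1) by (intro mult_left_mono) auto
  then show "2 * real k * real (max_clusters k d \<epsilon>) \<le> \<epsilon> * real (num_parts k d \<epsilon>)"
    using assms(1) by (simp add: x_def M_def)
  have "real M = 2 * (4 * real (d + 1) * (real (separation k \<epsilon>) * real A)) ^ d"
    by (simp add: M_def max_clusters_def A_def)
  also have "\<dots> \<le> 2 * (4 * real (d + 1) * (2 * a * (1 / \<epsilon>)\<^sup>2 * real A)) ^ d"
    using separation_bounds(2) [OF assms]
    by (intro mult_left_mono power_mono mult_right_mono) (auto simp: a_def)
  also have "4 * real (d + 1) * (2 * a * (1 / \<epsilon>)\<^sup>2 * real A) = 8 * real (d + 1) * a * real A * (1 / \<epsilon>)\<^sup>2"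
    by simp
  also have "(8 * real (d + 1) * a * real A * (1 / \<epsilon>)\<^sup>2) ^ d =
      (8 * real (d + 1) * a * real A) ^ d * (1 / \<epsilon>) ^ (2 * d)"
    by (simp only: power_mult_distrib power_mult)
  finally have M: "real M \<le> 2 * ((8 * real (d + 1) * a * real A) ^ d * (1 / \<epsilon>) ^ (2 * d))" .
  have "real (num_parts k d \<epsilon>) \<le> 2 * x" using K(2) x1 by linarith
  also have "2 * x = 4 * real k * (1 / \<epsilon>) * real M" by (simp add: x_def)
  also have "\<dots> \<le> 4 * real k * (1 / \<epsilon>) * (2 * ((8 * real (d + 1) * a * real A) ^ d * (1 / \<epsilon>) ^ (2 * d)))"
    using assms(1) by (intro mult_left_mono M) auto
  also have "\<dots> = 8 * real k * (8 * real (d + 1) * a * real A) ^ d * (1 / \<epsilon>) ^ (2 * d + 1)"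
    by (simp only: power_add power_one_right) simp
  finally show "real (num_parts k d \<epsilon>) \<le> parts_const k d * (1 / \<epsilon>) ^ (2 * d + 1)"
    by (simp only: parts_const_def a_def A_def)
qed

text \<open>With \<open>D\<close> left open between two multiples of \<open>set_dist\<close>, the
  same lemma serves the existence proof, where \<open>D\<close> is \<open>set_dist\<close> itself,
  and the algorithm, where it is the tensor distance.\<close>

lemma regular_partition_clusters:
  assumes H: "uniform_hypergraph k V E" and vc: "has_dual_vc_dim k V E d" and "2 \<le> k"
    and \<epsilon>: "0 < \<epsilon>" "\<epsilon> < 1 / 4"
    and D: "\<And>u v. u \<in> V \<Longrightarrow> v \<in> V \<Longrightarrow> set_dist (nbhd k V E u) (nbhd k V E v) \<le> D u v"
      "\<And>u v. u \<in> V \<Longrightarrow> v \<in> V \<Longrightarrow>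
        D u v \<le> (k - 1) ^ (k - 1) * set_dist (nbhd k V E u) (nbhd k V E v)"
    and near: "\<And>u v. near u v \<longleftrightarrow> D u v * separation k \<epsilon> < card V ^ (k - 1)"
    and order: "cluster_order near V cs \<kappa> ys" "set ys = V"
    and K: "num_parts k d \<epsilon> \<le> card V"
  shows "regular_partition (parts_const k d) k d \<epsilon> V E (num_parts k d \<epsilon>)
    (\<lambda>i. (!) ys ` slice (card V) (num_parts k d \<epsilon>) i)"
proof -
  have "0 < k" "0 < (k - 1) ^ (k - 1)" using \<open>2 \<le> k\<close> by auto
  note reg = regular_of_cluster_order [OF H vc this(1) \<epsilon> D this(2) near order
      separation_bounds(1) [OF \<epsilon> \<open>2 \<le> k\<close>] K num_parts_bounds(1) [OF \<epsilon> \<open>2 \<le> k\<close>, of d, unfolded max_clusters_def]]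
  show ?thesis
    unfolding regular_partition_def using reg num_parts_bounds(2,3) [OF \<epsilon> \<open>2 \<le> k\<close>, of d] by blast
qed

text \<open>With fewer vertices than \<open>num_parts\<close> the slices could be empty. Singletons
  make every tuple homogeneous, and empty parts are added only if \<open>n\<close> is below
  \<open>8 / \<epsilon>\<close>. The resulting number of parts does not exceed
  \<open>num_parts\<close>, so it inherits the upper bound.\<close>

lemma regular_partition_singletons:
  assumes H: "uniform_hypergraph k V E" and "2 \<le> k" and \<epsilon>: "0 < \<epsilon>" "\<epsilon> < 1 / 4"
    and bij: "bij_betw y {..<card V} V" and K: "card V < num_parts k d \<epsilon>"
  shows "regular_partition (parts_const k d) k d \<epsilon> V E (max (card V) (nat \<lceil>8 / \<epsilon>\<rceil>))
    (\<lambda>i. y ` {r. r < card V \<and> r = i})"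
proof -
  define n where "n = card V"
  define K where "K = max n (nat \<lceil>8 / \<epsilon>\<rceil>)"
  define P where "P = (\<lambda>i. y ` {r. r < n \<and> r = i})"
  have inj: "inj_on y {..<n}" and img: "y ` {..<n} = V" using bij by (auto simp: bij_betw_def n_def)
  have P: "P i = (if i < n then {y i} else {})" for i by (auto simp: P_def)
  have disj: "disjoint_family_on P {..<K}"
    unfolding disjoint_family_on_def P using inj by (auto simp: inj_on_def)
  have card_P: "finite (P i) \<and> card (P i) \<le> 1" for i by (simp add: P)
  have "8 / \<epsilon> \<le> real (num_parts k d \<epsilon>)" by (rule num_parts_bounds(2) [OF \<epsilon> \<open>2 \<le> k\<close>])
  then have "nat \<lceil>8 / \<epsilon>\<rceil> \<le> num_parts k d \<epsilon>" by (simp add: nat_le_iff ceiling_le_iff)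
  then have "K \<le> num_parts k d \<epsilon>" using K by (simp add: K_def n_def)
  then have Kc: "real K \<le> parts_const k d * (1 / \<epsilon>) ^ (2 * d + 1)"
    using num_parts_bounds(3) [OF \<epsilon> \<open>2 \<le> k\<close>, of d] by linarith
  have "homogeneous \<epsilon> E P I" if "I \<in> nsets {..<K} k" for I
  proof (rule homogeneous_singletons [OF H _ _ _ card_P \<epsilon>(1)])
    have "I \<subseteq> {..<K}" using that by (simp add: nsets_def)
    then show "disjoint_family_on P I" using disj by (rule disjoint_family_on_mono)
  qed (use that in \<open>auto simp: nsets_def\<close>)
  then have none: "{I \<in> nsets {..<K} k. \<not> homogeneous \<epsilon> E P I} = {}" by blast
  have "real (card {I \<in> nsets {..<K} k. \<not> homogeneous \<epsilon> E P I}) \<le> \<epsilon> * real (K choose k)"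
    unfolding none using \<epsilon>(1) by simp
  moreover have "(\<Union>i<K. P i) = V"
  proof -
    have "(\<Union>i<K. {r. r < n \<and> r = i}) = {..<n}" by (auto simp: K_def)
    then have "(\<Union>i<K. P i) = y ` {..<n}" by (simp only: P_def image_UN [symmetric])
    then show ?thesis using img by simp
  qed
  moreover have "card (P i) \<le> card (P j) + 1" for i j using card_P [of i] by simp
  moreover have "P i \<noteq> {}" if "8 / \<epsilon> \<le> real n" "i < K" for i
  proof -
    have "nat \<lceil>8 / \<epsilon>\<rceil> \<le> n" using that(1) by (simp add: nat_le_iff ceiling_le_iff)
    then show ?thesis using that(2) by (simp add: K_def P)
  qed
  moreover have "8 / \<epsilon> \<le> real K" unfolding K_def using real_nat_ceiling_ge [of "8 / \<epsilon>"] by simp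
  ultimately have "regular_partition (parts_const k d) k d \<epsilon> V E K P"
    using disj Kc \<epsilon>(1) by (simp add: regular_partition_def equitable_partition_def n_def)
  then show ?thesis by (simp add: K_def P_def n_def)
qed

theorem theorem3:
  fixes k d :: nat
  assumes "2 \<le> k"
  shows "\<exists>c::real. \<forall>\<epsilon>::real. 0 < \<epsilon> \<and> \<epsilon> < 1 / 4 \<longrightarrow>
    (\<forall>(V :: 'a set) E. uniform_hypergraph k V E \<and> has_dual_vc_dim k V E d \<longrightarrow>
       (\<exists>K P. regular_partition c k d \<epsilon> V E K P)) \<and>
    (\<exists>p C. \<forall>n E. uniform_hypergraph k {..<n} E \<and> has_dual_vc_dim k {..<n} E d \<longrightarrow>
       (\<exists>t s. run (C * n ^ k) p (input k n E) t s \<and> t \<le> C * n ^ k \<and>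
          regular_partition c k d \<epsilon> {..<n} E (output_size s) (output_part n s)))"
proof (intro exI [of _ "parts_const k d"] allI impI conjI)
  fix \<epsilon> :: real and V :: "'a set" and E
  assume "0 < \<epsilon> \<and> \<epsilon> < 1 / 4" and "uniform_hypergraph k V E \<and> has_dual_vc_dim k V E d"
  then have \<epsilon>: "0 < \<epsilon>" "\<epsilon> < 1 / 4" and H: "uniform_hypergraph k V E" and vc: "has_dual_vc_dim k V E d"
    by auto
  have V: "finite V" using H by (simp add: uniform_hypergraph_def)
  show "\<exists>K P. regular_partition (parts_const k d) k d \<epsilon> V E K P"
  proof (cases "card V < num_parts k d \<epsilon>")
    case True
    obtain y where "bij_betw y {0..<card V} V" using ex_bij_betw_nat_finite [OF V] by blast
    then have "bij_betw y {..<card V} V" by (simp add: atLeast0LessThan)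
    from regular_partition_singletons [OF H assms \<epsilon> this True] show ?thesis by blast
  next
    case False
    \<comment> \<open>On an arbitrary vertex type there is no tensor, so the clusters are formed
      with the exact distance.\<close>
    define D where "D u v = set_dist (nbhd k V E u) (nbhd k V E v)" for u v
    define near where "near u v \<longleftrightarrow> D u v * separation k \<epsilon> < card V ^ (k - 1)" for u v
    have "0 < card V" using dual_vc_dim_nonempty [OF vc] V by (simp add: card_gt_0_iff)
    then have "near v v" for v by (simp add: near_def D_def set_dist_def)
    moreover have "near u v = near v u" for u v by (simp add: near_def D_def set_dist_commute)
    ultimately obtain cs \<kappa> ys where "cluster_order near V cs \<kappa> ys" "set ys = V"
      using ex_cluster_order [OF V, of near] by blast
    moreover have "D u v \<le> (k - 1) ^ (k - 1) * set_dist (nbhd k V E u) (nbhd k V E v)" for u v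
    proof -
      have "1 \<le> (k - 1) ^ (k - 1)" using assms by (simp add: Suc_le_eq)
      from mult_le_mono1 [OF this] show ?thesis by (simp add: D_def)
    qed
    ultimately have "regular_partition (parts_const k d) k d \<epsilon> V E (num_parts k d \<epsilon>)
        (\<lambda>i. (!) ys ` slice (card V) (num_parts k d \<epsilon>) i)"
      by (intro regular_partition_clusters [OF H vc assms \<epsilon> _ _ near_def]) (use False in \<open>auto simp: D_def\<close>)
    then show ?thesis by blast
  qed
next
  fix \<epsilon> :: real
  assume "0 < \<epsilon> \<and> \<epsilon> < 1 / 4"
  then have \<epsilon>: "0 < \<epsilon>" "\<epsilon> < 1 / 4" by auto
  \<comment> \<open>The program and \<open>C\<close> are fixed here, before \<open>n\<close> and
    \<open>E\<close>; they depend on \<open>k\<close>, \<open>d\<close> and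
    \<open>\<epsilon>\<close> only.\<close>
  define q K M where "q = separation k \<epsilon>" and "K = num_parts k d \<epsilon>" and "M = max_clusters k d \<epsilon>"
  define K0 where "K0 = nat \<lceil>8 / \<epsilon>\<rceil>"
  define C where "C = 30 + M * (6 * k + 83) + q + K + K0"
  have k: "0 < k" using assms by simp
  have "\<exists>t s. run (C * n ^ k) (partition_prog (k - 1) q K K0) (input k n E) t s \<and> t \<le> C * n ^ k \<and>
      regular_partition (parts_const k d) k d \<epsilon> {..<n} E (output_size s) (output_part n s)"
    if H: "uniform_hypergraph k {..<n} E" and vc: "has_dual_vc_dim k {..<n} E d" for n E
  proof -
    have "0 < n" using dual_vc_dim_nonempty [OF vc] by (cases n) auto
    have D: "set_dist (nbhd k {..<n} E u) (nbhd k {..<n} E v) \<le> tensor_dist k n E u v"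
      "tensor_dist k n E u v \<le> (k - 1) ^ (k - 1) * set_dist (nbhd k {..<n} E u) (nbhd k {..<n} E v)"
      if "u \<in> {..<n}" "v \<in> {..<n}" for u v
      using tensor_dist_bounds [OF H k, of u v] that by simp_all
    have near: "tensor_near k n E q u v \<longleftrightarrow> tensor_dist k n E u v * separation k \<epsilon> < card {..<n} ^ (k - 1)"
      for u v by (simp add: tensor_near_def q_def)
    have M: "\<forall>cs \<kappa> ys. cluster_order (tensor_near k n E q) {..<n} cs \<kappa> ys \<longrightarrow> length cs \<le> M"
      unfolding M_def max_clusters_def
      using cluster_order_length_le [OF _ vc separation_bounds(3) [OF \<epsilon> assms] _ D(2) near] assms
      by simp
    obtain t s where run: "run (C * n ^ k) (partition_prog (k - 1) q K K0) (input k n E) t s" "t \<le> C * n ^ k"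
      and out: "if n < K then fst s 0 = max n K0 \<and> (\<forall>v<n. snd s 1 v = v)
        else fst s 0 = K \<and> (\<exists>cs \<kappa> ys. cluster_order (tensor_near k n E q) {..<n} cs \<kappa> ys \<and>
          set ys = {..<n} \<and> (\<forall>r<n. snd s 1 (ys ! r) = r * K div n))"
      using run_partition_prog [OF \<open>0 < n\<close> k M C_def] by blast
    have "regular_partition (parts_const k d) k d \<epsilon> {..<n} E (output_size s) (output_part n s)"
    proof (cases "n < K")
      case True
      then have s: "fst s 0 = max n K0" "\<forall>v<n. snd s 1 v = v" using out by auto
      have "output_part n s = (\<lambda>i. id ` {r. r < n \<and> r = i})" using s(2) by (auto simp: output_part_def)
      moreover have "bij_betw id {..<card {..<n}} {..<n}" by simp
      ultimately show ?thesis
        using regular_partition_singletons [OF H assms \<epsilon>, of id d] True s(1)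
        by (simp add: output_size_def K_def K0_def)
    next
      case False
      then obtain cs \<kappa> ys where s: "fst s 0 = K" and
        order: "cluster_order (tensor_near k n E q) {..<n} cs \<kappa> ys" "set ys = {..<n}"
        and part: "\<forall>r<n. snd s 1 (ys ! r) = r * K div n" using out by auto
      have len: "length ys = n" using order distinct_card [of ys] by (simp add: cluster_order_def)
      have "output_part n s i = (!) ys ` slice n K i" for i
      proof (intro set_eqI iffI)
        fix v assume "v \<in> output_part n s i"
        then have v: "v \<in> set ys" "snd s 1 v = i" using order(2) by (auto simp: output_part_def)
        obtain r where "r < n" "v = ys ! r" using v(1) len by (metis in_set_conv_nth)
        then show "v \<in> (!) ys ` slice n K i" using part v(2) by (auto simp: slice_def)
      next
        fix v assume "v \<in> (!) ys ` slice n K i"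
        then obtain r where "r < n" "r * K div n = i" "v = ys ! r" by (auto simp: slice_def)
        moreover have "ys ! r < n" using nth_mem [of r ys] order(2) len \<open>r < n\<close> by simp
        ultimately show "v \<in> output_part n s i" using part by (simp add: output_part_def)
      qed
      then have "output_part n s = (\<lambda>i. (!) ys ` slice n K i)" by blast
      moreover have "num_parts k d \<epsilon> \<le> card {..<n}" using False by (simp add: K_def)
      from regular_partition_clusters [OF H vc assms \<epsilon> D near order this]
      have "regular_partition (parts_const k d) k d \<epsilon> {..<n} E K (\<lambda>i. (!) ys ` slice n K i)"
        by (simp add: K_def)
      ultimately show ?thesis by (simp add: output_size_def s)
    qed
    with run show ?thesis by blast
  qed
  then show "\<exists>p C. \<forall>n E. uniform_hypergraph k {..<n} E \<and> has_dual_vc_dim k {..<n} E d \<longrightarrow>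
       (\<exists>t s. run (C * n ^ k) p (input k n E) t s \<and> t \<le> C * n ^ k \<and>
          regular_partition (parts_const k d) k d \<epsilon> {..<n} E (output_size s) (output_part n s))"
    by blast
qed

end
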